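(* Consider the action of $SU(3)$ on the Wolf space $\mathrm{Gr}_2(\mathbb C^4)=SU(4)/S(U(2)\times U(2))$ induced by the standard embedding $SU(3)\subset SU(4)$. With this action, $\mathrm{Gr}_2(\mathbb C^4)$ can be viewed as a cohomogeneity one manifold obtained by gluing together the disc bundles over two copies of the singular orbit $\mathbb{CP}(2)=SU(3)/U(2)$. Each principal orbit is a copy of the exceptional Aloff–Wallach space $N^{1,0}\cong N^{1,-1}$. The form of the metric in the two bundles is the same up to the identification $$e_1\mapsto -e_1,\ e_2\mapsto e_4,\ e_3\mapsto -e_5,\ e_4\mapsto -e_2,\ e_5\mapsto e_3,\ e_6\mapsto e_6,\ e_7\mapsto -e_7,\ e_8\mapsto e_8$$ of $\mathfrak{su}(3)$.
   Context: $SU(3)\subset SU(4)$ is embedded as $A\mapsto\begin{pmatrix}A&\\&1\end{pmatrix}$ and acts on $\mathrm{Gr}_2(\mathbb C^4)$ by restriction of the $SU(4)$-action. Let $E_{k,\ell}$ be the elementary $4\times4$ matrices, $H_j=E_{j,j}-E_{j+1,j+1}$, $X_1=E_{1,2},X_2=E_{1,3},X_3=E_{1,4},X_4=E_{2,3},X_5=E_{2,4},X_6=E_{3,4}$, $Y_j=X_j^T$, and $A_j=iH_j$, $C_j=X_j-Y_j$, $B_j=i(X_j+Y_j)$, a basis of $\mathfrak{su}(4)$. Let $\mathfrak k=\langle i(H_1+H_2+H_3),C_3,B_3\rangle\oplus\langle i(H_1-H_3),iH_2,C_4,B_4\rangle$, and let $K\cong S(U(2)\times U(2))$ be the corresponding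 connected subgroup, so $\mathrm{Gr}_2(\mathbb C^4)=SU(4)/K$. The metric on $\mathrm{Gr}_2(\mathbb C^4)$ is the $SU(4)$-invariant (quaternion-Kähler) symmetric metric induced by minus the Killing form. The basis $e_1,\dots,e_8$ of $\mathfrak{su}(3)\subset\mathfrak{su}(4)$ is $$e_1=A_1+A_2,\ e_2=\tfrac1{\sqrt2}(C_1+C_4),\ e_3=\tfrac1{\sqrt2}(B_1+B_4),\ e_4=\tfrac1{\sqrt2}(C_1-C_4),\ e_5=\tfrac1{\sqrt2}(B_1-B_4),\ e_6=C_2,\ e_7=-B_2,\ e_8=\tfrac1{\sqrt3}(A_1-A_2).$$ The metric is described by pulling it back under the orbit maps $(g,t)\mapsto g\exp(tC_5)K$, $g\in SU(3)$, and expressing it in terms of $dt$ and the left-invariant coframe on $SU(3)$ dual to $e_1,\dots,e_8$; the two singular orbits, over which the two disc bundles lie, are those through $\exp(tC_5)K$ with $t=0$ and $t=\pi/2$. An action is of cohomogeneity one if its principal orbits have codimension one. The Aloff–Wallach space is $N^{k,l}=SU(3)/U(1)_{k,l}$, $U(1)_{k,l}=\{\mathrm{diag}(e^{ik\theta},e^{il\theta},e^{-i(k+l)\theta})\}$. *)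

theory Defs
  imports "HOL-Analysis.Analysis"
begin

section \<open>Matrix groups and Lie algebras\<close>

definition ctranspose :: "complex^'n^'n \<Rightarrow> complex^'n^'n" where
  "ctranspose M = (\<chi> i j. cnj (M $ j $ i))"

definition SU :: "(complex^'n^'n) set" where
  "SU = {g. g ** ctranspose g = mat 1 \<and> det g = 1}"

definition su :: "(complex^'n^'n) set" where
  "su = {M. ctranspose M = - M \<and> trace M = 0}"

definition lie_bracket :: "complex^'n^'n \<Rightarrow> complex^'n^'n \<Rightarrow> complex^'n^'n" where
  "lie_bracket M N = M ** N - N ** M"

primrec matrix_power :: "complex^'n^'n \<Rightarrow> nat \<Rightarrow> complex^'n^'n" where
  "matrix_power M 0 = mat 1"
| "matrix_power M (Suc n) = M ** matrix_power M n"

text \<open>The multiplication of the vector types is componentwise, so the library's \<open>exp\<close> is not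
  available for matrices.\<close>

definition mexp :: "complex^'n^'n \<Rightarrow> complex^'n^'n" where
  "mexp M = (\<Sum>n. (1 / fact n) *\<^sub>R matrix_power M n)"

definition E_mat :: "4 \<Rightarrow> 4 \<Rightarrow> complex^4^4" where
  "E_mat k l = (\<chi> i j. if i = k \<and> j = l then 1 else 0)"

definition i_times :: "complex^4^4 \<Rightarrow> complex^4^4" where
  "i_times M = (\<chi> a b. \<i> * M $ a $ b)"

definition H_mat :: "nat \<Rightarrow> complex^4^4" where
  "H_mat n = [E_mat 1 1 - E_mat 2 2, E_mat 2 2 - E_mat 3 3, E_mat 3 3 - E_mat 4 4] ! (n - 1)"

definition X_mat :: "nat \<Rightarrow> complex^4^4" where
  "X_mat n = [E_mat 1 2, E_mat 1 3, E_mat 1 4, E_mat 2 3, E_mat 2 4, E_mat 3 4] ! (n - 1)"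

definition Y_mat :: "nat \<Rightarrow> complex^4^4" where
  "Y_mat n = transpose (X_mat n)"

definition A_mat :: "nat \<Rightarrow> complex^4^4" where
  "A_mat n = i_times (H_mat n)"

definition C_mat :: "nat \<Rightarrow> complex^4^4" where
  "C_mat n = X_mat n - Y_mat n"

definition B_mat :: "nat \<Rightarrow> complex^4^4" where
  "B_mat n = i_times (X_mat n + Y_mat n)"

definition e_mat :: "nat \<Rightarrow> complex^4^4" where
  "e_mat n =
    [A_mat 1 + A_mat 2,
     (1 / sqrt 2) *\<^sub>R (C_mat 1 + C_mat 4),
     (1 / sqrt 2) *\<^sub>R (B_mat 1 + B_mat 4),
     (1 / sqrt 2) *\<^sub>R (C_mat 1 - C_mat 4),
     (1 / sqrt 2) *\<^sub>R (B_mat 1 - B_mat 4),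
     C_mat 2,
     - B_mat 2,
     (1 / sqrt 3) *\<^sub>R (A_mat 1 - A_mat 2)] ! (n - 1)"

text \<open>The embedding of \<open>SU(3)\<close> as upper left block; the value of the index map at \<open>4\<close> is never
  used.\<close>

definition index3 :: "4 \<Rightarrow> 3" where
  "index3 i = (if i = 1 then 1 else if i = 2 then 2 else 3)"

definition emb :: "complex^3^3 \<Rightarrow> complex^4^4" where
  "emb g = (\<chi> i j. if i = 4 \<or> j = 4 then (if i = j then 1 else 0)
                   else g $ index3 i $ index3 j)"

text \<open>\<open>su(3)\<close> as a subalgebra of \<open>su(4)\<close>.\<close>

definition su3 :: "(complex^4^4) set" where
  "su3 = {M \<in> su. \<forall>i. M $ i $ 4 = 0 \<and> M $ 4 $ i = 0}"

definition k_alg :: "(complex^4^4) set" where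
  "k_alg = span {i_times (H_mat 1 + H_mat 2 + H_mat 3), C_mat 3, B_mat 3,
                 i_times (H_mat 1 - H_mat 3), i_times (H_mat 2), C_mat 4, B_mat 4}"

text \<open>The connected subgroup with Lie algebra \<open>k_alg\<close>: the group generated by its exponentials
  (closed under inverses, as \<open>k_alg\<close> is closed under negation).\<close>

inductive_set K_grp :: "(complex^4^4) set" where
  one: "mat 1 \<in> K_grp"
| step: "\<lbrakk>a \<in> K_grp; M \<in> k_alg\<rbrakk> \<Longrightarrow> a ** mexp M \<in> K_grp"

text \<open>The group \<open>S(U(2) \<times> U(2))\<close>, with the blocks on the index sets \<open>{1,4}\<close> and \<open>{2,3}\<close>.\<close>

definition SU2U2 :: "(complex^4^4) set" where
  "SU2U2 = {g \<in> SU. \<forall>i j. (i \<in> {1,4}) \<noteq> (j \<in> {1,4}) \<longrightarrow> g $ i $ j = 0}"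

section \<open>The Wolf space and its metric\<close>

definition coset :: "complex^4^4 \<Rightarrow> (complex^4^4) set" where
  "coset a = (\<lambda>k. a ** k) ` K_grp"

definition wolf :: "(complex^4^4) set set" where
  "wolf = coset ` SU"

definition Gr2 :: "(complex^4) set set" where
  "Gr2 = {W. vec.subspace W \<and> vec.dim W = 2}"

text \<open>Trace of an endomorphism of a finite-dimensional real subspace; it does not depend on the
  basis chosen.\<close>

definition trace_on :: "'a::real_vector set \<Rightarrow> ('a \<Rightarrow> 'a) \<Rightarrow> real" where
  "trace_on V f =
    (let B = (SOME B. independent B \<and> span B = V) in \<Sum>b\<in>B. representation B (f b) b)"

definition killing :: "complex^4^4 \<Rightarrow> complex^4^4 \<Rightarrow> real" where
  "killing M N = trace_on su (\<lambda>Z. lie_bracket M (lie_bracket N Z))"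

definition p_space :: "(complex^4^4) set" where
  "p_space = {M \<in> su. \<forall>N\<in>k_alg. killing M N = 0}"

definition p_proj :: "complex^4^4 \<Rightarrow> complex^4^4" where
  "p_proj M = (THE Z. Z \<in> p_space \<and> M - Z \<in> k_alg)"

text \<open>The metric at \<open>aK\<close>. A tangent vector at \<open>aK\<close> is the image of a tangent vector
  \<open>U = a M\<close> of \<open>SU(4)\<close> at \<open>a\<close>, with \<open>M\<close> in \<open>su(4)\<close> determined modulo \<open>k_alg\<close>.\<close>

definition wolf_metric :: "complex^4^4 \<Rightarrow> complex^4^4 \<Rightarrow> complex^4^4 \<Rightarrow> real" where
  "wolf_metric a U V = - killing (p_proj (matrix_inv a ** U)) (p_proj (matrix_inv a ** V))"

text \<open>Pull-back of the metric under the orbit map \<open>(g,t) \<mapsto> g \<gamma>(t) K\<close> on \<open>SU(3) \<times> \<real>\<close>, at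
  \<open>(g,t)\<close>, evaluated on two tangent vectors. The pair \<open>(x,\<tau>)\<close> stands for
  \<open>x + \<tau> \<partial>/\<partial>t\<close>, where \<open>x \<in> su(3)\<close> is viewed as a left-invariant vector field on \<open>SU(3)\<close>, so
  that evaluating on the \<open>e_mat\<close> gives the components in the dual coframe.\<close>

definition orbit_map_push ::
  "(real \<Rightarrow> complex^4^4) \<Rightarrow> complex^3^3 \<Rightarrow> real \<Rightarrow> (complex^4^4) \<times> real \<Rightarrow> complex^4^4" where
  "orbit_map_push \<gamma> g t v =
    vector_derivative (\<lambda>s. emb g ** mexp (s *\<^sub>R fst v) ** \<gamma> (t + s * snd v)) (at 0)"

definition pullback_metric ::
  "(real \<Rightarrow> complex^4^4) \<Rightarrow> complex^3^3 \<Rightarrow> real \<Rightarrow> (complex^4^4) \<times> real \<Rightarrow> (complex^4^4) \<times> real \<Rightarrow> real"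
  where
  "pullback_metric \<gamma> g t v w =
    wolf_metric (emb g ** \<gamma> t) (orbit_map_push \<gamma> g t v) (orbit_map_push \<gamma> g t w)"

section \<open>The action of \<open>SU(3)\<close>\<close>

definition act :: "complex^3^3 \<Rightarrow> (complex^4^4) set \<Rightarrow> (complex^4^4) set" where
  "act g Z = (\<lambda>m. emb g ** m) ` Z"

definition orbit :: "(complex^4^4) set \<Rightarrow> (complex^4^4) set set" where
  "orbit Z = (\<lambda>g. act g Z) ` SU"

definition stab :: "(complex^4^4) set \<Rightarrow> (complex^3^3) set" where
  "stab Z = {g \<in> SU. act g Z = Z}"

text \<open>Principal: the isotropy group is subconjugate to every other isotropy group.\<close>

definition principal_at :: "(complex^4^4) set \<Rightarrow> bool" where
  "principal_at Z \<longleftrightarrow>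
    (\<forall>Z'\<in>wolf. \<exists>g\<in>SU. \<forall>h\<in>stab Z. g ** h ** matrix_inv g \<in> stab Z')"

text \<open>The tangent space at \<open>aK\<close> of the orbit through it, after translation by \<open>a\<close> to
  \<open>p_space\<close>, the tangent space of the Wolf space: \<open>exp(sM) a K = a exp(s a\<^sup>-\<^sup>1 M a) K\<close>.\<close>

definition orbit_tangent :: "complex^4^4 \<Rightarrow> (complex^4^4) set" where
  "orbit_tangent a = (\<lambda>M. p_proj (matrix_inv a ** M ** a)) ` su3"

text \<open>Singular: the orbit has smaller dimension than a principal orbit.\<close>

definition singular_at :: "complex^4^4 \<Rightarrow> bool" where
  "singular_at a \<longleftrightarrow>
    (\<exists>b\<in>SU. principal_at (coset b) \<and> dim (orbit_tangent a) < dim (orbit_tangent b))"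

definition pt :: "real \<Rightarrow> (complex^4^4) set" where
  "pt t = coset (mexp (t *\<^sub>R C_mat 5))"

section \<open>Smooth structures\<close>

primrec Ck_on ::
  "nat \<Rightarrow> 'a::euclidean_space set \<Rightarrow> ('a \<Rightarrow> 'b::euclidean_space) \<Rightarrow> bool" where
  "Ck_on 0 U f \<longleftrightarrow> continuous_on U f"
| "Ck_on (Suc n) U f \<longleftrightarrow>
    (\<forall>x\<in>U. f differentiable (at x)) \<and> (\<forall>v. Ck_on n U (\<lambda>x. frechet_derivative f (at x) v))"

text \<open>Smoothness on an arbitrary subset: local extendability to smooth functions on open sets.\<close>

definition smooth_on :: "'a::euclidean_space set \<Rightarrow> ('a \<Rightarrow> real) \<Rightarrow> bool" where
  "smooth_on S f \<longleftrightarrow>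
    (\<forall>x\<in>S. \<exists>U F. open U \<and> x \<in> U \<and> (\<forall>n. Ck_on n U F) \<and> (\<forall>y\<in>S \<inter> U. F y = f y))"

text \<open>All manifolds here (possibly with boundary) are quotients of subsets of Euclidean spaces by
  submersions. Such a quotient is given by a pair \<open>(S, q)\<close>, with points \<open>q ` S\<close>; a function on it
  is smooth iff its lift to \<open>S\<close> is. A diffeomorphism is a bijection that identifies the smooth
  real functions, which determine the smooth structure of a manifold.\<close>

type_synonym ('a, 'x) presentation = "'a set \<times> ('a \<Rightarrow> 'x)"

definition points :: "('a, 'x) presentation \<Rightarrow> 'x set" where
  "points P = snd P ` fst P"

definition smooth_fun :: "('a::euclidean_space, 'x) presentation \<Rightarrow> ('x \<Rightarrow> real) \<Rightarrow> bool" where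
  "smooth_fun P f \<longleftrightarrow> smooth_on (fst P) (f \<circ> snd P)"

definition diffeo ::
  "('a::euclidean_space, 'x) presentation \<Rightarrow> ('b::euclidean_space, 'y) presentation
    \<Rightarrow> ('x \<Rightarrow> 'y) \<Rightarrow> bool" where
  "diffeo P Q F \<longleftrightarrow>
    bij_betw F (points P) (points Q) \<and> (\<forall>f. smooth_fun Q f \<longleftrightarrow> smooth_fun P (f \<circ> F))"

text \<open>\<open>SU(3)\<close>-equivariant diffeomorphism, for the given actions on both sides.\<close>

definition equi_diffeo ::
  "('a::euclidean_space, 'x) presentation \<Rightarrow> (complex^3^3 \<Rightarrow> 'x \<Rightarrow> 'x)
    \<Rightarrow> ('b::euclidean_space, 'y) presentation \<Rightarrow> (complex^3^3 \<Rightarrow> 'y \<Rightarrow> 'y)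
    \<Rightarrow> ('x \<Rightarrow> 'y) \<Rightarrow> bool" where
  "equi_diffeo P \<alpha> Q \<beta> F \<longleftrightarrow>
    diffeo P Q F \<and> (\<forall>g\<in>SU. \<forall>x\<in>points P. F (\<alpha> g x) = \<beta> g (F x))"

text \<open>A submanifold (or domain with boundary) \<open>D\<close> of the Wolf space.\<close>

definition wolf_part :: "(complex^4^4) set set \<Rightarrow> (complex^4^4, (complex^4^4) set) presentation"
  where
  "wolf_part D = ({a \<in> SU. coset a \<in> D}, coset)"

definition hom_space :: "(complex^3^3) set \<Rightarrow> (complex^3^3, (complex^3^3) set) presentation" where
  "hom_space H = (SU, \<lambda>g. (\<lambda>h. g ** h) ` H)"

definition hom_act :: "complex^3^3 \<Rightarrow> (complex^3^3) set \<Rightarrow> (complex^3^3) set" where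
  "hom_act g Z = (\<lambda>m. g ** m) ` Z"

definition U1 :: "int \<Rightarrow> int \<Rightarrow> (complex^3^3) set" where
  "U1 k l = {\<chi> i j. if i \<noteq> j then 0
                     else if i = 1 then cis (real_of_int k * \<theta>)
                     else if i = 2 then cis (real_of_int l * \<theta>)
                     else cis (- real_of_int (k + l) * \<theta>) | \<theta>. True}"

definition aloff_wallach :: "int \<Rightarrow> int \<Rightarrow> (complex^3^3, (complex^3^3) set) presentation" where
  "aloff_wallach k l = hom_space (U1 k l)"

text \<open>\<open>U(2)\<close> inside \<open>SU(3)\<close> as the matrices with diagonal blocks \<open>A\<close> and \<open>1 / det A\<close>.\<close>

definition U2 :: "(complex^3^3) set" where
  "U2 = {g \<in> SU. g $ 1 $ 3 = 0 \<and> g $ 2 $ 3 = 0 \<and> g $ 3 $ 1 = 0 \<and> g $ 3 $ 2 = 0}"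

definition CP2 :: "(complex^3, (complex^3) set) presentation" where
  "CP2 = (- {0}, \<lambda>z. vec.span {z})"

definition line_act :: "complex^3^3 \<Rightarrow> (complex^3) set \<Rightarrow> (complex^3) set" where
  "line_act g L = (\<lambda>z. g *v z) ` L"

section \<open>Disc bundles\<close>

text \<open>Orthogonal representations of \<open>H\<close> on the real vector space underlying \<open>\<complex>\<^sup>2\<close>, and the
  associated closed disc bundle: the quotient of \<open>SU(3) \<times> D\<close>, with \<open>D\<close> the unit disc, by
  \<open>(g h, v) ~ (g, \<rho>(h) v)\<close>.\<close>

definition orth_rep :: "(complex^3^3) set \<Rightarrow> (complex^3^3 \<Rightarrow> complex^2 \<Rightarrow> complex^2) \<Rightarrow> bool" where
  "orth_rep H \<rho> \<longleftrightarrow>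
    (\<forall>h\<in>H. orthogonal_transformation (\<rho> h)) \<and> \<rho> (mat 1) = id \<and>
    (\<forall>h\<in>H. \<forall>k\<in>H. \<rho> (h ** k) = \<rho> h \<circ> \<rho> k) \<and>
    continuous_on (H \<times> UNIV) (\<lambda>(h, v). \<rho> h v)"

definition bundle_class ::
  "(complex^3^3) set \<Rightarrow> (complex^3^3 \<Rightarrow> complex^2 \<Rightarrow> complex^2)
    \<Rightarrow> (complex^3^3) \<times> (complex^2) \<Rightarrow> ((complex^3^3) \<times> (complex^2)) set" where
  "bundle_class H \<rho> = (\<lambda>(g, v). {(g ** matrix_inv h, \<rho> h v) | h. h \<in> H})"

definition disc_bundle ::
  "(complex^3^3) set \<Rightarrow> (complex^3^3 \<Rightarrow> complex^2 \<Rightarrow> complex^2)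
    \<Rightarrow> ((complex^3^3) \<times> (complex^2), ((complex^3^3) \<times> (complex^2)) set) presentation" where
  "disc_bundle H \<rho> = (SU \<times> cball 0 1, bundle_class H \<rho>)"

definition sphere_bundle ::
  "(complex^3^3) set \<Rightarrow> (complex^3^3 \<Rightarrow> complex^2 \<Rightarrow> complex^2)
    \<Rightarrow> ((complex^3^3) \<times> (complex^2)) set set" where
  "sphere_bundle H \<rho> = bundle_class H \<rho> ` (SU \<times> sphere 0 1)"

definition bundle_act ::
  "complex^3^3 \<Rightarrow> ((complex^3^3) \<times> (complex^2)) set \<Rightarrow> ((complex^3^3) \<times> (complex^2)) set" where
  "bundle_act g Z = (\<lambda>(m, v). (g ** m, v)) ` Z"

text \<open>\<open>\<Phi>\<close> identifies the domain \<open>D\<close> equivariantly with a disc bundle over the orbit of \<open>Z\<close>, the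
  zero section being the orbit and the boundary sphere bundle being \<open>S\<close>.\<close>

definition disc_bundle_over ::
  "(complex^4^4) set \<Rightarrow> (complex^4^4) set set \<Rightarrow> (complex^4^4) set set \<Rightarrow> bool" where
  "disc_bundle_over Z D S \<longleftrightarrow>
    (\<exists>\<rho> \<Phi>. orth_rep (stab Z) \<rho> \<and>
       equi_diffeo (disc_bundle (stab Z) \<rho>) bundle_act (wolf_part D) act \<Phi> \<and>
       (\<forall>g\<in>SU. \<Phi> (bundle_class (stab Z) \<rho> (g, 0)) = act g Z) \<and>
       \<Phi> ` sphere_bundle (stab Z) \<rho> = S)"

definition lie_automorphism :: "(complex^4^4) set \<Rightarrow> (complex^4^4 \<Rightarrow> complex^4^4) \<Rightarrow> bool" where
  "lie_automorphism L \<phi> \<longleftrightarrow> linear \<phi> \<and> bij_betw \<phi> L L \<and>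
    (\<forall>x\<in>L. \<forall>y\<in>L. \<phi> (lie_bracket x y) = lie_bracket (\<phi> x) (\<phi> y))"

text \<open>In the two disc bundles the radial coordinate \<open>t\<close> vanishes on the respective singular orbit;
  in the second one it is \<open>\<pi>/2\<close> minus the parameter of \<open>exp(t C\<^sub>5)\<close>.\<close>

definition radial_0 :: "real \<Rightarrow> complex^4^4" where
  "radial_0 t = mexp (t *\<^sub>R C_mat 5)"

definition radial_1 :: "real \<Rightarrow> complex^4^4" where
  "radial_1 t = mexp ((pi / 2 - t) *\<^sub>R C_mat 5)"

end

theory Submission
  imports Defs
begin

text \<open>Write \<open>V\<^sub>0 = \<langle>e\<^sub>1, e\<^sub>4\<rangle>\<close>, so that \<open>aK\<close> corresponds to the plane \<open>a V\<^sub>0\<close> and \<open>exp(t C\<^sub>5) K\<close> to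
  \<open>\<langle>e\<^sub>1, cos t e\<^sub>4 + sin t e\<^sub>2\<rangle>\<close>. The squared length of the projection of \<open>e\<^sub>4\<close> to \<open>a V\<^sub>0\<close> is
  \<open>SU(3)\<close>-invariant and equals \<open>cos\<^sup>2 t\<close>. A plane not contained in \<open>\<complex>\<^sup>3\<close> is \<open>g m(w) V\<^sub>0\<close>, where
  \<open>g \<in> SU(3)\<close> and \<open>m(w)\<close> rotates \<open>e\<^sub>4\<close> to \<open>w + p e\<^sub>4\<close> with \<open>w \<in> \<langle>e\<^sub>2, e\<^sub>3\<rangle>\<close>; the factors can be chosen
  smoothly in \<open>a\<close>, and \<open>(g, w)\<close> is unique up to the isotropy group of \<open>t = 0\<close>. This identifies
  the orbits and the disc bundle over the orbit at \<open>t = 0\<close>; passing to orthogonal planes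
  exchanges \<open>t\<close> and \<open>\<pi>/2 - t\<close> up to \<open>SU(3)\<close>, which gives the other disc bundle. The Killing form of
  \<open>su(4)\<close> is \<open>8 tr(XY)\<close>, so the metric is explicit, and \<open>\<phi>\<close> is conjugation by a signed
  permutation exchanging the indices 1 and 3.\<close>

subsection \<open>Matrices\<close>

text \<open>Diffeomorphisms are certified through smooth functions: a bijection induced by a smooth
  map upstairs is one as soon as that map has smooth local sections. So everything rests on explicit
  formulas for sections. These contain \<open>sqrt (hgt a)\<close>, which is smooth only where
  \<open>hgt\<close> is positive; hence one chart serves all orbits except the one at
  \<open>pi/2\<close>, and there it is transported by right multiplication with
  \<open>J_mat\<close>. A section over the preimage of an orbit in SU(4) can be global even when the
  orbit has none, because \<open>a\<close> remembers a frame of its plane.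

  The symmetry of the metric is visible in the tangent vectors: translated back to the base point,
  \<open>x\<close> in su(3) has the components \<open>cos t * x$1$2\<close>, \<open>x$1$3\<close>,
  \<open>sin t * cos t * x$2$2\<close> and \<open>sin t * x$2$3\<close>. Replacing \<open>t\<close>
  by \<open>pi/2 - t\<close> exchanges the first factor with the last, and so does exchanging the
  indices 1 and 3. The same factors tell which directions collapse on the singular orbits.\<close>

lemma sum_component: "(\<Sum>i\<in>A. f i) $ j = (\<Sum>i\<in>A. f i $ j)"
  by (induct A rule: infinite_finite_induct) auto

lemma matmul_component: "(A ** B) $ i $ j = (\<Sum>k\<in>UNIV. A $ i $ k * B $ k $ j)"
  by (simp add: matrix_matrix_mult_def)

lemma ctranspose_component [simp]: "ctranspose M $ i $ j = cnj (M $ j $ i)"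
  by (simp add: ctranspose_def)

lemma mat_1_component: "mat 1 $ i $ j = (if i = j then 1 else 0)"
  by (simp add: mat_def)

lemmas mat3_simps = vec_eq_iff forall_3 matmul_component sum_3 mat_1_component
lemmas mat4_simps = vec_eq_iff forall_4 matmul_component sum_4 mat_1_component

lemma cmod_eq_1: "z * cnj z = 1 \<Longrightarrow> cmod z = 1"
proof -
  assume "z * cnj z = 1"
  then have "complex_of_real ((cmod z)\<^sup>2) = 1"
    by (simp add: complex_norm_square del: of_real_power)
  then have "(cmod z)\<^sup>2 = 1"
    using of_real_eq_1_iff by blast
  then show ?thesis
    by (simp add: power2_eq_1_iff) (smt (verit) norm_ge_zero)
qed

lemma ctranspose_mult: "ctranspose (A ** B) = ctranspose B ** ctranspose A"
  by (simp add: vec_eq_iff matmul_component mult.commute)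

lemma ctranspose_ctranspose [simp]: "ctranspose (ctranspose A) = A"
  by (simp add: vec_eq_iff)

lemma ctranspose_mat_1 [simp]: "ctranspose (mat 1) = mat 1"
  by (simp add: vec_eq_iff mat_def)

text \<open>Source of the distributive laws, of the product rule for paths of matrices and of the
  smoothness of matrix products.\<close>

lemma bounded_bilinear_matmul:
  "bounded_bilinear ((**) :: complex^'n^'n \<Rightarrow> complex^'n^'n \<Rightarrow> complex^'n^'n)"
  unfolding bilinear_conv_bounded_bilinear [symmetric] bilinear_def
  by (intro conjI allI linearI)
    (simp_all add: vec_eq_iff matmul_component scaleR_sum_right algebra_simps sum.distrib)

lemmas matmul_add_left = bounded_bilinear.add_left [OF bounded_bilinear_matmul]
lemmas matmul_add_right = bounded_bilinear.add_right [OF bounded_bilinear_matmul]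
lemmas matmul_diff_left = bounded_bilinear.diff_left [OF bounded_bilinear_matmul]
lemmas matmul_diff_right = bounded_bilinear.diff_right [OF bounded_bilinear_matmul]
lemmas matmul_minus_left = bounded_bilinear.minus_left [OF bounded_bilinear_matmul]
lemmas matmul_minus_right = bounded_bilinear.minus_right [OF bounded_bilinear_matmul]
lemmas matmul_zero_left = bounded_bilinear.zero_left [OF bounded_bilinear_matmul]
lemmas matmul_zero_right = bounded_bilinear.zero_right [OF bounded_bilinear_matmul]
lemmas matmul_scaleR_left = bounded_bilinear.scaleR_left [OF bounded_bilinear_matmul]
lemmas matmul_scaleR_right = bounded_bilinear.scaleR_right [OF bounded_bilinear_matmul]

lemma bounded_linear_ctranspose:
  "bounded_linear (ctranspose :: complex^'n^'n \<Rightarrow> complex^'n^'n)"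
  unfolding linear_conv_bounded_linear [symmetric]
  by (intro linearI) (simp_all add: vec_eq_iff)

subsection \<open>Special unitary groups\<close>

lemma SU_D1: "g \<in> SU \<Longrightarrow> g ** ctranspose g = mat 1"
  by (simp add: SU_def)

lemma SU_D2: "g \<in> SU \<Longrightarrow> ctranspose g ** g = mat 1"
  by (simp add: SU_def matrix_left_right_inverse)

lemma SU_det: "g \<in> SU \<Longrightarrow> det g = 1"
  by (simp add: SU_def)

lemma SU_cancel:
  assumes "g \<in> SU"
  shows "g ** (ctranspose g ** M) = M" "ctranspose g ** (g ** M) = M"
    "M ** g ** ctranspose g = M" "M ** ctranspose g ** g = M"
  using SU_D1 [OF assms] SU_D2 [OF assms]
  by (simp_all add: matrix_mul_assoc) (simp_all add: matrix_mul_assoc [symmetric])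

lemma mat_1_SU [simp]: "mat 1 \<in> SU"
  by (simp add: SU_def)

lemma det_cnj: "det (\<chi> i j. cnj (M $ i $ j)) = cnj (det M)"
  by (simp add: det_def)

lemma det_ctranspose: "det (ctranspose M) = cnj (det M)"
proof -
  have "ctranspose M = transpose (\<chi> i j. cnj (M $ i $ j))"
    by (simp add: vec_eq_iff transpose_def)
  then show ?thesis
    by (simp add: det_cnj)
qed

lemma mult_SU: "g \<in> SU \<Longrightarrow> h \<in> SU \<Longrightarrow> g ** h \<in> SU"
  unfolding SU_def
  by (auto simp: ctranspose_mult det_mul matrix_mul_assoc)
    (metis matrix_mul_assoc matrix_mul_rid)

lemma ctranspose_SU: "g \<in> SU \<Longrightarrow> ctranspose g \<in> SU"
  using SU_D2 [of g] by (simp add: SU_def det_ctranspose)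

lemma SU_inv_unique: "g \<in> SU \<Longrightarrow> g ** h = mat 1 \<Longrightarrow> h = ctranspose g"
  by (metis SU_cancel(2) matrix_mul_rid)

lemma matrix_inv_SU: "g \<in> SU \<Longrightarrow> matrix_inv g = ctranspose g"
  unfolding matrix_inv_def
  by (rule some_equality) (use SU_D1 SU_D2 in \<open>auto intro: SU_inv_unique\<close>)

lemma unitary_row:
  assumes "g ** ctranspose g = mat 1"
  shows "(\<Sum>k\<in>UNIV. g $ i $ k * cnj (g $ j $ k)) = (if i = j then 1 else 0)"
  using arg_cong [OF assms, of "\<lambda>M. M $ i $ j"] by (simp add: matmul_component mat_def)

lemma unitary_col:
  assumes "g ** ctranspose g = mat 1"
  shows "(\<Sum>k\<in>UNIV. cnj (g $ k $ i) * g $ k $ j) = (if i = j then 1 else 0)"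
proof -
  have "ctranspose g ** g = mat 1"
    using assms by (simp add: matrix_left_right_inverse)
  from arg_cong [OF this, of "\<lambda>M. M $ i $ j"] show ?thesis
    by (simp add: matmul_component mat_def)
qed

subsection \<open>The matrix exponential\<close>

lemma matrix_power_scaleR: "matrix_power (s *\<^sub>R M) n = s ^ n *\<^sub>R matrix_power M n"
  by (induct n) (simp_all add: matmul_scaleR_left matmul_scaleR_right)

text \<open>Bounded bilinearity gives a constant \<open>K\<close> that bounds the norm of a product,
  which is enough for comparison with the exponential series of \<open>norm M * K\<close>.\<close>

lemma summable_mexp: "summable (\<lambda>n. (1 / fact n) *\<^sub>R matrix_power (M :: complex^'n^'n) n)"
proof -
  have "\<exists>K>0. \<forall>(A :: complex^'n^'n) (B :: complex^'n^'n). norm (A ** B) \<le> norm A * norm B * K"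
    by (rule bounded_bilinear.pos_bounded [OF bounded_bilinear_matmul])
  then obtain K where K: "0 < K" "\<And>(A :: complex^'n^'n) (B :: complex^'n^'n). norm (A ** B) \<le> norm A * norm B * K"
    by blast
  let ?c = "norm (mat 1 :: complex^'n^'n)"
  have le: "norm (matrix_power M n) \<le> ?c * (norm M * K) ^ n" for n
  proof (induct n)
    case (Suc n)
    have "norm (matrix_power M (Suc n)) \<le> norm M * norm (matrix_power M n) * K"
      using K by simp
    also have "\<dots> \<le> norm M * (?c * (norm M * K) ^ n) * K"
      using Suc K by (intro mult_left_mono mult_right_mono) auto
    finally show ?case
      by (simp add: algebra_simps)
  qed simp
  have "summable (\<lambda>n. ?c * (inverse (fact n) * (norm M * K) ^ n))"
    by (intro summable_mult summable_exp)
  moreover have "norm ((1 / fact n) *\<^sub>R matrix_power M n) \<le> ?c * (inverse (fact n) * (norm M * K) ^ n)"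
    for n
    using mult_left_mono [OF le [of n], of "inverse (fact n)"] by (simp add: field_simps)
  ultimately show ?thesis
    by (rule summable_comparison_test' [where N = 0])
qed

lemma mexp_0 [simp]: "mexp (0 :: complex^'n^'n) = mat 1"
proof -
  have "(\<lambda>n. (1 / fact n) *\<^sub>R matrix_power (0 :: complex^'n^'n) n) sums (\<Sum>n\<in>{0}. (1 / fact n) *\<^sub>R matrix_power 0 n)"
  proof (rule sums_finite)
    show "(1 / fact n) *\<^sub>R matrix_power (0 :: complex^'n^'n) n = 0" if "n \<notin> {0}" for n
      using that by (cases n) (auto simp: matmul_zero_left)
  qed simp
  then show ?thesis
    by (simp add: mexp_def sums_iff)
qed

lemma bounded_linear_entry: "bounded_linear (\<lambda>M :: complex^'n^'n. M $ i $ j)"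
  by (rule bounded_linear_compose [OF bounded_linear_vec_nth bounded_linear_vec_nth])

text \<open>Each entry is a scalar power series in \<open>s\<close>, so termwise differentiation of
  complex power series becomes available.\<close>

lemma mexp_component:
  "mexp (s *\<^sub>R M) $ i $ j = (\<Sum>n. (1 / fact n) *\<^sub>R (matrix_power M n $ i $ j) * of_real s ^ n)"
  unfolding mexp_def bounded_linear.suminf [OF bounded_linear_entry summable_mexp]
  by (simp add: matrix_power_scaleR scaleR_conv_of_real[where 'a=complex] mult_ac)

lemma matmul_mexp_component:
  "(M ** mexp (s *\<^sub>R M)) $ i $ j =
    (\<Sum>n. (1 / fact n) *\<^sub>R (matrix_power M (Suc n) $ i $ j) * of_real s ^ n)"
  unfolding mexp_def
    bounded_linear.suminf [OF bounded_linear_compose [OF bounded_linear_entry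
      bounded_bilinear.bounded_linear_right [OF bounded_bilinear_matmul]] summable_mexp]
  by (simp add: matrix_power_scaleR scaleR_conv_of_real[where 'a=complex] mult_ac matmul_scaleR_right)

lemma has_vector_derivative_entries:
  fixes f :: "real \<Rightarrow> complex^'n^'n"
  assumes "\<And>i j. ((\<lambda>t. f t $ i $ j) has_vector_derivative f' $ i $ j) (at t)"
  shows "(f has_vector_derivative f') (at t)"
  unfolding has_vector_derivative_def has_derivative_componentwise_within [of f]
proof
  fix b :: "complex^'n^'n"
  assume "b \<in> Basis"
  then obtain i j c where b: "b = axis i (axis j c)"
    by (auto simp: Basis_vec_def)
  have "((\<lambda>t. f t $ i $ j) has_derivative (\<lambda>x. x *\<^sub>R f' $ i $ j)) (at t)"
    using assms by (simp add: has_vector_derivative_def)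
  from has_derivative_inner_left [OF this, of c]
  show "((\<lambda>x. f x \<bullet> b) has_derivative (\<lambda>x. x *\<^sub>R f' \<bullet> b)) (at t)"
    by (simp add: b inner_axis)
qed

lemma mexp_has_vector_derivative:
  "((\<lambda>s. mexp (s *\<^sub>R M)) has_vector_derivative M ** mexp (s *\<^sub>R M)) (at s)"
proof (rule has_vector_derivative_entries)
  fix i j
  define c where "c n = (1 / fact n) *\<^sub>R (matrix_power M n $ i $ j)" for n
  have "summable (\<lambda>n. c n * z ^ n)" for z :: complex
  proof -
    have "summable (\<lambda>n. c n * of_real r ^ n)" for r :: real
      using bounded_linear.summable [OF bounded_linear_entry summable_mexp, of "r *\<^sub>R M" i j]
      by (simp add: c_def matrix_power_scaleR scaleR_conv_of_real[where 'a=complex] mult_ac)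
    from this [of "norm z + 1"] show ?thesis
      by (rule powser_inside) simp
  qed
  from termdiffs_strong_converges_everywhere [OF this, of "of_real s"]
  have "((\<lambda>x. \<Sum>n. c n * x ^ n) has_field_derivative (\<Sum>n. diffs c n * of_real s ^ n)) (at (of_real s))" .
  moreover have "diffs c n = (1 / fact n) *\<^sub>R (matrix_power M (Suc n) $ i $ j)" for n
    by (simp add: diffs_def c_def scaleR_conv_of_real[where 'a=complex] field_simps del: of_nat_Suc)
  ultimately have "((\<lambda>x. \<Sum>n. c n * x ^ n) has_field_derivative (M ** mexp (s *\<^sub>R M)) $ i $ j)
    (at (of_real s))"
    by (simp add: matmul_mexp_component)
  from has_vector_derivative_real_field [OF this]
  show "((\<lambda>s. mexp (s *\<^sub>R M) $ i $ j) has_vector_derivative (M ** mexp (s *\<^sub>R M)) $ i $ j) (at s)"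
    by (simp add: mexp_component c_def)
qed

text \<open>Serves twice: in the differential equations for \<open>mexp\<close>, and to transfer
  linear conditions expressible as commutation from a matrix to its exponential.\<close>

lemma mexp_commutes:
  assumes "A ** M = M ** A"
  shows "A ** mexp M = mexp M ** A"
proof -
  have p: "A ** matrix_power M n = matrix_power M n ** A" for n
  proof (induct n)
    case (Suc n)
    have "A ** (M ** matrix_power M n) = M ** (A ** matrix_power M n)"
      by (simp only: matrix_mul_assoc assms)
    then show ?case
      by (simp only: Suc matrix_power.simps matrix_mul_assoc)
  qed simp
  show ?thesis
    unfolding mexp_def
      bounded_linear.suminf [OF bounded_bilinear.bounded_linear_right [OF bounded_bilinear_matmul] summable_mexp]
      bounded_linear.suminf [OF bounded_bilinear.bounded_linear_left [OF bounded_bilinear_matmul] summable_mexp]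
    by (simp add: p matmul_scaleR_left matmul_scaleR_right)
qed

lemma has_vector_derivative_zero_constant:
  fixes f :: "real \<Rightarrow> 'a::real_normed_vector"
  assumes "\<And>t. (f has_vector_derivative 0) (at t)"
  shows "f t = f 0"
  using has_derivative_zero_unique [of UNIV f 0 t] assms by (simp add: has_vector_derivative_def)

lemma mexp_minus_cancel: "mexp (- s *\<^sub>R M) ** mexp (s *\<^sub>R M) = mat 1"
proof -
  have "((\<lambda>s. mexp (- s *\<^sub>R M) ** mexp (s *\<^sub>R M)) has_vector_derivative 0) (at t)" for t
  proof -
    have "((\<lambda>s. mexp (- s *\<^sub>R M) ** mexp (s *\<^sub>R M)) has_vector_derivative
       mexp (- t *\<^sub>R M) ** (M ** mexp (t *\<^sub>R M)) + (- M ** mexp (- t *\<^sub>R M)) ** mexp (t *\<^sub>R M)) (at t)"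
      using mexp_has_vector_derivative [of "- M"]
      by (intro bounded_bilinear.has_vector_derivative [OF bounded_bilinear_matmul]
          mexp_has_vector_derivative) simp
    moreover have "M ** mexp (- t *\<^sub>R M) = mexp (- t *\<^sub>R M) ** M"
      by (rule mexp_commutes) (simp add: matmul_scaleR_left matmul_scaleR_right matmul_minus_left matmul_minus_right)
    ultimately show ?thesis
      by (simp add: matmul_minus_left matrix_mul_assoc)
  qed
  from has_vector_derivative_zero_constant [OF this, of s] show ?thesis
    by simp
qed

text \<open>By the product rule \<open>mexp (- s *\<^sub>R M) ** R s\<close> has derivative zero.
  From here on the series can be forgotten: additivity, adjoints and closed forms of exponentials
  follow by exhibiting a solution of the equation.\<close>

lemma mexp_unique:
  assumes der: "\<And>t. (R has_vector_derivative M ** R t) (at t)" and "R 0 = mat 1"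
  shows "R t = mexp (t *\<^sub>R M)"
proof -
  have "((\<lambda>s. mexp (- s *\<^sub>R M) ** R s) has_vector_derivative 0) (at t)" for t
  proof -
    have "((\<lambda>s. mexp (- s *\<^sub>R M) ** R s) has_vector_derivative
       mexp (- t *\<^sub>R M) ** (M ** R t) + (- M ** mexp (- t *\<^sub>R M)) ** R t) (at t)"
      using mexp_has_vector_derivative [of "- M"]
      by (intro bounded_bilinear.has_vector_derivative [OF bounded_bilinear_matmul] der) simp
    moreover have "M ** mexp (- t *\<^sub>R M) = mexp (- t *\<^sub>R M) ** M"
      by (rule mexp_commutes) (simp add: matmul_scaleR_left matmul_scaleR_right matmul_minus_left matmul_minus_right)
    ultimately show ?thesis
      by (simp add: matmul_minus_left matrix_mul_assoc)
  qed
  from has_vector_derivative_zero_constant [OF this, of t]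
  have 1: "mexp (- t *\<^sub>R M) ** R t = mat 1"
    by (simp add: assms(2))
  have 2: "mexp (t *\<^sub>R M) ** mexp (- t *\<^sub>R M) = mat 1"
    using mexp_minus_cancel [of "- t" M] by simp
  show ?thesis
    using arg_cong [OF 1, of "(**) (mexp (t *\<^sub>R M))"] using 2 by (simp add: matrix_mul_assoc)
qed

lemma mexp_add: "mexp ((s + t) *\<^sub>R M) = mexp (s *\<^sub>R M) ** mexp (t *\<^sub>R M)"
proof -
  have "mexp ((u + t) *\<^sub>R M) ** mexp (- t *\<^sub>R M) = mexp (u *\<^sub>R M)" for u
  proof (rule mexp_unique)
    show "((\<lambda>u. mexp ((u + t) *\<^sub>R M) ** mexp (- t *\<^sub>R M)) has_vector_derivative
      M ** (mexp ((u + t) *\<^sub>R M) ** mexp (- t *\<^sub>R M))) (at u)" for u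
    proof -
      have "((\<lambda>u. mexp ((u + t) *\<^sub>R M)) has_vector_derivative 1 *\<^sub>R (M ** mexp ((u + t) *\<^sub>R M))) (at u)"
        by (rule vector_diff_chain_at [where f = "\<lambda>u. u + t" and g = "\<lambda>u. mexp (u *\<^sub>R M)", unfolded o_def])
          (auto intro!: mexp_has_vector_derivative derivative_eq_intros)
      from bounded_linear.has_vector_derivative [OF bounded_bilinear.bounded_linear_left [OF bounded_bilinear_matmul] this]
      show ?thesis
        by (simp add: matrix_mul_assoc)
    qed
    show "mexp ((0 + t) *\<^sub>R M) ** mexp (- t *\<^sub>R M) = mat 1"
      using mexp_minus_cancel [of "- t" M] by simp
  qed
  from arg_cong [OF this [of s], of "\<lambda>A. A ** mexp (t *\<^sub>R M)"]
  show ?thesis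
    using mexp_minus_cancel [of t M] by (simp add: matrix_mul_assoc [symmetric])
qed

lemma ctranspose_mexp: "ctranspose (mexp M) = mexp (ctranspose M)"
proof -
  have "ctranspose (mexp (t *\<^sub>R M)) = mexp (t *\<^sub>R ctranspose M)" for t
  proof (rule mexp_unique)
    show "((\<lambda>t. ctranspose (mexp (t *\<^sub>R M))) has_vector_derivative
      ctranspose M ** ctranspose (mexp (t *\<^sub>R M))) (at t)" for t
      using bounded_linear.has_vector_derivative [OF bounded_linear_ctranspose mexp_has_vector_derivative [of M t]]
        mexp_commutes [of M "t *\<^sub>R M"]
      by (simp add: ctranspose_mult [symmetric] matmul_scaleR_left matmul_scaleR_right)
  qed simp
  from this [of 1] show ?thesis by simp
qed

text \<open>In the Leibniz formula only the identity contributes: any other permutation moves at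
  least two points, so after one factor has been differentiated an off-diagonal entry of the
  identity matrix remains.\<close>

lemma has_derivative_det_at_1:
  fixes R :: "real \<Rightarrow> complex^'n^'n"
  assumes R: "(R has_vector_derivative M) (at 0)" and R0: "R 0 = mat 1"
  shows "((\<lambda>h. det (R h)) has_vector_derivative trace M) (at 0)"
proof -
  have e: "((\<lambda>h. R h $ i $ j) has_derivative (\<lambda>h. h *\<^sub>R (M $ i $ j))) (at 0)" for i j
    using bounded_linear.has_vector_derivative [OF bounded_linear_entry R]
    by (simp add: has_vector_derivative_def)
  define D where "D p = (\<Sum>i\<in>UNIV. M $ i $ p i * (\<Prod>j\<in>UNIV - {i}. mat 1 $ j $ p j))" for p :: "'n \<Rightarrow> 'n"
  have "((\<lambda>h. \<Prod>i\<in>UNIV. R h $ i $ p i) has_derivative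
      (\<lambda>h. \<Sum>i\<in>UNIV. h *\<^sub>R (M $ i $ p i) * (\<Prod>j\<in>UNIV - {i}. R 0 $ j $ p j))) (at 0)" for p
    by (rule has_derivative_prod [OF e])
  then have prd: "((\<lambda>h. \<Prod>i\<in>UNIV. R h $ i $ p i) has_vector_derivative D p) (at 0)" for p
    by (simp add: has_vector_derivative_def D_def R0 scaleR_sum_right)
  have "((\<lambda>h. det (R h)) has_vector_derivative
      (\<Sum>p\<in>{p. p permutes UNIV}. of_int (sign p) * D p)) (at 0)"
    unfolding det_def
    by (intro has_vector_derivative_sum bounded_linear.has_vector_derivative [OF bounded_linear_mult_right] prd)
  moreover have "D p = 0" if p: "p permutes UNIV" "p \<noteq> id" for p
  proof -
    obtain a where a: "p a \<noteq> a"
      using p by (auto simp: fun_eq_iff)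
    have pa: "p (p a) \<noteq> p a"
      using a permutes_inj [OF p(1)] by (auto dest: injD)
    have z: "(\<Prod>j\<in>UNIV - {i}. mat 1 $ j $ p j) = (0 :: complex)" for i
    proof -
      have "\<exists>b\<in>UNIV - {i}. p b \<noteq> b"
        using a pa by (intro bexI [of _ "if a = i then p a else a"]) auto
      then obtain b where b: "b \<in> UNIV - {i}" "p b \<noteq> b"
        by blast
      then have "mat 1 $ b $ p b = (0 :: complex)"
        by (simp add: mat_def)
      with b(1) show ?thesis
        by (intro prod_zero) auto
    qed
    show ?thesis
      unfolding D_def by (intro sum.neutral ballI) (simp only: z mult_zero_right)
  qed
  then have "(\<Sum>p\<in>{p. p permutes UNIV}. of_int (sign p) * D p) = D id"
    using sum.mono_neutral_right [of "{p. p permutes (UNIV :: 'n set)}" "{id}" "\<lambda>p. of_int (sign p) * D p"]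
    by (auto simp: permutes_id)
  moreover have "D id = trace M"
    by (simp add: D_def trace_def mat_def)
  ultimately show ?thesis by simp
qed

text \<open>Multiplicativity of \<open>det\<close> along the one-parameter group moves the
  derivative at \<open>t\<close> to the derivative at 0; a scalar linear differential equation
  remains.\<close>

lemma det_mexp: "det (mexp M) = exp (trace M)"
proof -
  have der: "((\<lambda>t. det (mexp (t *\<^sub>R M))) has_vector_derivative trace M * det (mexp (t *\<^sub>R M))) (at t)" for t
  proof -
    have "((\<lambda>h. mexp (h *\<^sub>R M)) has_vector_derivative M) (at 0)"
      using mexp_has_vector_derivative [of M 0] by simp
    then have "((\<lambda>h. det (mexp (h *\<^sub>R M))) has_vector_derivative trace M) (at (t - t))"
      by (simp add: has_derivative_det_at_1)
    then have "((\<lambda>h. det (mexp ((h - t) *\<^sub>R M))) has_vector_derivative 1 *\<^sub>R trace M) (at t)"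
      by (intro vector_diff_chain_at [where f = "\<lambda>h. h - t" and g = "\<lambda>h. det (mexp (h *\<^sub>R M))", unfolded o_def])
        (auto intro!: derivative_eq_intros)
    from bounded_linear.has_vector_derivative [OF bounded_linear_mult_left this, of "det (mexp (t *\<^sub>R M))"]
    show ?thesis
      by (simp add: det_mul [symmetric] mexp_add [symmetric])
  qed
  have "((\<lambda>t. det (mexp (t *\<^sub>R M)) * exp (- (t *\<^sub>R trace M))) has_vector_derivative 0) (at t)" for t
  proof -
    have "((\<lambda>t. exp (t *\<^sub>R (- trace M))) has_vector_derivative exp (t *\<^sub>R (- trace M)) * (- trace M)) (at t)"
      by (rule exp_scaleR_has_vector_derivative_right)
    from has_vector_derivative_mult [OF der this]
    show ?thesis by simp
  qed
  from has_vector_derivative_zero_constant [OF this, of 1]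
  show ?thesis by (simp add: exp_minus field_simps)
qed

lemma mexp_SU: "M \<in> su \<Longrightarrow> mexp M \<in> SU"
  using mexp_minus_cancel [of "- 1" M] by (simp add: SU_def su_def ctranspose_mexp det_mexp)

lemma mexp_matrix_diagonal:
  fixes d :: "'n::finite \<Rightarrow> real"
  shows "mexp (\<chi> i j. if i = j then \<i> * of_real (d i) else 0) = (\<chi> i j. if i = j then cis (d i) else 0)"
proof -
  let ?M = "\<chi> i j. if i = j then \<i> * of_real (d i) else 0 :: complex^'n^'n"
  have "(\<chi> i j. if i = j then cis (t * d i) else 0) = mexp (t *\<^sub>R ?M)" for t
  proof (rule mexp_unique)
    have 1: "((\<lambda>t. cis (t * d i)) has_vector_derivative \<i> * of_real (d i) * cis (t * d i)) (at t)" for t i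
      unfolding cis_conv_exp
      using exp_scaleR_has_vector_derivative_right [of "\<i> * of_real (d i)" t]
      by (simp add: scaleR_conv_of_real mult_ac)
    show "((\<lambda>t. \<chi> i j. if i = j then cis (t * d i) else 0) has_vector_derivative
       ?M ** (\<chi> i j. if i = j then cis (t * d i) else 0)) (at t)" for t
      by (rule has_vector_derivative_entries)
        (auto simp: matmul_component 1 if_distrib[of "\<lambda>x. x * _"] if_distrib[of "(*) _"] cong: if_cong)
  qed (simp add: vec_eq_iff mat_def)
  from this [of 1] show ?thesis by (simp only: scaleR_one mult_1)
qed

subsection \<open>Smooth maps\<close>

text \<open>The congruence property is a premise because its own inductive proof applies this rule
  one level lower.\<close>

lemma Ck_on_SucI:
  fixes f :: "'a::euclidean_space \<Rightarrow> 'b::euclidean_space"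
  assumes "\<And>x. x \<in> U \<Longrightarrow> (f has_derivative f' x) (at x)" "\<And>v. Ck_on n U (\<lambda>x. f' x v)"
    and cong: "\<And>(g :: 'a \<Rightarrow> 'b) h. Ck_on n U g \<Longrightarrow> (\<And>x. x \<in> U \<Longrightarrow> h x = g x) \<Longrightarrow> Ck_on n U h"
  shows "Ck_on (Suc n) U f"
proof -
  have "frechet_derivative f (at x) v = f' x v" if "x \<in> U" for x v
    using frechet_derivative_at [OF assms(1) [OF that]] by simp
  then have "Ck_on n U (\<lambda>x. frechet_derivative f (at x) v)" for v
    by (rule cong [OF assms(2) [of v]])
  then show ?thesis
    using assms(1) by (auto simp: differentiable_def)
qed

lemma Ck_on_cong:
  assumes "open U"
  shows "Ck_on n U g \<Longrightarrow> (\<And>x. x \<in> U \<Longrightarrow> h x = g x) \<Longrightarrow> Ck_on n U h"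
proof (induct n arbitrary: g h)
  case 0
  then show ?case
    by (simp cong: continuous_on_cong)
next
  case (Suc n)
  show ?case
  proof (rule Ck_on_SucI)
    fix x assume "x \<in> U"
    then have "(g has_derivative frechet_derivative g (at x)) (at x)"
      using Suc(2) by (simp add: frechet_derivative_works)
    then show "(h has_derivative frechet_derivative g (at x)) (at x)"
      by (rule has_derivative_transform_within_open [OF _ assms \<open>x \<in> U\<close>]) (simp add: Suc(3))
  qed (use Suc in auto)
qed

lemma Ck_on_SucI':
  assumes "open U" "\<And>x. x \<in> U \<Longrightarrow> (f has_derivative f' x) (at x)" "\<And>v. Ck_on n U (\<lambda>x. f' x v)"
  shows "Ck_on (Suc n) U f"
  using Ck_on_SucI [of U f f' n] Ck_on_cong assms by blast

lemma Ck_on_SucD: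
  "Ck_on (Suc n) U f \<Longrightarrow> x \<in> U \<Longrightarrow> (f has_derivative frechet_derivative f (at x)) (at x)"
  by (simp add: frechet_derivative_works)

lemma Ck_on_Suc_imp: "Ck_on (Suc n) U f \<Longrightarrow> Ck_on n U f"
proof (induct n arbitrary: f)
  case 0
  then show ?case
    by (auto intro!: continuous_at_imp_continuous_on differentiable_imp_continuous_within)
next
  case (Suc n)
  then show ?case
    by (metis Ck_on.simps(2))
qed

lemma Ck_on_subset: "Ck_on n U f \<Longrightarrow> V \<subseteq> U \<Longrightarrow> Ck_on n V f"
  by (induct n arbitrary: f) (auto intro: continuous_on_subset)

lemma Ck_on_const: "Ck_on n U (\<lambda>x. c)"
  by (induct n arbitrary: c) auto

lemma Ck_on_add:
  assumes "open U"
  shows "Ck_on n U f \<Longrightarrow> Ck_on n U g \<Longrightarrow> Ck_on n U (\<lambda>x. f x + g x)"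
proof (induct n arbitrary: f g)
  case 0
  then show ?case by (auto intro: continuous_intros)
next
  case (Suc n)
  show ?case
    by (rule Ck_on_SucI' [OF assms has_derivative_add [OF Ck_on_SucD Ck_on_SucD]])
      (use Suc in auto)
qed

lemma Ck_on_sum:
  assumes "open U" "finite I"
  shows "(\<And>i. i \<in> I \<Longrightarrow> Ck_on n U (f i)) \<Longrightarrow> Ck_on n U (\<lambda>x. \<Sum>i\<in>I. f i x)"
  using assms(2) by (induct I rule: finite_induct) (auto intro: Ck_on_const Ck_on_add [OF assms(1)])

lemma Ck_on_linear_compose:
  assumes "open U" "bounded_linear L"
  shows "Ck_on n U f \<Longrightarrow> Ck_on n U (\<lambda>x. L (f x))"
proof (induct n arbitrary: f)
  case 0
  then show ?case
    using linear_continuous_on_compose [of U f L] assms(2) by (simp add: linear_conv_bounded_linear)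
next
  case (Suc n)
  show ?case
    by (rule Ck_on_SucI' [OF assms(1) bounded_linear.has_derivative [OF assms(2) Ck_on_SucD]])
      (use Suc in auto)
qed

lemma Ck_on_ident: "open U \<Longrightarrow> Ck_on n U (\<lambda>x. x)"
  by (cases n) (auto intro!: Ck_on_SucI' [of U _ "\<lambda>x v. v"] Ck_on_const)

lemma Ck_on_bilinear:
  assumes "open U" "bounded_bilinear B"
  shows "Ck_on n U f \<Longrightarrow> Ck_on n U g \<Longrightarrow> Ck_on n U (\<lambda>x. B (f x) (g x))"
proof (induct n arbitrary: f g)
  case 0
  then show ?case
    by (auto intro: bounded_bilinear.continuous_on [OF assms(2)])
next
  case (Suc n)
  note Suc(2,3) [THEN Ck_on_Suc_imp]
  then show ?case
    by (intro Ck_on_SucI' [OF assms(1) bounded_bilinear.FDERIV [OF assms(2) Ck_on_SucD Ck_on_SucD]])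
      (use Suc in \<open>auto intro!: Ck_on_add [OF assms(1)]\<close>)
qed

text \<open>An arbitrary real exponent lets the induction close, since differentiation lowers it by
  one. Square roots and reciprocals are the cases \<open>1/2\<close> and \<open>-1\<close>.\<close>

lemma Ck_on_powr:
  fixes f :: "'a::euclidean_space \<Rightarrow> real"
  assumes "open U"
  shows "Ck_on n U f \<Longrightarrow> (\<And>x. x \<in> U \<Longrightarrow> 0 < f x) \<Longrightarrow> Ck_on n U (\<lambda>x. f x powr a)"
proof (induct n arbitrary: f a)
  case 0
  then show ?case
    by (force intro!: continuous_intros)
next
  case (Suc n)
  show ?case
  proof (rule Ck_on_SucI' [OF assms])
    fix x assume x: "x \<in> U"
    have "((\<lambda>y. y powr a) has_real_derivative a * f x powr (a - 1)) (at (f x))"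
      using Suc(3) [OF x] by (rule has_real_derivative_powr)
    from has_derivative_compose [OF Ck_on_SucD [OF Suc(2) x] this [unfolded has_field_derivative_def]]
    show "((\<lambda>x. f x powr a) has_derivative
      (\<lambda>v. a * f x powr (a - 1) * frechet_derivative f (at x) v)) (at x)" .
  next
    fix v
    show "Ck_on n U (\<lambda>x. a * f x powr (a - 1) * frechet_derivative f (at x) v)"
      using Suc Ck_on_Suc_imp [OF Suc(2)]
      by (intro Ck_on_bilinear [OF assms bounded_bilinear_mult] Ck_on_const) auto
  qed
qed

lemma Ck_on_compose:
  assumes "open U" "open V"
  shows "Ck_on n V g \<Longrightarrow> Ck_on n U f \<Longrightarrow> f ` U \<subseteq> V \<Longrightarrow> Ck_on n U (\<lambda>x. g (f x))"
proof (induct n arbitrary: g)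
  case 0
  then show ?case
    by (auto intro: continuous_on_compose2)
next
  case (Suc n)
  show ?case
  proof (rule Ck_on_SucI' [OF assms(1)])
    fix x assume x: "x \<in> U"
    then have "(g has_derivative frechet_derivative g (at (f x))) (at (f x))"
      using Suc(2,4) by (intro Ck_on_SucD) auto
    from has_derivative_compose [OF Ck_on_SucD [OF Suc(3) x] this]
    show "((\<lambda>x. g (f x)) has_derivative
      (\<lambda>v. frechet_derivative g (at (f x)) (frechet_derivative f (at x) v))) (at x)" .
  next
    fix v
    \<comment> \<open>The chain rule applies the derivative of \<open>g\<close> to a direction
      depending on \<open>x\<close>, whereas \<open>Ck_on\<close> speaks of fixed directions.
      Expanding over \<open>Basis\<close> turns it into a sum of scalar coefficients times
      derivatives in fixed directions.\<close>
    have "Ck_on n U (\<lambda>x. \<Sum>b\<in>Basis. (frechet_derivative f (at x) v \<bullet> b) *\<^sub>R frechet_derivative g (at (f x)) b)"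
    proof (intro Ck_on_sum [OF assms(1)] Ck_on_bilinear [OF assms(1) bounded_bilinear_scaleR])
      show "Ck_on n U (\<lambda>x. frechet_derivative f (at x) v \<bullet> b)" for b
        using Suc(3) by (intro Ck_on_linear_compose [OF assms(1) bounded_linear_inner_left]) auto
      show "Ck_on n U (\<lambda>x. frechet_derivative g (at (f x)) b)" for b
        using Suc Ck_on_Suc_imp [OF Suc(3)] by (intro Suc(1)) auto
    qed simp
    then show "Ck_on n U (\<lambda>x. frechet_derivative g (at (f x)) (frechet_derivative f (at x) v))"
    proof (rule Ck_on_cong [OF assms(1)])
      fix x assume "x \<in> U"
      then have "(g has_derivative frechet_derivative g (at (f x))) (at (f x))"
        using Suc(2,4) by (intro Ck_on_SucD) auto
      then have lin: "linear (frechet_derivative g (at (f x)))"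
        by (rule has_derivative_linear)
      let ?w = "frechet_derivative f (at x) v"
      have "frechet_derivative g (at (f x)) ?w = frechet_derivative g (at (f x)) (\<Sum>b\<in>Basis. (?w \<bullet> b) *\<^sub>R b)"
        by (simp only: euclidean_representation)
      also have "\<dots> = (\<Sum>b\<in>Basis. (?w \<bullet> b) *\<^sub>R frechet_derivative g (at (f x)) b)"
        by (simp only: linear_sum [OF lin] linear_scale [OF lin])
      finally show "frechet_derivative g (at (f x)) ?w =
        (\<Sum>b\<in>Basis. (?w \<bullet> b) *\<^sub>R frechet_derivative g (at (f x)) b)" .
    qed
  qed
qed

text \<open>Openness is built in, so that the rules for products and composites carry no separate
  premise for it.\<close>

definition Cinf_on :: "'a::euclidean_space set \<Rightarrow> ('a \<Rightarrow> 'b::euclidean_space) \<Rightarrow> bool" where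
  "Cinf_on U f \<longleftrightarrow> open U \<and> (\<forall>n. Ck_on n U f)"

lemma Cinf_on_open: "Cinf_on U f \<Longrightarrow> open U"
  by (simp add: Cinf_on_def)

lemma Cinf_on_continuous: "Cinf_on U f \<Longrightarrow> continuous_on U f"
  unfolding Cinf_on_def by (metis Ck_on.simps(1))

lemma Cinf_on_subset: "Cinf_on U f \<Longrightarrow> open V \<Longrightarrow> V \<subseteq> U \<Longrightarrow> Cinf_on V f"
  by (auto simp: Cinf_on_def intro: Ck_on_subset)

lemma Cinf_on_const: "open U \<Longrightarrow> Cinf_on U (\<lambda>x. c)"
  by (simp add: Cinf_on_def Ck_on_const)

lemma Cinf_on_ident: "open U \<Longrightarrow> Cinf_on U (\<lambda>x. x)"
  by (simp add: Cinf_on_def Ck_on_ident)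

lemma Cinf_on_add: "Cinf_on U f \<Longrightarrow> Cinf_on U g \<Longrightarrow> Cinf_on U (\<lambda>x. f x + g x)"
  by (simp add: Cinf_on_def Ck_on_add)

lemma Cinf_on_sum:
  "open U \<Longrightarrow> finite I \<Longrightarrow> (\<And>i. i \<in> I \<Longrightarrow> Cinf_on U (f i)) \<Longrightarrow> Cinf_on U (\<lambda>x. \<Sum>i\<in>I. f i x)"
  by (simp add: Cinf_on_def Ck_on_sum)

lemma Cinf_on_linear_compose: "bounded_linear L \<Longrightarrow> Cinf_on U f \<Longrightarrow> Cinf_on U (\<lambda>x. L (f x))"
  by (simp add: Cinf_on_def Ck_on_linear_compose)

lemma Cinf_on_bilinear:
  "bounded_bilinear B \<Longrightarrow> Cinf_on U f \<Longrightarrow> Cinf_on U g \<Longrightarrow> Cinf_on U (\<lambda>x. B (f x) (g x))"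
  by (simp add: Cinf_on_def Ck_on_bilinear)

lemma Cinf_on_compose:
  "Cinf_on V g \<Longrightarrow> Cinf_on U f \<Longrightarrow> f ` U \<subseteq> V \<Longrightarrow> Cinf_on U (\<lambda>x. g (f x))"
  by (auto simp: Cinf_on_def intro: Ck_on_compose)

lemmas Cinf_on_mult = Cinf_on_bilinear [OF bounded_bilinear_mult]
lemmas Cinf_on_scaleR = Cinf_on_bilinear [OF bounded_bilinear_scaleR]
lemmas Cinf_on_matmul = Cinf_on_bilinear [OF bounded_bilinear_matmul]
lemmas Cinf_on_ctranspose = Cinf_on_linear_compose [OF bounded_linear_ctranspose]
lemmas Cinf_on_nth = Cinf_on_linear_compose [OF bounded_linear_vec_nth]
lemmas Cinf_on_cnj = Cinf_on_linear_compose [OF bounded_linear_cnj]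
lemmas Cinf_on_of_real = Cinf_on_linear_compose [OF bounded_linear_of_real]
lemmas Cinf_on_uminus = Cinf_on_linear_compose [OF bounded_linear_minus [OF bounded_linear_ident]]
lemmas Cinf_on_fst = Cinf_on_linear_compose [OF bounded_linear_fst]
lemmas Cinf_on_snd = Cinf_on_linear_compose [OF bounded_linear_snd]
lemmas Cinf_on_inner = Cinf_on_bilinear [OF bounded_bilinear_inner]

lemma Cinf_on_diff: "Cinf_on U f \<Longrightarrow> Cinf_on U g \<Longrightarrow> Cinf_on U (\<lambda>x. f x - g x)"
  using Cinf_on_add [OF _ Cinf_on_uminus, of U f g] by simp

lemma Cinf_on_norm_power2: "Cinf_on U f \<Longrightarrow> Cinf_on U (\<lambda>x. (norm (f x))\<^sup>2)"
  unfolding power2_norm_eq_inner by (rule Cinf_on_inner)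

lemma Cinf_on_sqrt:
  assumes "Cinf_on U f" "\<And>x. x \<in> U \<Longrightarrow> 0 < f x"
  shows "Cinf_on U (\<lambda>x. sqrt (f x))"
  unfolding Cinf_on_def
proof (intro conjI allI)
  show "open U" using assms(1) by (rule Cinf_on_open)
  fix n
  have "Ck_on n U (\<lambda>x. f x powr (1 / 2))"
    using assms by (intro Ck_on_powr) (auto simp: Cinf_on_def)
  then show "Ck_on n U (\<lambda>x. sqrt (f x))"
    by (rule Ck_on_cong [OF \<open>open U\<close>]) (use assms(2) in \<open>simp add: powr_half_sqrt less_imp_le\<close>)
qed

lemma Cinf_on_inverse:
  fixes f :: "'a::euclidean_space \<Rightarrow> real"
  assumes "Cinf_on U f" "\<And>x. x \<in> U \<Longrightarrow> 0 < f x"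
  shows "Cinf_on U (\<lambda>x. inverse (f x))"
  unfolding Cinf_on_def
proof (intro conjI allI)
  show "open U" using assms(1) by (rule Cinf_on_open)
  fix n
  have "Ck_on n U (\<lambda>x. f x powr (- 1))"
    using assms by (intro Ck_on_powr) (auto simp: Cinf_on_def)
  then show "Ck_on n U (\<lambda>x. inverse (f x))"
    by (rule Ck_on_cong [OF \<open>open U\<close>]) (use assms(2) in \<open>simp add: powr_minus less_imp_le\<close>)
qed

lemma Cinf_on_vec_lambda:
  fixes f :: "'n::finite \<Rightarrow> 'a::euclidean_space \<Rightarrow> 'b::euclidean_space"
  assumes "\<And>i. Cinf_on U (f i)"
  shows "Cinf_on U (\<lambda>x. \<chi> i. f i x)"
proof -
  have "bounded_linear (axis i :: 'b \<Rightarrow> 'b^'n)" for i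
    unfolding linear_conv_bounded_linear [symmetric]
    by (intro linearI) (auto simp: vec_eq_iff axis_def)
  from Cinf_on_sum [OF Cinf_on_open [OF assms] finite Cinf_on_linear_compose [OF this assms]]
  have "Cinf_on U (\<lambda>x. \<Sum>i\<in>UNIV. axis i (f i x))" .
  moreover have "(\<Sum>i\<in>UNIV. axis i (f i x)) = (\<chi> i. f i x)" for x
    by (simp add: vec_eq_iff sum_component axis_def if_distrib cong: if_cong)
  ultimately show ?thesis by simp
qed

lemma Cinf_on_Pair:
  assumes "Cinf_on U f" "Cinf_on U g"
  shows "Cinf_on U (\<lambda>x. (f x, g x))"
proof -
  have "bounded_linear (\<lambda>a :: 'b. (a, 0 :: 'c))" "bounded_linear (\<lambda>b :: 'c. (0 :: 'b, b))"
    by (intro bounded_linear_Pair bounded_linear_ident bounded_linear_zero)+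
  from Cinf_on_add [OF Cinf_on_linear_compose [OF this(1) assms(1)] Cinf_on_linear_compose [OF this(2) assms(2)]]
  show ?thesis by simp
qed

lemmas Cinf_intros = Cinf_on_const Cinf_on_ident Cinf_on_add Cinf_on_diff Cinf_on_uminus Cinf_on_mult
  Cinf_on_scaleR Cinf_on_matmul Cinf_on_ctranspose Cinf_on_nth Cinf_on_cnj Cinf_on_of_real
  Cinf_on_fst Cinf_on_snd Cinf_on_norm_power2 Cinf_on_sqrt Cinf_on_inverse Cinf_on_vec_lambda Cinf_on_Pair

lemma Cinf_on_if:
  "(c \<Longrightarrow> Cinf_on U f) \<Longrightarrow> (\<not> c \<Longrightarrow> Cinf_on U g) \<Longrightarrow> Cinf_on U (\<lambda>x. if c then f x else g x)"
  by (cases c) simp_all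

lemma smooth_on_cong: "smooth_on S f \<Longrightarrow> (\<And>x. x \<in> S \<Longrightarrow> g x = f x) \<Longrightarrow> smooth_on S g"
  unfolding smooth_on_def by (metis IntD1)

lemma smooth_onE:
  assumes "smooth_on S f" "x \<in> S"
  obtains U F where "open U" "x \<in> U" "\<forall>n. Ck_on n U F" "\<forall>y\<in>S \<inter> U. F y = f y"
  using bspec [OF assms(1) [unfolded smooth_on_def] assms(2)] by (elim exE conjE) (rule that)

lemma smooth_on_local:
  assumes "\<And>x. x \<in> S \<Longrightarrow> \<exists>U. open U \<and> x \<in> U \<and> smooth_on (S \<inter> U) f"
  shows "smooth_on S f"
  unfolding smooth_on_def
proof
  fix x assume "x \<in> S"
  with assms obtain U where U: "open U" "x \<in> U" "smooth_on (S \<inter> U) f" by blast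
  with \<open>x \<in> S\<close> obtain V F where V: "open V" "x \<in> V" "\<forall>n. Ck_on n V F" "\<forall>y \<in> S \<inter> U \<inter> V. F y = f y"
    using smooth_onE [OF U(3)] by blast
  show "\<exists>U F. open U \<and> x \<in> U \<and> (\<forall>n. Ck_on n U F) \<and> (\<forall>y\<in>S \<inter> U. F y = f y)"
    by (rule exI [of _ "U \<inter> V"], rule exI [of _ F]) (use U V in \<open>auto intro: Ck_on_subset\<close>)
qed

lemma smooth_on_pullback:
  assumes "smooth_on T h" "Cinf_on U \<phi>" "S \<subseteq> U" "\<phi> ` S \<subseteq> T"
  shows "smooth_on S (h \<circ> \<phi>)"
  unfolding smooth_on_def
proof
  fix x assume x: "x \<in> S"
  with assms(4) have "\<phi> x \<in> T" by blast
  then obtain V F where V: "open V" "\<phi> x \<in> V" "\<forall>n. Ck_on n V F" "\<forall>y \<in> T \<inter> V. F y = h y"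
    by (rule smooth_onE [OF assms(1)])
  let ?W = "U \<inter> \<phi> -` V"
  have W: "open ?W"
    using continuous_open_preimage [OF Cinf_on_continuous [OF assms(2)] Cinf_on_open [OF assms(2)] V(1)]
    by (simp add: Int_commute)
  have "Ck_on n ?W (\<lambda>y. F (\<phi> y))" for n
  proof (rule Ck_on_compose [OF W V(1)])
    show "Ck_on n V F" using V(3) by blast
    have "Ck_on n U \<phi>" using assms(2) by (simp add: Cinf_on_def)
    then show "Ck_on n ?W \<phi>" by (rule Ck_on_subset) blast
  qed blast
  then show "\<exists>U F. open U \<and> x \<in> U \<and> (\<forall>n. Ck_on n U F) \<and> (\<forall>y\<in>S \<inter> U. F y = (h \<circ> \<phi>) y)"
    using W x V assms(3,4) by (intro exI [of _ ?W] exI [of _ "\<lambda>y. F (\<phi> y)"]) auto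
qed

text \<open>The sections \<open>\<psi>\<close> are local because \<open>SU(3) \<rightarrow> CP(2)\<close> has no global one.\<close>

lemma equi_diffeo_exI:
  assumes \<phi>: "Cinf_on U \<phi>" "S \<subseteq> U" "\<phi> ` S \<subseteq> T"
    and inj: "\<And>x y. x \<in> S \<Longrightarrow> y \<in> S \<Longrightarrow> q x = q y \<longleftrightarrow> r (\<phi> x) = r (\<phi> y)"
    and \<psi>: "\<And>y. y \<in> T \<Longrightarrow> \<exists>V \<psi>. y \<in> V \<and> Cinf_on V \<psi> \<and> (\<forall>z \<in> T \<inter> V. \<psi> z \<in> S \<and> r (\<phi> (\<psi> z)) = r z)"
    and act: "\<And>g x. g \<in> SU \<Longrightarrow> x \<in> S \<Longrightarrow> \<exists>y\<in>S. \<alpha> g (q x) = q y \<and> \<beta> g (r (\<phi> x)) = r (\<phi> y)"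
  shows "\<exists>F. equi_diffeo (S, q) \<alpha> (T, r) \<beta> F \<and> (\<forall>x\<in>S. F (q x) = r (\<phi> x))"
proof -
  define F where "F p = r (\<phi> (SOME x. x \<in> S \<and> q x = p))" for p
  have F: "F (q x) = r (\<phi> x)" if "x \<in> S" for x
  proof -
    have "\<exists>y. y \<in> S \<and> q y = q x"
      using that by blast
    then have "(SOME y. y \<in> S \<and> q y = q x) \<in> S \<and> q (SOME y. y \<in> S \<and> q y = q x) = q x"
      by (rule someI_ex)
    then show ?thesis
      unfolding F_def using inj that by blast
  qed
  have "bij_betw F (q ` S) (r ` T)"
  proof (rule bij_betw_imageI)
    show "inj_on F (q ` S)"
      by (auto simp: inj_on_def F inj)
    show "F ` q ` S = r ` T"
    proof
      show "F ` q ` S \<subseteq> r ` T"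
        using \<phi>(3) by (auto simp: F)
      show "r ` T \<subseteq> F ` q ` S"
      proof clarify
        fix y assume "y \<in> T"
        with \<psi> obtain V \<psi> where "y \<in> V" "\<forall>z \<in> T \<inter> V. \<psi> z \<in> S \<and> r (\<phi> (\<psi> z)) = r z" by blast
        with \<open>y \<in> T\<close> have "\<psi> y \<in> S" "F (q (\<psi> y)) = r y"
          by (auto simp: F)
        then show "r y \<in> F ` q ` S"
          by (metis imageI)
      qed
    qed
  qed
  moreover have "smooth_on T (f \<circ> r) \<longleftrightarrow> smooth_on S ((f \<circ> F) \<circ> q)" for f :: "_ \<Rightarrow> real"
  proof
    assume "smooth_on T (f \<circ> r)"
    from smooth_on_pullback [OF this \<phi>]
    show "smooth_on S ((f \<circ> F) \<circ> q)"
      by (rule smooth_on_cong) (simp add: F)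
  next
    assume s: "smooth_on S ((f \<circ> F) \<circ> q)"
    show "smooth_on T (f \<circ> r)"
    proof (rule smooth_on_local)
      fix y assume "y \<in> T"
      with \<psi> obtain V \<psi> where V: "y \<in> V" "Cinf_on V \<psi>" "\<forall>z \<in> T \<inter> V. \<psi> z \<in> S \<and> r (\<phi> (\<psi> z)) = r z" by blast
      then have "smooth_on (T \<inter> V) (((f \<circ> F) \<circ> q) \<circ> \<psi>)"
        by (intro smooth_on_pullback [OF s V(2)]) auto
      then have "smooth_on (T \<inter> V) (f \<circ> r)"
        by (rule smooth_on_cong) (use V(3) in \<open>auto simp: F\<close>)
      then show "\<exists>U. open U \<and> y \<in> U \<and> smooth_on (T \<inter> U) (f \<circ> r)"
        using V Cinf_on_open by blast
    qed
  qed
  moreover have "F (\<alpha> g (q x)) = \<beta> g (F (q x))" if "g \<in> SU" "x \<in> S" for g x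
    using act [OF that] that by (auto simp: F)
  ultimately show ?thesis
    by (intro exI [of _ F]) (auto simp: equi_diffeo_def diffeo_def points_def smooth_fun_def F)
qed

section \<open>Determinants of order four and entries of the basis matrices\<close>

lemma det_4:
  "det (A::'a::comm_ring_1^4^4) =
    A$1$1 * (A$2$2 * A$3$3 * A$4$4 + A$2$3 * A$3$4 * A$4$2 + A$2$4 * A$3$2 * A$4$3
      - A$2$2 * A$3$4 * A$4$3 - A$2$3 * A$3$2 * A$4$4 - A$2$4 * A$3$3 * A$4$2) -
    A$1$2 * (A$2$1 * A$3$3 * A$4$4 + A$2$3 * A$3$4 * A$4$1 + A$2$4 * A$3$1 * A$4$3
      - A$2$1 * A$3$4 * A$4$3 - A$2$3 * A$3$1 * A$4$4 - A$2$4 * A$3$3 * A$4$1) +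
    A$1$3 * (A$2$1 * A$3$2 * A$4$4 + A$2$2 * A$3$4 * A$4$1 + A$2$4 * A$3$1 * A$4$2
      - A$2$1 * A$3$4 * A$4$2 - A$2$2 * A$3$1 * A$4$4 - A$2$4 * A$3$2 * A$4$1) -
    A$1$4 * (A$2$1 * A$3$2 * A$4$3 + A$2$2 * A$3$3 * A$4$1 + A$2$3 * A$3$1 * A$4$2
      - A$2$1 * A$3$3 * A$4$2 - A$2$2 * A$3$1 * A$4$3 - A$2$3 * A$3$2 * A$4$1)"
proof -
  have f1: "finite {2::4, 3, 4}" "1 \<notin> {2::4, 3, 4}"
    by auto
  have f2: "finite {3::4, 4}" "2 \<notin> {3::4, 4}"
    by auto
  have f3: "finite {4::4}" "3 \<notin> {4::4}"
    by auto
  show ?thesis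
    unfolding det_def UNIV_4
    unfolding sum_over_permutations_insert [OF f1]
    unfolding sum_over_permutations_insert [OF f2]
    unfolding sum_over_permutations_insert [OF f3]
    unfolding permutes_sing
    by (simp add: sign_swap_id permutation_swap_id permutation_compose sign_compose sign_id swap_id_eq)
      (simp add: algebra_simps)
qed

lemma E_mat_component: "E_mat k l $ i $ j = (if i = k \<and> j = l then 1 else 0)"
  by (simp add: E_mat_def)

lemma i_times_component: "i_times M $ i $ j = \<i> * M $ i $ j"
  by (simp add: i_times_def)

lemma transpose_component: "transpose M $ i $ j = M $ j $ i"
  by (simp add: transpose_def)

lemmas basis_mat_defs = H_mat_def X_mat_def Y_mat_def A_mat_def B_mat_def C_mat_def

lemma C_mat_eq: "C_mat 3 = E_mat 1 4 - E_mat 4 1" "C_mat 4 = E_mat 2 3 - E_mat 3 2"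
  "C_mat 5 = E_mat 2 4 - E_mat 4 2"
  by (simp_all add: basis_mat_defs vec_eq_iff transpose_component E_mat_component)

subsection \<open>The isotropy group\<close>

text \<open>The zero entries off the blocks {1,4} and {2,3} are listed one by one so that each can
  act as a rewrite rule.\<close>

definition blk :: "complex^4^4 \<Rightarrow> bool" where
  "blk M \<longleftrightarrow> M$1$2 = 0 \<and> M$1$3 = 0 \<and> M$2$1 = 0 \<and> M$2$4 = 0 \<and>
    M$3$1 = 0 \<and> M$3$4 = 0 \<and> M$4$2 = 0 \<and> M$4$3 = 0"

lemma blk_iff: "blk M \<longleftrightarrow> (\<forall>i j. (i \<in> {1,4}) \<noteq> (j \<in> {1,4}) \<longrightarrow> M $ i $ j = 0)"
  by (simp add: blk_def forall_4)

lemma SU2U2_iff: "g \<in> SU2U2 \<longleftrightarrow> g \<in> SU \<and> blk g"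
  by (simp add: SU2U2_def blk_iff)

lemma blk_mult: "blk M \<Longrightarrow> blk N \<Longrightarrow> blk (M ** N)"
  by (simp add: blk_def matmul_component sum_4)

lemma blk_ctranspose: "blk M \<Longrightarrow> blk (ctranspose M)"
  by (simp add: blk_def)

lemma SU2U2_mult: "g \<in> SU2U2 \<Longrightarrow> h \<in> SU2U2 \<Longrightarrow> g ** h \<in> SU2U2"
  by (simp add: SU2U2_iff mult_SU blk_mult)

lemma SU2U2_ctranspose: "g \<in> SU2U2 \<Longrightarrow> ctranspose g \<in> SU2U2"
  by (simp add: SU2U2_iff ctranspose_SU blk_ctranspose)

lemma SU2U2_one: "mat 1 \<in> SU2U2"
  by (simp add: SU2U2_iff blk_def mat_1_component)

lemma su_iff: "M \<in> su \<longleftrightarrow> (\<forall>i j. cnj (M $ j $ i) = - M $ i $ j) \<and> trace M = 0"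
  by (simp add: su_def vec_eq_iff)

lemma trace_4: "trace (M :: complex^4^4) = M$1$1 + M$2$2 + M$3$3 + M$4$4"
  by (simp add: trace_def sum_4)

lemma subspace_su: "subspace (su :: (complex^'n^'n) set)"
proof -
  have s: "subspace {M :: complex^'n^'n. ctranspose M + M = 0} " "subspace {M :: complex^'n^'n. trace M = 0}"
    by (auto simp: subspace_def vec_eq_iff trace_def sum.distrib algebra_simps simp flip: scaleR_sum_right)
      (metis scaleR_add_right scaleR_zero_right)
  have "su = {M :: complex^'n^'n. ctranspose M + M = 0} \<inter> {M. trace M = 0}"
    by (auto simp: su_def eq_neg_iff_add_eq_0)
  then show ?thesis
    using subspace_inter [OF s] by simp
qed

lemma su_diag: "M \<in> su \<Longrightarrow> M $ i $ i = \<i> * of_real (Im (M $ i $ i))"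
  unfolding su_iff by (metis complex_cnj_cancel_iff complex_eq_iff Re_complex_of_real Im_complex_of_real
    cnj.simps(1) uminus_complex.sel(1) mult.commute Re_i_times Im_i_times add.inverse_neutral
    equation_minus_iff neg_equal_iff_equal neg_equal_0_iff_equal equal_neg_zero)

text \<open>Replaces the span of seven generators by linear conditions on entries, the only form in
  which the subalgebra is used afterwards.\<close>

lemma k_alg_eq: "k_alg = {M \<in> su. blk M}"
proof
  have "subspace {M. blk M}"
    by (auto simp: subspace_def blk_def)
  then have "subspace {M \<in> su. blk M}"
    using subspace_inter [OF subspace_su] by (simp add: Collect_conj_eq)
  then show "k_alg \<subseteq> {M \<in> su. blk M}"
    unfolding k_alg_def
    by (rule span_minimal [rotated])
      (simp add: su_iff forall_4 blk_def basis_mat_defs i_times_component E_mat_component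
        transpose_component trace_4)
  show "{M \<in> su. blk M} \<subseteq> k_alg"
  proof clarify
    fix M assume M: "M \<in> su" "blk M"
    define x where "x i = Im (M $ i $ i)" for i
    have d: "M $ i $ i = \<i> * of_real (x i)" for i
      using su_diag [OF M(1)] by (simp add: x_def)
    have tr: "x 2 + x 3 = - x 1 - x 4"
      using M(1) by (simp add: su_iff trace_4 x_def complex_eq_iff)
    have s: "M$4$1 = - cnj (M$1$4)" "M$3$2 = - cnj (M$2$3)"
      using M(1) by (simp_all add: su_iff)
    \<comment> \<open>The diagonal generators are \<open>i\<close> times diag(1,0,0,-1),
      diag(1,-1,-1,1) and diag(0,1,-1,0); their coefficients solve the system for the diagonal with
      the help of the vanishing trace.\<close>
    have "M = ((x 1 - x 4) / 2) *\<^sub>R i_times (H_mat 1 + H_mat 2 + H_mat 3) + Re (M$1$4) *\<^sub>R C_mat 3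
      + Im (M$1$4) *\<^sub>R B_mat 3 + ((x 1 + x 4) / 2) *\<^sub>R i_times (H_mat 1 - H_mat 3)
      + ((x 2 - x 3) / 2) *\<^sub>R i_times (H_mat 2) + Re (M$2$3) *\<^sub>R C_mat 4 + Im (M$2$3) *\<^sub>R B_mat 4"
      using M(2) tr by (simp add: vec_eq_iff forall_4 basis_mat_defs i_times_component E_mat_component
        transpose_component d s blk_def complex_eq_iff field_simps)
    also have "\<dots> \<in> k_alg"
      unfolding k_alg_def by (intro span_add span_scale span_base) auto
    finally show "M \<in> k_alg" .
  qed
qed

text \<open>Being block diagonal means commuting with the sign matrix of the two blocks, and this
  passes to the exponential.\<close>

lemma mexp_k_alg: "M \<in> k_alg \<Longrightarrow> mexp M \<in> SU2U2"
proof -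
  assume M: "M \<in> k_alg"
  define J :: "complex^4^4" where "J = (\<chi> i j. if i = j then (if i \<in> {1,4} then 1 else -1) else 0)"
  have J: "J ** A = A ** J \<longleftrightarrow> blk A" for A
    by (auto simp: mat4_simps J_def blk_def)
  have "blk (mexp M)"
    using mexp_commutes [of J M] J M by (simp add: k_alg_eq)
  then show ?thesis
    using M by (simp add: SU2U2_iff k_alg_eq mexp_SU)
qed

text \<open>Membership in \<open>K_grp\<close> may thus be tested after right multiplication by
  exponentials, as the reduction to diagonal form does.\<close>

lemma K_grp_cancel:
  assumes "a ** mexp M \<in> K_grp" "M \<in> k_alg"
  shows "a \<in> K_grp"
proof -
  have "- M \<in> k_alg"
    using assms(2) unfolding k_alg_def by (rule span_neg)
  from K_grp.step [OF assms(1) this] show ?thesis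
    using mexp_minus_cancel [of "- 1" M] by (simp add: matrix_mul_assoc [symmetric])
qed

text \<open>The closed form solves the differential equation of \<open>mexp_unique\<close>. It
  covers \<open>C_mat 3\<close> and \<open>C_mat 4\<close> in the isotropy algebra as well as the
  geodesic direction \<open>C_mat 5\<close>.\<close>

lemma mexp_rotation:
  assumes "p \<noteq> q"
  shows "mexp (t *\<^sub>R (E_mat p q - E_mat q p)) =
    (\<chi> i j. if i = j then (if i = p \<or> i = q then of_real (cos t) else 1)
            else if i = p \<and> j = q then of_real (sin t)
            else if i = q \<and> j = p then - of_real (sin t) else 0)"
proof -
  define R :: "real \<Rightarrow> complex^4^4" where
    "R t = (\<chi> i j. if i = j then (if i = p \<or> i = q then of_real (cos t) else 1)
            else if i = p \<and> j = q then of_real (sin t)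
            else if i = q \<and> j = p then - of_real (sin t) else 0)" for t
  have E: "(E_mat k l ** A) $ i $ j = (if i = k then A $ l $ j else 0)" for k l A i j
    by (simp add: matmul_component E_mat_component if_distrib [of "\<lambda>x. x * _"] if_distrib [of "\<lambda>P. _ \<and> P"]
      cong: if_cong conj_cong) 
  have "R t = mexp (t *\<^sub>R (E_mat p q - E_mat q p))"
  proof (rule mexp_unique)
    have c: "((\<lambda>t. complex_of_real (cos t)) has_vector_derivative - complex_of_real (sin t)) (at t)" for t
      by (rule has_vector_derivative_of_real [THEN has_vector_derivative_eq_rhs])
        (auto intro!: derivative_eq_intros)
    have s: "((\<lambda>t. complex_of_real (sin t)) has_vector_derivative complex_of_real (cos t)) (at t)" for t
      by (rule has_vector_derivative_of_real [THEN has_vector_derivative_eq_rhs])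
        (auto intro!: derivative_eq_intros)
    have ms: "((\<lambda>t. - complex_of_real (sin t)) has_vector_derivative - complex_of_real (cos t)) (at t)" for t
      by (rule has_vector_derivative_minus [OF s])
    show "(R has_vector_derivative (E_mat p q - E_mat q p) ** R t) (at t)" for t
    proof (rule has_vector_derivative_entries)
      fix i j
      show "((\<lambda>t. R t $ i $ j) has_vector_derivative ((E_mat p q - E_mat q p) ** R t) $ i $ j) (at t)"
        by (cases "i = p"; cases "i = q"; cases "j = p"; cases "j = q"; cases "i = j")
          (use assms in \<open>auto simp: R_def matmul_diff_left E intro!: c s ms\<close>)
    qed
    show "R 0 = mat 1"
      using assms by (auto simp: R_def vec_eq_iff mat_def)
  qed
  then show ?thesis
    by (simp add: R_def)
qed

text \<open>A Givens rotation: a diagonal factor gives two entries of row \<open>p\<close> the same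
  phase, then a real rotation annihilates the second. Both factors are exponentials from
  \<open>k_alg\<close>. The other columns stay fixed, so the two blocks can be treated one after the
  other.\<close>

lemma SU2U2_clear_entry:
  assumes "g \<in> SU2U2" "p = 1 \<and> q = 4 \<or> p = 2 \<and> q = 3"
  shows "\<exists>h\<in>SU2U2. (h \<in> K_grp \<longrightarrow> g \<in> K_grp) \<and> h $ p $ q = 0 \<and>
    (\<forall>i j. j \<noteq> p \<longrightarrow> j \<noteq> q \<longrightarrow> h $ i $ j = g $ i $ j)"
proof -
  have pq: "p \<noteq> q" using assms(2) by auto
  define r1 r2 where "r1 = cmod (g $ p $ p)" and "r2 = cmod (g $ p $ q)"
  define \<alpha> \<beta> where "\<alpha> = Arg (g $ p $ p)" and "\<beta> = Arg (g $ p $ q)"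
  have g: "g $ p $ p = of_real r1 * cis \<alpha>" "g $ p $ q = of_real r2 * cis \<beta>"
    using rcis_cmod_Arg by (simp_all add: r1_def r2_def \<alpha>_def \<beta>_def rcis_def)
  \<comment> \<open>Phases shifted by \<open>- \<eta>\<close> and \<open>\<eta>\<close> both become
    \<open>(\<alpha> + \<beta>) / 2\<close>.\<close>
  define \<eta> where "\<eta> = (\<alpha> - \<beta>) / 2"
  define d where "d i = (if i = p then - \<eta> else if i = q then \<eta> else 0)" for i
  define M :: "complex^4^4" where "M = (\<chi> i j. if i = j then \<i> * of_real (d i) else 0)"
  define N where "N = E_mat p q - E_mat q p"
  obtain t where t: "r1 * sin t + r2 * cos t = 0"
  proof (cases "r1 = 0")
    case True
    then show ?thesis using that [of "pi / 2"] by simp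
  next
    case False
    have "tan (arctan (- r2 / r1)) = - r2 / r1" by (rule tan_arctan)
    then show ?thesis
      using False that [of "arctan (- r2 / r1)"] by (simp add: tan_def field_simps add_eq_0_iff)
  qed
  have M: "M \<in> k_alg"
    using assms(2) by (auto simp: k_alg_eq su_iff forall_4 trace_4 M_def d_def blk_def)
  have N: "t *\<^sub>R N \<in> k_alg"
    using assms(2) unfolding N_def k_alg_def by (auto simp: C_mat_eq [symmetric] intro!: span_scale intro: span_base)
  let ?g = "g ** mexp M" let ?h = "?g ** mexp (t *\<^sub>R N)"
  have "mexp M = (\<chi> i j. if i = j then cis (d i) else 0)"
    by (simp only: M_def mexp_matrix_diagonal)
  then have gM: "?g $ i $ j = g $ i $ j * cis (d j)" for i j
    by (simp add: matmul_component if_distrib [of "(*) _"] cong: if_cong)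
  have "?h \<in> SU2U2"
    using assms(1) M N by (simp add: SU2U2_mult mexp_k_alg)
  moreover have "?h \<in> K_grp \<longrightarrow> g \<in> K_grp"
    by (rule impI) (erule K_grp_cancel [OF K_grp_cancel [OF _ N] M])
  moreover have "?h $ p $ q = 0"
  proof -
    have "?h $ p $ q = (\<Sum>k\<in>{p, q}. ?g $ p $ k * mexp (t *\<^sub>R N) $ k $ q)"
      unfolding matmul_component [of ?g]
      by (rule sum.mono_neutral_right) (auto simp: N_def mexp_rotation [OF pq])
    also have "\<dots> = of_real r1 * cis \<alpha> * cis (- \<eta>) * of_real (sin t) + of_real r2 * cis \<beta> * cis \<eta> * of_real (cos t)"
      using pq by (simp add: gM g d_def N_def mexp_rotation [OF pq])
    also have "cis \<beta> * cis \<eta> = cis \<alpha> * cis (- \<eta>)"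
      by (simp add: cis_mult \<eta>_def field_simps)
    then have "of_real r1 * cis \<alpha> * cis (- \<eta>) * of_real (sin t) + of_real r2 * cis \<beta> * cis \<eta> * of_real (cos t) =
      cis \<alpha> * cis (- \<eta>) * of_real (r1 * sin t + r2 * cos t)"
      by (simp add: algebra_simps)
    finally show ?thesis
      by (simp add: t)
  qed
  moreover have "?h $ i $ j = g $ i $ j" if "j \<noteq> p" "j \<noteq> q" for i j
  proof -
    have "?h $ i $ j = (\<Sum>k\<in>{j}. ?g $ i $ k * mexp (t *\<^sub>R N) $ k $ j)"
      unfolding matmul_component [of ?g]
      by (rule sum.mono_neutral_right) (use that in \<open>auto simp: N_def mexp_rotation [OF pq]\<close>)
    also have "\<dots> = g $ i $ j"
      using that by (simp add: gM d_def N_def mexp_rotation [OF pq])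
    finally show ?thesis .
  qed
  ultimately show ?thesis by blast
qed

lemma diagonal_SU_in_K_grp:
  assumes "h \<in> SU" "\<And>i j. i \<noteq> j \<Longrightarrow> h $ i $ j = 0"
  shows "h \<in> K_grp"
proof -
  have n: "cmod (h $ i $ i) = 1" for i
  proof -
    have "(\<Sum>k\<in>UNIV. h $ i $ k * cnj (h $ i $ k)) = (\<Sum>k\<in>{i}. h $ i $ k * cnj (h $ i $ k))"
      by (rule sum.mono_neutral_right) (use assms(2) in auto)
    then show ?thesis
      using unitary_row [OF SU_D1 [OF assms(1)], of i i] by (intro cmod_eq_1) simp
  qed
  then have c: "h $ i $ i = cis (Arg (h $ i $ i))" for i
    using rcis_cmod_Arg [of "h $ i $ i"] by (simp add: rcis_def)
  \<comment> \<open>The arguments of the four diagonal entries add up only to a multiple of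
    \<open>2 * pi\<close>. Defining the first angle from the other three makes the trace exactly
    zero.\<close>
  define d where "d i = (if i = 1 then - (Arg (h$2$2) + Arg (h$3$3) + Arg (h$4$4)) else Arg (h $ i $ i))" for i
  have "h$1$1 * (h$2$2 * h$3$3 * h$4$4) = 1"
    using SU_det [OF assms(1)] by (simp add: det_4 assms(2))
  then have "h$1$1 * cis (Arg (h$2$2) + Arg (h$3$3) + Arg (h$4$4)) = 1"
    using c [of 2] c [of 3] c [of 4] by (simp add: cis_mult [symmetric])
  moreover have "h$1$1 = h$1$1 * cis s * cis (- s)" for s
    by (simp add: mult.assoc cis_mult)
  ultimately have "h$1$1 = cis (d 1)"
    by (metis d_def mult_1)
  then have "h $ i $ i = cis (d i)" for i
    using c [of i] by (cases "i = 1") (auto simp: d_def)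
  then have "h = (\<chi> i j. if i = j then cis (d i) else 0)"
    using assms(2) by (simp add: vec_eq_iff)
  then have h: "h = mat 1 ** mexp (\<chi> i j. if i = j then \<i> * of_real (d i) else 0)"
    by (simp add: mexp_matrix_diagonal)
  have "(\<chi> i j. if i = j then \<i> * of_real (d i) else 0) \<in> k_alg"
  proof -
    have "d 1 + d 2 + d 3 + d 4 = 0"
      by (simp add: d_def)
    then have "\<i> * of_real (d 1) + \<i> * of_real (d 2) + \<i> * of_real (d 3) + \<i> * of_real (d 4) = 0"
      by (simp add: complex_eq_iff)
    then show ?thesis
      unfolding k_alg_eq su_iff trace_4 blk_def by simp
  qed
  from K_grp.step [OF K_grp.one this] show ?thesis
    by (simp only: h [symmetric])
qed

text \<open>Clearing one off-diagonal entry in each block leaves a diagonal matrix, since rows and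
  columns of length one force the opposite entry to vanish too.\<close>

theorem K_grp_eq: "K_grp = SU2U2"
proof
  show "K_grp \<subseteq> SU2U2"
  proof
    fix g assume "g \<in> K_grp"
    then show "g \<in> SU2U2"
      by induct (simp_all add: SU2U2_one SU2U2_mult mexp_k_alg)
  qed
  show "SU2U2 \<subseteq> K_grp"
  proof
    fix g assume "g \<in> SU2U2"
    then obtain h where h: "h \<in> SU2U2" "h \<in> K_grp \<longrightarrow> g \<in> K_grp" "h $ 1 $ 4 = 0"
      using SU2U2_clear_entry [of g 1 4] by blast
    obtain k where k: "k \<in> SU2U2" "k \<in> K_grp \<longrightarrow> h \<in> K_grp" "k $ 2 $ 3 = 0"
      "\<forall>i j. j \<noteq> 2 \<longrightarrow> j \<noteq> 3 \<longrightarrow> k $ i $ j = h $ i $ j"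
      using SU2U2_clear_entry [OF h(1), of 2 3] by blast
    have k14: "k $ 1 $ 4 = 0"
      using k(4) h(3) by simp
    have b: "blk k" and u: "k ** ctranspose k = mat 1"
      using k(1) by (auto simp: SU2U2_iff SU_def)
    have "k$1$1 * cnj (k$1$1) = 1" "cnj (k$1$1) * k$1$1 + cnj (k$4$1) * k$4$1 = 1"
      "k$2$2 * cnj (k$2$2) = 1" "cnj (k$2$2) * k$2$2 + cnj (k$3$2) * k$3$2 = 1"
      using unitary_row [OF u, of 1 1] unitary_col [OF u, of 1 1]
        unitary_row [OF u, of 2 2] unitary_col [OF u, of 2 2] b k14 k(3)
      by (simp_all add: sum_4 blk_def)
    then have "k$4$1 = 0" "k$3$2 = 0"
      by (simp_all add: mult.commute)
    then have "\<forall>i j. i \<noteq> j \<longrightarrow> k $ i $ j = 0"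
      using b k14 k(3) by (simp add: forall_4 blk_def)
    then have "k \<in> K_grp"
      using k(1) by (intro diagonal_SU_in_K_grp) (auto simp: SU2U2_iff)
    then show "g \<in> K_grp"
      using h(2) k(2) by blast
  qed
qed

subsection \<open>Cosets and planes\<close>

text \<open>Turns equality of points into vanishing of matrix entries; the computations of isotropy
  groups go through it.\<close>

lemma coset_eq_iff:
  assumes "a \<in> SU" "b \<in> SU"
  shows "coset a = coset b \<longleftrightarrow> blk (ctranspose a ** b)"
proof
  assume "coset a = coset b"
  moreover have "b \<in> coset b"
    using SU2U2_one by (force simp: coset_def K_grp_eq)
  ultimately obtain k where "k \<in> SU2U2" "b = a ** k"
    by (auto simp: coset_def K_grp_eq)
  then show "blk (ctranspose a ** b)"
    using assms by (simp add: SU_cancel SU2U2_iff)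
next
  assume "blk (ctranspose a ** b)"
  then have k: "ctranspose a ** b \<in> SU2U2"
    using assms by (simp add: SU2U2_iff mult_SU ctranspose_SU)
  have le: "coset x \<subseteq> coset y" if "x = y ** k" "k \<in> SU2U2" for x y k
    using that SU2U2_mult by (auto simp: coset_def K_grp_eq matrix_mul_assoc [symmetric])
  show "coset a = coset b"
  proof
    have "a = b ** ctranspose (ctranspose a ** b)"
      using assms by (simp add: ctranspose_mult SU_cancel)
    then show "coset a \<subseteq> coset b"
      using SU2U2_ctranspose [OF k] by (rule le)
    show "coset b \<subseteq> coset a"
      by (rule le [OF _ k]) (simp add: assms SU_cancel)
  qed
qed

lemma coset_mult_right: "a \<in> SU \<Longrightarrow> k \<in> SU \<Longrightarrow> blk k \<Longrightarrow> coset (a ** k) = coset a"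
  using coset_eq_iff [of a "a ** k"] by (simp add: mult_SU SU_cancel)

lemma wolfE: "Z \<in> wolf \<Longrightarrow> (\<And>a. a \<in> SU \<Longrightarrow> Z = coset a \<Longrightarrow> P) \<Longrightarrow> P"
  by (auto simp: wolf_def)

section \<open>Cosets as complex planes\<close>

definition V0 :: "(complex^4) set" where
  "V0 = vec.span {axis 1 1, axis 4 1}"

lemma V0_iff: "z \<in> V0 \<longleftrightarrow> z $ 2 = 0 \<and> z $ 3 = 0"
proof
  have "vec.subspace {z :: complex^4. z $ 2 = 0 \<and> z $ 3 = 0}"
    by (auto simp: vec.subspace_def)
  then have "V0 \<subseteq> {z. z $ 2 = 0 \<and> z $ 3 = 0}"
    unfolding V0_def by (rule vec.span_minimal [rotated]) (auto simp: axis_def)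
  then show "z \<in> V0 \<Longrightarrow> z $ 2 = 0 \<and> z $ 3 = 0" by blast
  assume "z $ 2 = 0 \<and> z $ 3 = 0"
  then have "z = z $ 1 *s axis 1 1 + z $ 4 *s axis 4 1"
    by (simp add: vec_eq_iff forall_4 axis_def)
  also have "\<dots> \<in> V0"
    unfolding V0_def by (intro vec.span_add vec.span_scale vec.span_base) auto
  finally show "z \<in> V0" .
qed

lemma matvec_component: "(A *v x) $ i = (\<Sum>k\<in>UNIV. A $ i $ k * x $ k)"
  by (simp add: matrix_vector_mult_def)

lemma image_V0_eq_iff:
  assumes "m \<in> SU"
  shows "(*v) m ` V0 = V0 \<longleftrightarrow> blk m"
proof
  assume *: "(*v) m ` V0 = V0"
  have "axis i 1 \<in> V0" if "i \<in> {1, 4}" for i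
    using that by (auto simp: V0_iff axis_def)
  then have 1: "m *v axis i 1 \<in> V0" if "i \<in> {1, 4}" for i
    using * that by blast
  \<comment> \<open>The adjoint is the inverse and so preserves the plane as well. Applied to
    \<open>m\<close> the invariance gives zeros in columns 1 and 4, applied to the adjoint it gives
    them in rows 1 and 4.\<close>
  have 2: "ctranspose m *v axis i 1 \<in> V0" if i: "i \<in> {1, 4}" for i
  proof -
    have "axis i 1 \<in> (*v) m ` V0"
      using i * by (auto simp: V0_iff axis_def)
    then obtain z where "z \<in> V0" "axis i 1 = m *v z" by blast
    then show ?thesis
      by (simp add: matrix_vector_mul_assoc SU_D2 [OF assms])
  qed
  show "blk m"
    using 1 [of 1] 1 [of 4] 2 [of 1] 2 [of 4]
    by (simp add: V0_iff matvec_component sum_4 axis_def blk_def)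
next
  assume b: "blk m"
  have "m *v z \<in> V0" "ctranspose m *v z \<in> V0" if "z \<in> V0" for z
    using that b by (auto simp: V0_iff matvec_component sum_4 blk_def)
  moreover have "m *v (ctranspose m *v z) = z" for z
    by (simp add: matrix_vector_mul_assoc SU_D1 [OF assms])
  ultimately show "(*v) m ` V0 = V0"
    by (metis image_eqI image_subsetI subsetI subset_antisym)
qed

lemma image_V0_coset:
  assumes "a \<in> SU" "b \<in> SU"
  shows "(*v) a ` V0 = (*v) b ` V0 \<longleftrightarrow> coset a = coset b"
proof -
  have i: "(*v) (ctranspose a) ` (*v) a ` S = S" "(*v) a ` (*v) (ctranspose a) ` S = S" for S
    using assms(1) by (simp_all add: image_image matrix_vector_mul_assoc SU_D1 SU_D2)
  have "(*v) a ` V0 = (*v) b ` V0 \<longleftrightarrow> V0 = (*v) (ctranspose a) ` (*v) b ` V0"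
    using i by metis
  also have "(*v) (ctranspose a) ` (*v) b ` V0 = (*v) (ctranspose a ** b) ` V0"
    by (simp add: image_image matrix_vector_mul_assoc)
  also have "V0 = (*v) (ctranspose a ** b) ` V0 \<longleftrightarrow> blk (ctranspose a ** b)"
    using image_V0_eq_iff [of "ctranspose a ** b"] assms by (auto simp: mult_SU ctranspose_SU)
  finally show ?thesis
    using coset_eq_iff [OF assms] by simp
qed

definition hprod :: "complex^'n \<Rightarrow> complex^'n \<Rightarrow> complex" where
  "hprod x y = (\<Sum>i\<in>UNIV. cnj (x $ i) * y $ i)"

lemma hprod_self: "hprod x x = of_real ((norm x)\<^sup>2)"
proof -
  have "(norm x)\<^sup>2 = (\<Sum>i\<in>UNIV. (cmod (x $ i))\<^sup>2)"
    by (simp add: norm_vec_def L2_set_def sum_nonneg)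
  then show ?thesis
    by (simp add: hprod_def complex_norm_square mult.commute del: of_real_power)
qed

lemma hprod_diff_right: "hprod x (y - z) = hprod x y - hprod x z"
  by (simp add: hprod_def algebra_simps sum_subtractf)

lemma hprod_smult_right: "hprod x (c *s y) = c * hprod x y"
  by (simp add: hprod_def sum_distrib_left algebra_simps)

lemma hprod_commute: "hprod y x = cnj (hprod x y)"
  by (simp add: hprod_def mult.commute)

lemma normalize_ex: "x \<noteq> 0 \<Longrightarrow> \<exists>c. hprod (c *s x) (c *s x) = 1 \<and> c \<noteq> 0" for x :: "complex^'n"
proof (intro exI conjI)
  assume "x \<noteq> 0"
  let ?c = "of_real (1 / norm x) :: complex"
  have "hprod (?c *s x) (?c *s x) = ?c * cnj ?c * hprod x x"
    by (simp add: hprod_def sum_distrib_left algebra_simps)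
  also have "\<dots> = 1"
    using \<open>x \<noteq> 0\<close> by (simp add: hprod_self power2_eq_square field_simps)
  finally show "hprod (?c *s x) (?c *s x) = 1" .
  show "?c \<noteq> 0" using \<open>x \<noteq> 0\<close> by simp
qed

text \<open>Three linear conditions in four unknowns: the matrix with the conjugated vectors as rows
  and a zero fourth row is singular.\<close>

lemma orthogonal_unit_ex:
  fixes x y z :: "complex^4"
  shows "\<exists>u. hprod x u = 0 \<and> hprod y u = 0 \<and> hprod z u = 0 \<and> hprod u u = 1"
proof -
  define A :: "complex^4^4" where
    "A = (\<chi> i j. if i = 1 then cnj (x $ j) else if i = 2 then cnj (y $ j) else if i = 3 then cnj (z $ j) else 0)"
  have "det A = 0"
    by (simp add: det_4 A_def)
  then have "\<not> (\<exists>B. B ** A = mat 1)"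
    by (metis det_I det_mul mult_zero_right zero_neq_one)
  then obtain v where v: "A *v v = 0" "v \<noteq> 0"
    unfolding matrix_left_invertible_ker by blast
  have "hprod x v = (A *v v) $ 1" "hprod y v = (A *v v) $ 2" "hprod z v = (A *v v) $ 3"
    by (simp_all add: hprod_def matvec_component A_def)
  moreover obtain c where "hprod (c *s v) (c *s v) = 1"
    using normalize_ex [OF v(2)] by blast
  ultimately show ?thesis
    using v(1) by (intro exI [of _ "c *s v"]) (simp add: hprod_smult_right)
qed

text \<open>After completion to an orthonormal basis, one of the two free columns is multiplied by
  the conjugate of the determinant, a number of modulus one.\<close>

lemma SU_two_columns_ex:
  fixes u v :: "complex^4"
  assumes "hprod u u = 1" "hprod v v = 1" "hprod u v = 0"
  shows "\<exists>a\<in>SU. column 1 a = u \<and> column 4 a = v"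
proof -
  obtain w where w: "hprod u w = 0" "hprod v w = 0" "hprod w w = 1"
    using orthogonal_unit_ex by blast
  obtain x where x: "hprod u x = 0" "hprod v x = 0" "hprod w x = 0" "hprod x x = 1"
    using orthogonal_unit_ex by blast
  note o = assms w x hprod_commute [of v u] hprod_commute [of w u] hprod_commute [of x u]
    hprod_commute [of w v] hprod_commute [of x v] hprod_commute [of x w]
  define A where "A c = ((\<chi> i j. if j = 1 then u $ i else if j = 4 then v $ i else if j = 2 then w $ i else c * x $ i) :: complex^4^4)"
    for c :: complex
  have unit: "ctranspose (A c) ** A c = mat 1" if "c * cnj c = 1" for c
    using o that
    by (simp add: vec_eq_iff forall_4 matmul_component mat_1_component A_def hprod_def
      sum_distrib_left [symmetric] sum_distrib_right [symmetric] mult.assoc mult.left_commute mult.commute)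
  have "cnj (det (A 1)) * det (A 1) = 1"
    using arg_cong [OF unit [of 1], of det] by (simp add: det_mul det_ctranspose)
  then have c: "cnj (det (A 1)) * cnj (cnj (det (A 1))) = 1" "cnj (det (A 1)) * det (A 1) = 1"
    by (simp_all add: mult.commute)
  have "det (A c) = c * det (A 1)" for c
    by (simp add: det_4 A_def algebra_simps)
  with c(2) have "det (A (cnj (det (A 1)))) = 1"
    by metis
  with unit [OF c(1)] have "A (cnj (det (A 1))) \<in> SU"
    by (simp add: SU_def matrix_left_right_inverse)
  moreover have "column 1 (A c) = u" "column 4 (A c) = v" for c
    by (simp_all add: column_def A_def vec_eq_iff)
  ultimately show ?thesis by blast
qed

lemma dim_image_V0:
  assumes "a \<in> SU"
  shows "(*v) a ` V0 \<in> Gr2"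
proof -
  have "vec.independent {axis 1 1, axis 4 1 :: complex^4}"
    by (rule vec.independent_mono [OF independent_cart_basis]) (auto simp: cart_basis_def)
  then have "vec.dim V0 = 2"
    unfolding V0_def by (subst vec.dim_span_eq_card_independent) (auto simp: axis_eq_axis)
  moreover have "inj ((*v) a)"
    by (metis SU_D2 [OF assms] matrix_left_invertible_injective)
  ultimately have "vec.dim ((*v) a ` V0) = 2"
    using vec.dim_image_eq [of "(*v) a" V0] by (simp add: inj_on_subset matrix_vector_mul_linear_gen)
  then show ?thesis
    by (simp add: Gr2_def V0_def vec.subspace_image matrix_vector_mul_linear_gen)
qed

text \<open>Gram-Schmidt on a basis of \<open>W\<close> supplies columns 1 and 4; equality of
  dimensions turns the inclusion into an equality.\<close>

lemma Gr2_surj: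
  assumes "W \<in> Gr2"
  shows "\<exists>a\<in>SU. (*v) a ` V0 = W"
proof -
  have W: "vec.subspace W" "vec.dim W = 2"
    using assms by (auto simp: Gr2_def)
  obtain B where B: "B \<subseteq> W" "vec.independent B" "card B = 2"
    using vec.basis_exists [of W] W by metis
  then obtain x y where xy: "B = {x, y}" "x \<noteq> y"
    by (meson card_2_iff)
  then have "x \<noteq> 0"
    using B(2) vec.dependent_zero by blast
  then obtain c where c: "hprod (c *s x) (c *s x) = 1" "c \<noteq> 0"
    using normalize_ex by blast
  define u where "u = c *s x"
  define y' where "y' = y - hprod u y *s u"
  have "y' \<noteq> 0"
  proof
    assume "y' = 0"
    then have "y \<in> vec.span {x}"
      using vec.span_scale [OF vec.span_base, of x "{x}" "hprod u y * c"]
      by (simp add: y'_def u_def vector_smult_assoc)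
    then show False
      using B(2) xy vec.independent_insert [of y "{x}"] by (auto simp: insert_commute)
  qed
  then obtain d where d: "hprod (d *s y') (d *s y') = 1" "d \<noteq> 0"
    using normalize_ex by blast
  have "hprod u y' = 0"
    using c(1) by (simp add: y'_def hprod_diff_right hprod_smult_right u_def [symmetric])
  then obtain a where a: "a \<in> SU" "column 1 a = u" "column 4 a = d *s y'"
    using SU_two_columns_ex [of u "d *s y'"] c(1) d(1) by (auto simp: u_def hprod_smult_right)
  have "u \<in> W" "y' \<in> W"
    using B(1) xy W(1) by (auto simp: u_def y'_def intro!: vec.subspace_scale vec.subspace_diff)
  have "a *v z \<in> W" if "z \<in> V0" for z
  proof -
    have "a *v z = z $ 1 *s u + z $ 4 *s (d *s y')"
      unfolding a(2,3) [symmetric] using that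
      by (simp add: vec_eq_iff matvec_component sum_4 V0_iff column_def algebra_simps)
    also have "\<dots> \<in> W"
      using W(1) \<open>u \<in> W\<close> \<open>y' \<in> W\<close> by (intro vec.subspace_add vec.subspace_scale)
    finally show ?thesis .
  qed
  then have "(*v) a ` V0 \<subseteq> W" by blast
  then have "(*v) a ` V0 = W"
    using dim_image_V0 [OF a(1)] W by (intro vec.subspace_dim_equal) (auto simp: Gr2_def)
  with a(1) show ?thesis by blast
qed

lemma wolf_Gr2: "\<exists>\<Psi>. bij_betw \<Psi> wolf Gr2 \<and>
  (\<forall>a\<in>SU. \<Psi> (coset a) = (\<lambda>z. a *v z) ` vec.span {axis 1 1, axis 4 1})"
proof -
  define \<Psi> where "\<Psi> Z = (*v) (SOME a. a \<in> SU \<and> coset a = Z) ` V0" for Z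
  have \<Psi>: "\<Psi> (coset a) = (*v) a ` V0" if "a \<in> SU" for a
  proof -
    have "\<exists>b. b \<in> SU \<and> coset b = coset a" using that by blast
    from someI_ex [OF this] show ?thesis
      unfolding \<Psi>_def using image_V0_coset that by blast
  qed
  have "bij_betw \<Psi> wolf Gr2"
  proof (rule bij_betw_imageI)
    show "inj_on \<Psi> wolf"
      by (auto simp: inj_on_def wolf_def \<Psi> image_V0_coset)
    show "\<Psi> ` wolf = Gr2"
    proof
      show "\<Psi> ` wolf \<subseteq> Gr2"
        by (auto simp: wolf_def \<Psi> dim_image_V0)
      show "Gr2 \<subseteq> \<Psi> ` wolf"
        using Gr2_surj \<Psi> unfolding wolf_def by (metis (no_types, lifting) image_iff subsetI)
    qed
  qed
  then show ?thesis
    using \<Psi> unfolding V0_def by blast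
qed

subsection \<open>The embedding of \<open>SU(3)\<close>\<close>

lemma index3_simps [simp]: "index3 1 = 1" "index3 2 = 2" "index3 3 = 3"
  by (simp_all add: index3_def)

lemma emb_mult: "emb (g ** h) = emb g ** emb h"
  by (simp add: mat4_simps sum_3 emb_def)

lemma emb_one [simp]: "emb (mat 1) = mat 1"
  by (simp add: vec_eq_iff forall_4 emb_def mat_1_component)

lemma ctranspose_emb: "ctranspose (emb g) = emb (ctranspose g)"
  by (simp add: vec_eq_iff forall_4 emb_def)

lemma det_emb: "det (emb g) = det g"
  by (simp add: det_4 det_3 emb_def algebra_simps)

lemma emb_inj: "emb g = emb h \<Longrightarrow> g = h"
  by (simp add: vec_eq_iff forall_4 forall_3 emb_def)

lemma emb_SU_iff [simp]: "emb g \<in> SU \<longleftrightarrow> g \<in> SU"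
proof -
  have "emb g ** ctranspose (emb g) = mat 1 \<longleftrightarrow> g ** ctranspose g = mat 1"
    using emb_inj [of "g ** ctranspose g" "mat 1"] by (auto simp: ctranspose_emb emb_mult [symmetric])
  then show ?thesis
    by (simp add: SU_def det_emb)
qed

definition res :: "complex^4^4 \<Rightarrow> complex^3^3" where
  "res a = (\<chi> i j. a $ (if i = 1 then 1 else if i = 2 then 2 else 3)
    $ (if j = 1 then 1 else if j = 2 then 2 else 3))"

text \<open>The fourth column is a unit vector whose last entry is already 1, so its other entries
  vanish.\<close>

lemma emb_res:
  assumes "a \<in> SU" "a$4$1 = 0" "a$4$2 = 0" "a$4$3 = 0" "a$4$4 = 1"
  shows "emb (res a) = a" "res a \<in> SU"
proof -
  have "cnj (a$1$4) * a$1$4 + cnj (a$2$4) * a$2$4 + cnj (a$3$4) * a$3$4 = 0"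
    using unitary_col [OF SU_D1 [OF assms(1)], of 4 4] assms by (simp add: sum_4)
  then have "complex_of_real ((cmod (a$1$4))\<^sup>2 + (cmod (a$2$4))\<^sup>2 + (cmod (a$3$4))\<^sup>2) = 0"
    by (simp add: complex_norm_square mult.commute del: of_real_power)
  then have "(cmod (a$1$4))\<^sup>2 + (cmod (a$2$4))\<^sup>2 + (cmod (a$3$4))\<^sup>2 = 0"
    using of_real_eq_0_iff by blast
  then have "a$1$4 = 0 \<and> a$2$4 = 0 \<and> a$3$4 = 0"
    by (smt (verit) zero_le_power2 norm_eq_zero power_eq_0_iff)
  then show "emb (res a) = a"
    using assms by (simp add: vec_eq_iff forall_4 emb_def res_def)
  then show "res a \<in> SU"
    using assms(1) emb_SU_iff [of "res a"] by simp
qed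

lemma act_coset: "act g (coset a) = coset (emb g ** a)"
  by (simp add: act_def coset_def image_image matrix_mul_assoc)

lemma act_mult: "act (g ** h) Z = act g (act h Z)"
  by (simp add: act_def image_image emb_mult matrix_mul_assoc)

lemma act_one [simp]: "act (mat 1) Z = Z"
  by (simp add: act_def)

lemma orbit_act: "g \<in> SU \<Longrightarrow> orbit (act g Z) = orbit Z"
proof -
  assume g: "g \<in> SU"
  have "act h Z = act (h ** ctranspose g) (act g Z)" for h
    using g by (simp add: act_mult [symmetric] matrix_mul_assoc SU_cancel)
  then show ?thesis
    using g by (auto simp: orbit_def act_mult [symmetric] mult_SU ctranspose_SU image_iff)
      (metis mult_SU ctranspose_SU act_mult)
qed

lemma act_in_orbit: "g \<in> SU \<Longrightarrow> act g Z \<in> orbit Z"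
  by (simp add: orbit_def)

lemma stab_act:
  assumes "g \<in> SU"
  shows "stab (act g Z) = {g ** h ** ctranspose g | h. h \<in> stab Z}"
proof -
  have a: "act (ctranspose g) (act g Y) = Y" "act g (act (ctranspose g) Y) = Y" for Y
    using assms by (simp_all add: act_mult [symmetric] SU_D1 SU_D2)
  show ?thesis
  proof (intro set_eqI iffI)
    fix x assume x: "x \<in> stab (act g Z)"
    let ?h = "ctranspose g ** x ** g"
    have "?h \<in> SU"
      using x assms by (simp add: stab_def mult_SU ctranspose_SU)
    moreover have "act ?h Z = Z"
      using x a by (simp add: stab_def act_mult)
    ultimately have "?h \<in> stab Z"
      by (simp add: stab_def)
    moreover have "x = g ** ?h ** ctranspose g"
      using assms by (simp add: matrix_mul_assoc SU_cancel SU_D1)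
    ultimately show "x \<in> {g ** h ** ctranspose g | h. h \<in> stab Z}" by blast
  next
    fix x assume "x \<in> {g ** h ** ctranspose g | h. h \<in> stab Z}"
    then show "x \<in> stab (act g Z)"
      using assms a by (auto simp: stab_def mult_SU ctranspose_SU act_mult)
  qed
qed

lemma stab_coset:
  assumes "a \<in> SU"
  shows "stab (coset a) = {g \<in> SU. blk (ctranspose a ** emb g ** a)}"
  using assms coset_eq_iff [of a]
  by (auto simp: stab_def act_coset mult_SU matrix_mul_assoc) (metis emb_SU_iff mult_SU matrix_mul_assoc)+

subsection \<open>The geodesic and the orbit invariant\<close>

lemma radial_0_eq: "radial_0 t =
    (\<chi> i j. if i = j then (if i = 2 \<or> i = 4 then of_real (cos t) else 1)
            else if i = 2 \<and> j = 4 then of_real (sin t)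
            else if i = 4 \<and> j = 2 then - of_real (sin t) else 0)"
  unfolding radial_0_def C_mat_eq by (rule mexp_rotation) simp

lemma C_mat_su: "C_mat 5 \<in> su"
  by (simp add: su_iff forall_4 C_mat_eq E_mat_component trace_4)

lemma radial_0_SU: "radial_0 t \<in> SU"
  unfolding radial_0_def by (intro mexp_SU subspace_scale [OF subspace_su] C_mat_su)

lemma radial_1_eq: "radial_1 t = radial_0 (pi / 2 - t)"
  by (simp add: radial_1_def radial_0_def)

lemma pt_eq: "pt t = coset (radial_0 t)"
  by (simp add: pt_def radial_0_def)

lemma pt_wolf: "pt t \<in> wolf"
  by (simp add: pt_eq wolf_def radial_0_SU)

text \<open>The squared length of the projection of \<open>e\<^sub>4\<close> to the plane \<open>a V\<^sub>0\<close>, which separates the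
  orbits.\<close>

definition hgt :: "complex^4^4 \<Rightarrow> real" where
  "hgt a = (cmod (a$4$1))\<^sup>2 + (cmod (a$4$4))\<^sup>2"

lemma of_real_hgt: "complex_of_real (hgt a) = a$4$1 * cnj (a$4$1) + a$4$4 * cnj (a$4$4)"
  by (simp add: hgt_def complex_norm_square del: of_real_power)

lemma hgt_nonneg: "0 \<le> hgt a"
  by (simp add: hgt_def)

lemma hgt_complement:
  assumes "a \<in> SU"
  shows "1 - hgt a = (cmod (a$4$2))\<^sup>2 + (cmod (a$4$3))\<^sup>2"
proof -
  have "complex_of_real (hgt a + ((cmod (a$4$2))\<^sup>2 + (cmod (a$4$3))\<^sup>2)) = 1"
    using unitary_row [OF SU_D1 [OF assms], of 4 4]
    by (simp add: sum_4 of_real_hgt complex_norm_square algebra_simps del: of_real_power)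
  then have "hgt a + ((cmod (a$4$2))\<^sup>2 + (cmod (a$4$3))\<^sup>2) = 1"
    using of_real_eq_1_iff by blast
  then show ?thesis by simp
qed

lemma hgt_le_1: "a \<in> SU \<Longrightarrow> hgt a \<le> 1"
  using hgt_complement [of a] by (smt (verit) zero_le_power2)

lemma hgt_emb: "hgt (emb g ** a) = hgt a"
  by (simp add: hgt_def matmul_component sum_4 emb_def)

text \<open>Entries 1 and 4 of the fourth row are mixed by a unitary block, which preserves their
  joint length. With \<open>hgt_emb\<close> this makes \<open>hgt\<close> a function of the
  SU(3)-orbit of \<open>coset a\<close>.\<close>

lemma hgt_mult_right:
  assumes "k \<in> SU" "blk k"
  shows "hgt (a ** k) = hgt a"
proof -
  note r = unitary_row [OF SU_D1 [OF assms(1)]]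
  have "k$1$1 * cnj (k$1$1) + k$1$4 * cnj (k$1$4) = 1" "k$4$1 * cnj (k$4$1) + k$4$4 * cnj (k$4$4) = 1"
    "k$1$1 * cnj (k$4$1) + k$1$4 * cnj (k$4$4) = 0" "k$4$1 * cnj (k$1$1) + k$4$4 * cnj (k$1$4) = 0"
    using r [of 1 1] r [of 4 4] r [of 1 4] r [of 4 1] assms(2) by (simp_all add: sum_4 blk_def)
  moreover have "(a ** k)$4$1 = a$4$1 * k$1$1 + a$4$4 * k$4$1" "(a ** k)$4$4 = a$4$1 * k$1$4 + a$4$4 * k$4$4"
    using assms(2) by (simp_all add: matmul_component sum_4 blk_def)
  ultimately have "complex_of_real (hgt (a ** k)) = of_real (hgt a)"
    unfolding of_real_hgt by (simp, algebra)
  then show ?thesis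
    using of_real_eq_iff by blast
qed

lemma hgt_coset_cong:
  assumes "a \<in> SU" "b \<in> SU" "coset a = coset b"
  shows "hgt a = hgt b"
proof -
  have "hgt (a ** (ctranspose a ** b)) = hgt a"
    using assms coset_eq_iff by (intro hgt_mult_right mult_SU ctranspose_SU) auto
  then show ?thesis
    using assms(1) by (simp add: SU_cancel)
qed

lemma hgt_radial_0: "hgt (radial_0 t) = (cos t)\<^sup>2"
  by (simp add: hgt_def radial_0_eq)

lemma hgt_orbit:
  assumes "a \<in> SU" "coset a \<in> orbit (pt t)"
  shows "hgt a = (cos t)\<^sup>2"
proof -
  obtain g where "g \<in> SU" "coset a = coset (emb g ** radial_0 t)"
    using assms(2) by (auto simp: orbit_def pt_eq act_coset)
  then show ?thesis
    using hgt_coset_cong [OF assms(1), of "emb g ** radial_0 t"]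
    by (simp add: mult_SU radial_0_SU hgt_emb hgt_radial_0)
qed

text \<open>A normal form \<open>a k(a) = emb g m(w)\<close>: \<open>k(a)\<close> is block diagonal and turns the fourth row of \<open>a\<close>
  into that of \<open>m(w)\<close>, the rotation taking \<open>e\<^sub>4\<close> to \<open>w\<^sub>1 e\<^sub>2 + w\<^sub>2 e\<^sub>3 + p e\<^sub>4\<close>. All factors depend
  smoothly on \<open>a\<close>, which provides the sections needed for the diffeomorphisms.\<close>

definition kk :: "complex^4^4 \<Rightarrow> complex^4^4" where
  "kk a = (\<chi> i j. if i = 1 \<and> j = 1 then of_real (inverse (sqrt (hgt a))) * a$4$4
    else if i = 4 \<and> j = 1 then - (of_real (inverse (sqrt (hgt a))) * a$4$1)
    else if i = 1 \<and> j = 4 then of_real (inverse (sqrt (hgt a))) * cnj (a$4$1)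
    else if i = 4 \<and> j = 4 then of_real (inverse (sqrt (hgt a))) * cnj (a$4$4)
    else if i = j then 1 else 0)"

text \<open>With \<open>p = sqrt (1 - |w|^2)\<close>, the block on the indices 2 and 3 multiplies
  the direction of \<open>w\<close> by \<open>p\<close> and fixes its complement. Writing the
  coefficient \<open>(1 - p) / |w|^2\<close> as \<open>1 / (1 + p)\<close> removes the singularity
  at \<open>w = 0\<close>.\<close>

definition mm :: "complex^2 \<Rightarrow> complex^4^4" where
  "mm w = (\<chi> i j. if i = 2 \<and> j = 2 then 1 - of_real (inverse (1 + sqrt (1 - (norm w)\<^sup>2))) * (w$1 * cnj (w$1))
    else if i = 2 \<and> j = 3 then - (of_real (inverse (1 + sqrt (1 - (norm w)\<^sup>2))) * (w$1 * cnj (w$2)))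
    else if i = 3 \<and> j = 2 then - (of_real (inverse (1 + sqrt (1 - (norm w)\<^sup>2))) * (w$2 * cnj (w$1)))
    else if i = 3 \<and> j = 3 then 1 - of_real (inverse (1 + sqrt (1 - (norm w)\<^sup>2))) * (w$2 * cnj (w$2))
    else if i = 2 \<and> j = 4 then w$1 else if i = 3 \<and> j = 4 then w$2
    else if i = 4 \<and> j = 2 then - cnj (w$1) else if i = 4 \<and> j = 3 then - cnj (w$2)
    else if i = 4 \<and> j = 4 then of_real (sqrt (1 - (norm w)\<^sup>2))
    else if i = j then 1 else 0)"

lemma kk_SU:
  assumes "0 < hgt a"
  shows "kk a \<in> SU" "blk (kk a)"
proof -
  define r where "r = complex_of_real (inverse (sqrt (hgt a)))"
  have "inverse (sqrt (hgt a)) * inverse (sqrt (hgt a)) * hgt a = 1"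
    using assms by (simp add: field_simps)
  then have "r * r * of_real (hgt a) = 1"
    unfolding r_def of_real_mult [symmetric] by simp
  then have r: "r * r * (a$4$1 * cnj (a$4$1) + a$4$4 * cnj (a$4$4)) = 1"
    by (simp add: of_real_hgt)
  have c: "cnj r = r" by (simp add: r_def)
  have "kk a ** ctranspose (kk a) = mat 1"
    using r by (simp add: mat4_simps kk_def r_def [symmetric] c
      algebra_simps del: of_real_inverse)
  moreover have "det (kk a) = 1"
    using r by (simp add: det_4 kk_def r_def [symmetric] algebra_simps del: of_real_inverse)
  ultimately show "kk a \<in> SU" by (simp add: SU_def)
  show "blk (kk a)" by (simp add: kk_def blk_def)
qed

lemma norm_sq_2: "(norm (w :: complex^2))\<^sup>2 = (cmod (w$1))\<^sup>2 + (cmod (w$2))\<^sup>2"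
  by (simp add: norm_vec_def L2_set_def sum_2)

lemma norm_axis_2: "norm (\<chi> i::2. if i = 1 then complex_of_real x else 0) = \<bar>x\<bar>"
  by (rule power2_eq_imp_eq) (auto simp: norm_sq_2)

lemma mm_SU:
  assumes "norm w \<le> 1"
  shows "mm w \<in> SU"
proof -
  define p where "p = sqrt (1 - (norm w)\<^sup>2)"
  define P where "P = complex_of_real p"
  define Q where "Q = complex_of_real (inverse (1 + p))"
  have "0 \<le> p" "p\<^sup>2 = 1 - (norm w)\<^sup>2"
    using assms by (simp_all add: p_def power_le_one)
  then have "inverse (1 + p) * (1 + p) = 1" "p\<^sup>2 + ((cmod (w$1))\<^sup>2 + (cmod (w$2))\<^sup>2) = 1"
    by (simp_all add: norm_sq_2 [of w])
  from arg_cong [OF this(1), of complex_of_real] arg_cong [OF this(2), of complex_of_real]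
  have Q: "Q * (1 + P) = 1"
    and "of_real (p\<^sup>2) + (of_real ((cmod (w$1))\<^sup>2) + of_real ((cmod (w$2))\<^sup>2)) = (1 :: complex)"
    by (simp_all add: P_def Q_def del: of_real_inverse)
  moreover have "of_real (p\<^sup>2) = P * P"
    by (simp add: P_def power2_eq_square)
  ultimately have P: "P * P + w$1 * cnj (w$1) + w$2 * cnj (w$2) = 1"
    by (simp only: complex_norm_square add.assoc)
  have c: "cnj P = P" "cnj Q = Q" by (simp_all add: P_def Q_def)
  have e: "mm w = (\<chi> i j. if i = 2 \<and> j = 2 then 1 - Q * (w$1 * cnj (w$1))
    else if i = 2 \<and> j = 3 then - (Q * (w$1 * cnj (w$2)))
    else if i = 3 \<and> j = 2 then - (Q * (w$2 * cnj (w$1)))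
    else if i = 3 \<and> j = 3 then 1 - Q * (w$2 * cnj (w$2))
    else if i = 2 \<and> j = 4 then w$1 else if i = 3 \<and> j = 4 then w$2
    else if i = 4 \<and> j = 2 then - cnj (w$1) else if i = 4 \<and> j = 3 then - cnj (w$2)
    else if i = 4 \<and> j = 4 then P
    else if i = j then 1 else 0)"
    unfolding mm_def p_def [symmetric] P_def Q_def by simp
  \<comment> \<open>Entries and their conjugates become independent variables, so that
    \<open>algebra\<close> only has to use the polynomial relations \<open>Q\<close> and
    \<open>P'\<close>.\<close>
  obtain u v x y where uv: "u = w$1" "v = w$2" "x = cnj (w$1)" "y = cnj (w$2)" by blast
  have cu: "cnj u = x" "cnj v = y" "cnj x = u" "cnj y = v" by (simp_all add: uv)
  note P' = P [folded uv]
  have "mm w ** ctranspose (mm w) = mat 1"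
    unfolding e uv [symmetric]
    apply (simp add: mat4_simps c cu)
    using Q P' by (intro conjI; algebra)
  moreover have "det (mm w) = 1"
    unfolding e uv [symmetric]
    apply (simp add: det_4 cu)
    using Q P' by algebra
  ultimately show ?thesis by (simp add: SU_def)
qed

text \<open>Sign and conjugation are chosen so that \<open>mm (ww a)\<close> has the same entries
  (4,2) and (4,3) as \<open>a\<close>.\<close>

definition ww :: "complex^4^4 \<Rightarrow> complex^2" where
  "ww a = (\<chi> i. if i = 1 then - cnj (a$4$2) else - cnj (a$4$3))"

lemma norm_ww: "a \<in> SU \<Longrightarrow> (norm (ww a))\<^sup>2 = 1 - hgt a"
  by (simp add: norm_sq_2 ww_def hgt_complement)

definition gg :: "complex^4^4 \<Rightarrow> complex^3^3" where
  "gg a = res (a ** kk a ** ctranspose (mm (ww a)))"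

lemma normal_form:
  assumes a: "a \<in> SU" "0 < hgt a"
  shows "gg a \<in> SU" "emb (gg a) ** mm (ww a) = a ** kk a" "mm (ww a) \<in> SU"
    "coset (emb (gg a) ** mm (ww a)) = coset a"
proof -
  let ?m = "mm (ww a)" let ?b = "a ** kk a ** ctranspose ?m"
  have n: "(norm (ww a))\<^sup>2 = 1 - hgt a"
    using a(1) by (rule norm_ww)
  then have "(norm (ww a))\<^sup>2 \<le> 1"
    using hgt_nonneg [of a] by simp
  then show m: "?m \<in> SU"
    by (intro mm_SU) (simp add: power2_le_imp_le power_le_one_iff abs_square_le_1)
  note k = kk_SU [OF a(2)]
  have b: "?b \<in> SU"
    using a k m by (simp add: mult_SU ctranspose_SU)
  have s: "of_real (inverse (sqrt (hgt a))) * of_real (hgt a) = complex_of_real (sqrt (hgt a))"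
    unfolding of_real_mult [symmetric] using a(2) by (simp add: real_div_sqrt divide_inverse [symmetric] mult.commute)
  have row: "(a ** kk a) $ 4 $ j = ?m $ 4 $ j" for j
  proof -
    have "(a ** kk a) $ 4 $ 4 = of_real (inverse (sqrt (hgt a))) * of_real (hgt a)"
      unfolding of_real_hgt by (simp add: matmul_component sum_4 kk_def algebra_simps)
    moreover have "(a ** kk a) $ 4 $ 1 = 0" "(a ** kk a) $ 4 $ 2 = a$4$2" "(a ** kk a) $ 4 $ 3 = a$4$3"
      by (simp_all add: matmul_component sum_4 kk_def algebra_simps)
    ultimately have "\<forall>j. (a ** kk a) $ 4 $ j = ?m $ 4 $ j"
      by (simp only: forall_4 s) (simp add: mm_def n, simp add: ww_def)
    then show ?thesis ..
  qed
  \<comment> \<open>Agreement of the fourth rows of \<open>a ** kk a\<close> and \<open>?m\<close>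
    gives \<open>?b\<close> the fourth row of the identity, which puts it into the embedded
    SU(3).\<close>
  have "?b $ 4 $ j = (?m ** ctranspose ?m) $ 4 $ j" for j
    using row by (simp add: matmul_component [of _ "ctranspose ?m"])
  then have b4: "?b $ 4 $ j = (if j = 4 then 1 else 0)" for j
    by (auto simp: SU_D1 [OF m] mat_1_component)
  note r = emb_res [OF b, unfolded b4, simplified]
  show "gg a \<in> SU"
    using r by (simp add: gg_def)
  show e: "emb (gg a) ** ?m = a ** kk a"
    using r m by (simp add: gg_def SU_cancel)
  show "coset (emb (gg a) ** ?m) = coset a"
    unfolding e using a k by (simp add: coset_mult_right)
qed

text \<open>The slice representation of the isotropy group \<open>H0\<close> of \<open>pt 0\<close>.\<close>

definition rho :: "complex^3^3 \<Rightarrow> complex^2 \<Rightarrow> complex^2" where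
  "rho h v = (\<chi> i. if i = 1 then h$2$2 * v$1 + h$2$3 * v$2 else h$3$2 * v$1 + h$3$3 * v$2)"

definition H0 :: "(complex^3^3) set" where
  "H0 = {g \<in> SU. g$1$2 = 0 \<and> g$1$3 = 0 \<and> g$2$1 = 0 \<and> g$3$1 = 0}"

lemma H0_cols:
  assumes "h \<in> H0"
  shows "cnj (h$2$2) * h$2$2 + cnj (h$3$2) * h$3$2 = 1" "cnj (h$2$3) * h$2$3 + cnj (h$3$3) * h$3$3 = 1"
    "cnj (h$2$2) * h$2$3 + cnj (h$3$2) * h$3$3 = 0" "cnj (h$2$3) * h$2$2 + cnj (h$3$3) * h$3$2 = 0"
    "cnj (h$1$1) * h$1$1 = 1"
proof -
  have h: "h \<in> SU" "h$1$2 = 0" "h$1$3 = 0" "h$2$1 = 0" "h$3$1 = 0"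
    using assms by (auto simp: H0_def)
  note r = unitary_col [OF SU_D1 [OF h(1)]]
  show "cnj (h$2$2) * h$2$2 + cnj (h$3$2) * h$3$2 = 1" "cnj (h$2$3) * h$2$3 + cnj (h$3$3) * h$3$3 = 1"
    "cnj (h$2$2) * h$2$3 + cnj (h$3$2) * h$3$3 = 0" "cnj (h$2$3) * h$2$2 + cnj (h$3$3) * h$3$2 = 0"
    "cnj (h$1$1) * h$1$1 = 1"
    using r [of 2 2] r [of 3 3] r [of 2 3] r [of 3 2] r [of 1 1] h by (simp_all add: sum_3)
qed

lemma norm_rho:
  assumes "h \<in> H0"
  shows "norm (rho h v) = norm v"
proof -
  note c = H0_cols [OF assms]
  have "complex_of_real ((norm (rho h v))\<^sup>2) = of_real ((norm v)\<^sup>2)"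
    unfolding norm_sq_2 of_real_add complex_norm_square using c
    by (simp add: rho_def) algebra
  then have "(norm (rho h v))\<^sup>2 = (norm v)\<^sup>2"
    using of_real_eq_iff by blast
  then show ?thesis by simp
qed

text \<open>\<open>emb h\<close> fixes the vector e_4 and acts by \<open>rho h\<close> on the span
  of e_2 and e_3, so it conjugates the rotation of e_4 towards \<open>v\<close> into the one towards
  \<open>rho h v\<close>.\<close>

lemma mm_rho:
  assumes h: "h \<in> H0"
  shows "mm (rho h v) ** emb h = emb h ** mm v"
proof -
  note c = H0_cols [OF h]
  have z: "h$1$2 = 0" "h$1$3 = 0" "h$2$1 = 0" "h$3$1 = 0"
    using h by (auto simp: H0_def)
  define Q where "Q = complex_of_real (inverse (1 + sqrt (1 - (norm v)\<^sup>2)))"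
  show ?thesis
    unfolding mm_def norm_rho [OF h] Q_def [symmetric]
    apply (simp add: mat4_simps emb_def z rho_def)
    using c by (intro conjI; algebra)
qed

lemma blk_emb_H0: "h \<in> H0 \<Longrightarrow> blk (emb h)"
  by (simp add: H0_def blk_def emb_def)

lemma coset_mm_rho:
  assumes "h \<in> H0" "norm v \<le> 1"
  shows "coset (mm (rho h v)) = act h (coset (mm v))"
proof -
  have h: "h \<in> SU" using assms by (simp add: H0_def)
  have "coset (mm (rho h v)) = coset (mm (rho h v) ** emb h)"
    using assms h norm_rho [OF assms(1)] by (intro coset_mult_right [symmetric] mm_SU blk_emb_H0) auto
  then show ?thesis
    using assms by (simp add: mm_rho act_coset)
qed

text \<open>The geodesic is a ray of the slice, with \<open>sin t\<close> as its radius. The range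
  of \<open>t\<close> ensures that the nonnegative root is \<open>cos t\<close>.\<close>

lemma mm_axis:
  assumes "t \<in> {0..pi/2}"
  shows "mm (\<chi> i. if i = 1 then of_real (sin t) else 0) = radial_0 t"
proof -
  have c: "0 \<le> cos t"
    using assms by (intro cos_ge_zero) auto
  have n: "(norm (\<chi> i::2. if i = 1 then complex_of_real (sin t) else 0))\<^sup>2 = (sin t)\<^sup>2"
    by (simp add: norm_sq_2)
  have s: "sqrt (1 - (sin t)\<^sup>2) = cos t"
    using c by (simp add: cos_squared_eq [symmetric])
  have "1 - inverse (1 + cos t) * (sin t * sin t) = cos t"
  proof -
    have "sin t * sin t = (1 + cos t) * (1 - cos t)"
      using sin_cos_squared_add [of t] by (simp add: algebra_simps power2_eq_square)
    then show ?thesis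
      using c by (simp add: field_simps)
  qed
  from arg_cong [OF this, of complex_of_real]
  show ?thesis
    unfolding mm_def n s radial_0_eq
    by (simp add: vec_eq_iff forall_4)
qed

text \<open>For \<open>r = 1 / norm w\<close> this takes the first basis vector of \<open>\<complex>\<^sup>2\<close> to \<open>w / norm w\<close>.\<close>

definition hrot :: "real \<Rightarrow> complex^2 \<Rightarrow> complex^3^3" where
  "hrot r w = (\<chi> i j. if i = 1 \<and> j = 1 then 1 else if i = 2 \<and> j = 2 then of_real r * w$1
    else if i = 3 \<and> j = 2 then of_real r * w$2 else if i = 2 \<and> j = 3 then - (of_real r * cnj (w$2))
    else if i = 3 \<and> j = 3 then of_real r * cnj (w$1) else 0)"

lemma hrot_H0:
  assumes "r * norm w = 1"
  shows "hrot r w \<in> H0" "rho (hrot r w) (\<chi> i. if i = 1 then of_real (norm w) else 0) = w"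
proof -
  define R where "R = complex_of_real r"
  have "r * r * (norm w)\<^sup>2 = 1"
    using assms by (metis mult.assoc mult.commute mult.right_neutral power2_eq_square)
  from arg_cong [OF this, of complex_of_real]
  have r: "R * R * (w$1 * cnj (w$1) + w$2 * cnj (w$2)) = 1"
    unfolding norm_sq_2 by (simp add: R_def complex_norm_square del: of_real_power)
  have r': "R * of_real (norm w) = 1"
    using assms unfolding R_def of_real_mult [symmetric] by simp
  have c: "cnj R = R" by (simp add: R_def)
  have "hrot r w ** ctranspose (hrot r w) = mat 1" "det (hrot r w) = 1"
    using r by (simp_all add: mat3_simps hrot_def
      R_def [symmetric] c det_3 algebra_simps)
  then show "hrot r w \<in> H0"
    by (simp add: H0_def SU_def) (simp add: hrot_def)
  show "rho (hrot r w) (\<chi> i. if i = 1 then of_real (norm w) else 0) = w"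
    using r' by (simp add: rho_def hrot_def vec_eq_iff forall_2 R_def [symmetric])
qed

text \<open>Transitivity on the spheres of the slice: every point of the slice can be moved onto the
  geodesic ray.\<close>

lemma H0_transitive:
  obtains h where "h \<in> H0" "rho h (\<chi> i. if i = 1 then of_real (norm w) else 0) = w"
proof (cases "w = 0")
  case True
  have "mat 1 \<in> H0" by (simp add: H0_def mat_1_component)
  moreover have "rho (mat 1) (\<chi> i. if i = 1 then of_real (norm w) else 0) = w"
    using True by (simp add: rho_def vec_eq_iff forall_2 mat_1_component)
  ultimately show ?thesis using that by blast
next
  case False
  then show ?thesis
    using hrot_H0 [of "inverse (norm w)" w] that by simp
qed

section \<open>Exchange of the two singular orbits\<close>

definition J_mat :: "complex^4^4" where
  "J_mat = (\<chi> i j. if (i = 1 \<and> j = 3) \<or> (i = 3 \<and> j = 1) then 1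
    else if (i = 2 \<and> j = 4) \<or> (i = 4 \<and> j = 2) then -1 else 0)"

definition swap13 :: "complex^3^3" where
  "swap13 = (\<chi> i j. if (i = 1 \<and> j = 3) \<or> (i = 3 \<and> j = 1) then 1 else if i = 2 \<and> j = 2 then -1 else 0)"

lemma J_mat_SU: "J_mat \<in> SU"
  by (simp add: SU_def J_mat_def det_4 mat4_simps)

lemma swap13_SU: "swap13 \<in> SU"
  by (simp add: SU_def swap13_def det_3 mat3_simps)

lemma J_mat_J_mat: "J_mat ** J_mat = mat 1"
  by (simp add: J_mat_def mat4_simps)

lemma swap13_swap13: "swap13 ** swap13 = mat 1"
  by (simp add: swap13_def mat3_simps)

lemma ctranspose_J_mat: "ctranspose J_mat = J_mat"
  by (simp add: J_mat_def vec_eq_iff forall_4)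

lemma blk_J_mat: "blk (J_mat ** M ** J_mat) \<longleftrightarrow> blk M"
  by (auto simp: J_mat_def blk_def matmul_component sum_4)

lemma coset_J_mat:
  assumes "a \<in> SU" "b \<in> SU"
  shows "coset (a ** J_mat) = coset (b ** J_mat) \<longleftrightarrow> coset a = coset b"
proof -
  have "ctranspose (a ** J_mat) ** (b ** J_mat) = J_mat ** (ctranspose a ** b) ** J_mat"
    by (simp add: ctranspose_mult ctranspose_J_mat matrix_mul_assoc)
  then show ?thesis
    using assms by (simp add: coset_eq_iff mult_SU J_mat_SU blk_J_mat)
qed

text \<open>This identity dictates the signs: \<open>swap13\<close> needs one minus sign to have
  determinant 1, and those in \<open>J_mat\<close> compensate for it. Right multiplication by
  \<open>J_mat\<close> passes to the orthogonal plane because it exchanges the index blocks {1,4}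
  and {2,3}.\<close>

lemma radial_0_J_mat: "radial_0 t ** J_mat = emb swap13 ** radial_0 (pi / 2 - t)"
  by (simp add: mat4_simps emb_def swap13_def J_mat_def radial_0_eq
    cos_diff sin_diff)

lemma hgt_J_mat: "a \<in> SU \<Longrightarrow> hgt (a ** J_mat) = 1 - hgt a"
  by (simp add: hgt_complement) (simp add: hgt_def matmul_component sum_4 J_mat_def)

text \<open>For positive \<open>hgt\<close> the normal form and \<open>H0_transitive\<close> produce
  the group element. The normal form breaks down at \<open>hgt a = 0\<close>; there \<open>t\<close>
  is \<open>pi/2\<close>, and \<open>a ** J_mat\<close> has \<open>hgt\<close> equal to 1.\<close>

lemma orbit_pt_iff:
  assumes a: "a \<in> SU" and t: "t \<in> {0..pi/2}"
  shows "coset a \<in> orbit (pt t) \<longleftrightarrow> hgt a = (cos t)\<^sup>2"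
proof
  show "coset a \<in> orbit (pt t) \<Longrightarrow> hgt a = (cos t)\<^sup>2"
    using a by (rule hgt_orbit)
  \<comment> \<open>Stated for arbitrary \<open>b\<close> and \<open>s\<close> because it is applied
    to \<open>a\<close> itself and to \<open>a ** J_mat\<close> with \<open>s = 0\<close>.\<close>
  have pos: "coset b \<in> orbit (pt s)" if b: "b \<in> SU" and s: "s \<in> {0..pi/2}" "hgt b = (cos s)\<^sup>2" "0 < hgt b" for b s
  proof -
    have "(norm (ww b))\<^sup>2 = (sin s)\<^sup>2"
      using norm_ww [OF b] s(2) by (simp add: cos_squared_eq)
    moreover have "0 \<le> sin s"
      using s(1) by (intro sin_ge_zero) auto
    ultimately have n: "norm (ww b) = sin s"
      by (simp add: power2_eq_iff_nonneg)
    obtain h where h: "h \<in> H0" "rho h (\<chi> i. if i = 1 then of_real (norm (ww b)) else 0) = ww b"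
      by (rule H0_transitive)
    have "coset (mm (ww b)) = act h (coset (mm (\<chi> i. if i = 1 then of_real (norm (ww b)) else 0)))"
      using coset_mm_rho [OF h(1), of "\<chi> i. if i = 1 then of_real (norm (ww b)) else 0"] n
      by (simp add: h(2) norm_axis_2)
    also have "\<dots> = act h (pt s)"
      unfolding n mm_axis [OF s(1)] pt_eq ..
    finally have "coset b = act (gg b ** h) (pt s)"
      using normal_form(4) [OF b s(3)] by (simp only: act_mult act_coset [symmetric])
    moreover have "gg b ** h \<in> SU"
      using normal_form [OF b s(3)] h(1) by (simp add: mult_SU H0_def)
    ultimately show ?thesis
      by (simp add: act_in_orbit)
  qed
  assume h: "hgt a = (cos t)\<^sup>2"
  show "coset a \<in> orbit (pt t)"
  proof (cases "hgt a > 0")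
    case True
    with a t h show ?thesis by (intro pos)
  next
    case False
    then have "hgt a = 0"
      using hgt_nonneg [of a] by simp
    then have "cos t = 0" using h by simp
    have "t = pi / 2"
    proof (rule ccontr)
      assume "t \<noteq> pi / 2"
      then have "0 < cos t" using t pi_gt_zero by (intro cos_gt_zero_pi) auto
      with \<open>cos t = 0\<close> show False by simp
    qed
    have "hgt (a ** J_mat) = 1" "a ** J_mat \<in> SU"
      using a \<open>hgt a = 0\<close> by (simp_all add: hgt_J_mat mult_SU J_mat_SU)
    then have "coset (a ** J_mat) \<in> orbit (pt 0)"
      by (intro pos) auto
    then obtain g where g: "g \<in> SU" "coset (a ** J_mat) = coset (emb g ** radial_0 0)"
      by (auto simp: orbit_def pt_eq act_coset)
    then have "coset (a ** J_mat ** J_mat) = coset (emb g ** radial_0 0 ** J_mat)"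
      using a by (subst coset_J_mat) (auto simp: mult_SU J_mat_SU radial_0_SU)
    also have "emb g ** radial_0 0 ** J_mat = emb (g ** swap13) ** radial_0 (pi / 2)"
      using radial_0_J_mat [of 0] by (simp add: matrix_mul_assoc [symmetric] emb_mult)
    also have "a ** J_mat ** J_mat = a"
      by (simp add: matrix_mul_assoc [symmetric] J_mat_J_mat)
    finally have "coset a = act (g ** swap13) (pt t)"
      by (simp add: act_coset pt_eq \<open>t = pi / 2\<close>)
    then show ?thesis
      using g by (simp add: act_in_orbit mult_SU swap13_SU)
  qed
qed

lemma cos_squared_inj:
  assumes "s \<in> {0..pi/2}" "t \<in> {0..pi/2}" "(cos s)\<^sup>2 = (cos t)\<^sup>2"
  shows "s = t"
proof -
  have "0 \<le> cos s" "0 \<le> cos t"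
    using assms by (auto intro!: cos_ge_zero)
  with assms(3) have "cos s = cos t"
    by (simp add: power2_eq_iff_nonneg)
  then show ?thesis
    by (rule cos_inj_pi [rotated 4]) (use assms pi_gt_zero in auto)
qed

lemma hgt_angle:
  assumes "a \<in> SU"
  obtains t where "t \<in> {0..pi/2}" "hgt a = (cos t)\<^sup>2"
proof
  have s: "0 \<le> sqrt (hgt a)" "sqrt (hgt a) \<le> 1"
    using hgt_nonneg [of a] hgt_le_1 [OF assms] by auto
  then show "arccos (sqrt (hgt a)) \<in> {0..pi/2}"
    using arccos_lbound [of "sqrt (hgt a)"] arccos_le_pi2 [of "sqrt (hgt a)"] s by auto
  show "hgt a = (cos (arccos (sqrt (hgt a))))\<^sup>2"
    using s cos_arccos [of "sqrt (hgt a)"] hgt_nonneg [of a] by (smt (verit) real_sqrt_pow2)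
qed

lemma orbit_subset_wolf: "orbit (pt t) \<subseteq> wolf"
  by (auto simp: orbit_def pt_eq act_coset wolf_def mult_SU radial_0_SU)

lemma wolf_eq_Union_orbits: "wolf = (\<Union>t\<in>{0..pi/2}. orbit (pt t))"
proof
  show "wolf \<subseteq> (\<Union>t\<in>{0..pi/2}. orbit (pt t))"
  proof
    fix Z assume "Z \<in> wolf"
    then obtain a where a: "a \<in> SU" "Z = coset a" by (rule wolfE)
    obtain t where "t \<in> {0..pi/2}" "hgt a = (cos t)\<^sup>2" by (rule hgt_angle [OF a(1)])
    with a show "Z \<in> (\<Union>t\<in>{0..pi/2}. orbit (pt t))"
      using orbit_pt_iff by blast
  qed
qed (use orbit_subset_wolf in blast)

lemma orbits_disjoint:
  assumes "s \<in> {0..pi/2}" "t \<in> {0..pi/2}" "s \<noteq> t"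
  shows "orbit (pt s) \<inter> orbit (pt t) = {}"
proof (rule ccontr)
  assume "orbit (pt s) \<inter> orbit (pt t) \<noteq> {}"
  then obtain Z where Z: "Z \<in> orbit (pt s)" "Z \<in> orbit (pt t)" by blast
  then obtain a where a: "a \<in> SU" "Z = coset a"
    using orbit_subset_wolf wolfE by (metis subsetD)
  then have "(cos s)\<^sup>2 = (cos t)\<^sup>2"
    using a Z hgt_orbit [of a s] hgt_orbit [of a t] by simp
  then show False
    using assms cos_squared_inj by blast
qed

subsection \<open>Isotropy groups\<close>

text \<open>All types of isotropy group can be read off: the conditions with a factor
  \<open>sin t\<close> disappear at 0, those with a factor \<open>cos t\<close> at
  \<open>pi/2\<close>, and in the open interval all of them remain.\<close>

lemma blk_radial_0:
  "blk (ctranspose (radial_0 t) ** emb g ** radial_0 t) \<longleftrightarrow>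
    cos t * cmod (g$1$2) = 0 \<and> g$1$3 = 0 \<and> cos t * cmod (g$2$1) = 0 \<and> g$3$1 = 0 \<and>
    sin t * cmod (g$2$3) = 0 \<and> sin t * cmod (g$3$2) = 0 \<and> sin t * cos t * cmod (g$2$2 - 1) = 0"
proof -
  let ?m = "ctranspose (radial_0 t) ** emb g ** radial_0 t"
  have "?m$1$2 = of_real (cos t) * g$1$2" "?m$1$3 = g$1$3" "?m$2$1 = of_real (cos t) * g$2$1"
    "?m$3$1 = g$3$1" "?m$4$3 = of_real (sin t) * g$2$3" "?m$3$4 = of_real (sin t) * g$3$2"
    "?m$4$2 = of_real (sin t * cos t) * (g$2$2 - 1)" "?m$2$4 = of_real (sin t * cos t) * (g$2$2 - 1)"
    by (simp_all add: radial_0_eq matmul_component sum_4 emb_def algebra_simps)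
  then show ?thesis
    unfolding blk_def by auto
qed

lemma stab_pt_0: "stab (pt 0) = H0"
  by (auto simp: pt_eq stab_coset [OF radial_0_SU] blk_radial_0 H0_def)

lemma stab_pt_pi2: "stab (pt (pi/2)) = U2"
  by (auto simp: pt_eq stab_coset [OF radial_0_SU] blk_radial_0 U2_def)

lemma U1_iff: "g \<in> U1 k l \<longleftrightarrow> (\<exists>\<theta>. g = (\<chi> i j. if i \<noteq> j then 0
                     else if i = 1 then cis (real_of_int k * \<theta>)
                     else if i = 2 then cis (real_of_int l * \<theta>)
                     else cis (- real_of_int (k + l) * \<theta>)))"
  unfolding U1_def by blast

lemma U1_SU: "U1 k l \<subseteq> SU"
proof
  fix g assume "g \<in> U1 k l"
  then obtain \<theta> where g: "g = (\<chi> i j. if i \<noteq> j then 0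
                     else if i = 1 then cis (real_of_int k * \<theta>)
                     else if i = 2 then cis (real_of_int l * \<theta>)
                     else cis (- real_of_int (k + l) * \<theta>))"
    by (auto simp: U1_iff)
  show "g \<in> SU"
    by (simp add: SU_def g mat3_simps det_3 cis_mult
      cis_cnj algebra_simps)
qed

lemma stab_pt:
  assumes "t \<in> {0<..<pi/2}"
  shows "stab (pt t) = U1 1 0"
proof -
  have sc: "sin t \<noteq> 0" "cos t \<noteq> 0"
    using assms sin_gt_zero [of t] cos_gt_zero [of t] by auto
  show ?thesis
  proof (intro set_eqI iffI)
    fix g assume "g \<in> stab (pt t)"
    then have g: "g \<in> SU" "g$1$2 = 0" "g$1$3 = 0" "g$2$1 = 0" "g$3$1 = 0" "g$2$3 = 0" "g$3$2 = 0" "g$2$2 = 1"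
      using sc by (auto simp: pt_eq stab_coset [OF radial_0_SU] blk_radial_0)
    have d: "g$1$1 * g$3$3 = 1"
      using SU_det [OF g(1)] g by (simp add: det_3)
    have "cmod (g$1$1) = 1"
      using unitary_row [OF SU_D1 [OF g(1)], of 1 1] g by (intro cmod_eq_1) (simp add: sum_3)
    then have c: "g$1$1 = cis (Arg (g$1$1))"
      using rcis_cmod_Arg [of "g$1$1"] by (simp add: rcis_def)
    have "g$3$3 = cis (- Arg (g$1$1)) * (cis (Arg (g$1$1)) * g$3$3)"
      by (simp add: cis_mult mult.assoc [symmetric])
    then have "g$3$3 = cis (- Arg (g$1$1))"
      using d c by simp
    then have "g = (\<chi> i j. if i \<noteq> j then 0
                     else if i = 1 then cis (real_of_int 1 * Arg (g$1$1))
                     else if i = 2 then cis (real_of_int 0 * Arg (g$1$1))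
                     else cis (- real_of_int (1 + 0) * Arg (g$1$1)))"
      using g c by (simp add: vec_eq_iff forall_3)
    then show "g \<in> U1 1 0"
      unfolding U1_iff by blast
  next
    fix g assume g: "g \<in> U1 1 0"
    then have "g \<in> SU" using U1_SU by blast
    with g show "g \<in> stab (pt t)"
      by (auto simp: pt_eq stab_coset [OF radial_0_SU] blk_radial_0 U1_iff)
  qed
qed

lemma U1_subset_stab: "U1 1 0 \<subseteq> stab (pt t)"
proof
  fix g assume g: "g \<in> U1 1 0"
  then have "g \<in> SU" using U1_SU by blast
  with g show "g \<in> stab (pt t)"
    by (auto simp: pt_eq stab_coset [OF radial_0_SU] blk_radial_0 U1_iff)
qed

lemma orbitE:
  assumes "Z \<in> orbit Y"
  obtains g where "g \<in> SU" "Z = act g Y"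
  using assms by (auto simp: orbit_def)

lemma wolf_normalE:
  assumes "Z \<in> wolf"
  obtains g t where "g \<in> SU" "t \<in> {0..pi/2}" "Z = act g (pt t)"
  using assms unfolding wolf_eq_Union_orbits by (auto elim!: orbitE)

text \<open>The group \<open>U1 1 0\<close> is the isotropy group for interior \<open>t\<close> and
  lies in all the others, which gives one direction. For the other, the centre of SU(3) lies in both
  singular isotropy groups and is unchanged by conjugation, but a primitive cube root of unity times
  the identity is not in \<open>U1 1 0\<close>, whose elements have middle entry 1.\<close>

lemma principal_at_iff:
  assumes "g \<in> SU" "t \<in> {0..pi/2}"
  shows "principal_at (act g (pt t)) \<longleftrightarrow> t \<in> {0<..<pi/2}"
proof
  assume t: "t \<in> {0<..<pi/2}"
  show "principal_at (act g (pt t))"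
    unfolding principal_at_def
  proof
    fix Z' assume "Z' \<in> wolf"
    then obtain g' t' where Z': "g' \<in> SU" "Z' = act g' (pt t')"
      by (rule wolf_normalE)
    let ?x = "g' ** ctranspose g"
    have x: "?x \<in> SU"
      using assms Z' by (simp add: mult_SU ctranspose_SU)
    have "?x ** h ** matrix_inv ?x \<in> stab Z'" if h: "h \<in> stab (act g (pt t))" for h
    proof -
      obtain u where u: "u \<in> U1 1 0" "h = g ** u ** ctranspose g"
        using h unfolding stab_act [OF assms(1)] stab_pt [OF t] by blast
      then have "?x ** h ** matrix_inv ?x = g' ** u ** ctranspose g'"
        using assms(1) by (simp add: matrix_inv_SU [OF x] ctranspose_mult matrix_mul_assoc SU_cancel)
      then show ?thesis
        using u U1_subset_stab Z' by (auto simp: stab_act)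
    qed
    with x show "\<exists>x\<in>SU. \<forall>h\<in>stab (act g (pt t)). x ** h ** matrix_inv x \<in> stab Z'" by blast
  qed
next
  assume pr: "principal_at (act g (pt t))"
  show "t \<in> {0<..<pi/2}"
  proof (rule ccontr)
    assume "t \<notin> {0<..<pi/2}"
    then have t: "t = 0 \<or> t = pi / 2" using assms(2) by auto
    define \<omega> where "\<omega> = cis (2 * pi / 3)"
    have w: "\<omega> * (\<omega> * \<omega>) = 1" "\<omega> * cnj \<omega> = 1" "\<omega> \<noteq> 1"
    proof -
      show "\<omega> * (\<omega> * \<omega>) = 1" "\<omega> * cnj \<omega> = 1"
        by (simp_all add: \<omega>_def cis_mult cis_cnj)
      have "sin (2 * pi / 3) \<noteq> 0"
        using sin_gt_zero [of "2 * pi / 3"] by simp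
      then show "\<omega> \<noteq> 1"
        by (simp add: \<omega>_def complex_eq_iff)
    qed
    define S :: "complex^3^3" where "S = (\<chi> i j. if i = j then \<omega> else 0)"
    have S: "S \<in> SU"
      using w by (simp add: SU_def S_def det_3 mat3_simps mult.assoc)
    have comm: "x ** S = S ** x" for x
      by (simp add: S_def vec_eq_iff matmul_component if_distrib [of "\<lambda>z. z * _"] if_distrib [of "(*) _"]
        mult.commute cong: if_cong)
    have conj: "x ** S ** ctranspose x = S" if "x \<in> SU" for x
      using that by (simp add: comm matrix_mul_assoc [symmetric] SU_D1)
    have "S \<in> H0" "S \<in> U2"
      using S by (simp_all add: H0_def U2_def) (simp_all add: S_def)
    then have "S \<in> stab (pt t)"
      using t stab_pt_0 stab_pt_pi2 by blast
    then have "S \<in> stab (act g (pt t))"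
      unfolding stab_act [OF assms(1)] using conj [OF assms(1)] by force
    moreover obtain x where "x \<in> SU" "\<forall>h\<in>stab (act g (pt t)). x ** h ** matrix_inv x \<in> stab (pt (pi/4))"
      using pr pt_wolf unfolding principal_at_def by blast
    ultimately have "S \<in> stab (pt (pi/4))"
      using conj matrix_inv_SU by metis
    then have "S \<in> U1 1 0"
      by (simp add: stab_pt)
    then have "S $ 2 $ 2 = 1"
      by (auto simp: U1_iff)
    with w(3) show False
      by (simp add: S_def)
  qed
qed

lemma principal_iff_orbit:
  assumes "a \<in> SU"
  shows "principal_at (coset a) \<longleftrightarrow> (\<exists>t\<in>{0<..<pi/2}. coset a \<in> orbit (pt t))"
proof
  assume p: "principal_at (coset a)"
  have "coset a \<in> wolf" using assms by (simp add: wolf_def)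
  then obtain g t where *: "g \<in> SU" "t \<in> {0..pi/2}" "coset a = act g (pt t)"
    by (rule wolf_normalE)
  with p have "t \<in> {0<..<pi/2}" using principal_at_iff by metis
  with * show "\<exists>t\<in>{0<..<pi/2}. coset a \<in> orbit (pt t)"
    using act_in_orbit by metis
next
  assume "\<exists>t\<in>{0<..<pi/2}. coset a \<in> orbit (pt t)"
  then obtain g t where "t \<in> {0<..<pi/2}" "g \<in> SU" "coset a = act g (pt t)"
    by (auto elim: orbitE)
  then show "principal_at (coset a)"
    using principal_at_iff [of g t] by simp
qed

subsection \<open>Homogeneous spaces\<close>

text \<open>Inverses are expressed by adjoints, which agree with them inside
  \<open>SU\<close>.\<close>

definition is_grp :: "(complex^3^3) set \<Rightarrow> bool" where
  "is_grp H \<longleftrightarrow> H \<subseteq> SU \<and> mat 1 \<in> H \<and> (\<forall>g\<in>H. \<forall>h\<in>H. g ** h \<in> H) \<and> (\<forall>g\<in>H. ctranspose g \<in> H)"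

lemma is_grp_stab: "is_grp (stab Z)"
proof -
  have "act (ctranspose g) Z = Z" if "g \<in> SU" "act g Z = Z" for g
    using that by (metis act_mult act_one SU_D2)
  then show ?thesis
    by (auto simp: is_grp_def stab_def mult_SU ctranspose_SU act_mult)
qed

lemma is_grp_SU: "is_grp H \<Longrightarrow> h \<in> H \<Longrightarrow> h \<in> SU"
  by (auto simp: is_grp_def)

lemma grp_coset_eq_iff:
  assumes "is_grp H" "g \<in> SU" "h \<in> SU"
  shows "(\<lambda>x. g ** x) ` H = (\<lambda>x. h ** x) ` H \<longleftrightarrow> ctranspose g ** h \<in> H"
proof
  assume eq: "(\<lambda>x. g ** x) ` H = (\<lambda>x. h ** x) ` H"
  have "h ** mat 1 \<in> (\<lambda>x. h ** x) ` H"
    using assms(1) unfolding is_grp_def by blast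
  then obtain x where "x \<in> H" "h = g ** x"
    using eq by auto
  then show "ctranspose g ** h \<in> H"
    using assms(2) by (simp add: SU_cancel)
next
  assume *: "ctranspose g ** h \<in> H"
  have le: "(\<lambda>x. a ** x) ` H \<subseteq> (\<lambda>x. b ** x) ` H" if "k \<in> H" "a = b ** k" for a b k
    using that assms(1) by (auto simp: is_grp_def matrix_mul_assoc [symmetric])
  show "(\<lambda>x. g ** x) ` H = (\<lambda>x. h ** x) ` H"
  proof
    show "(\<lambda>x. h ** x) ` H \<subseteq> (\<lambda>x. g ** x) ` H"
      by (rule le [OF *]) (simp add: assms SU_cancel)
    have "ctranspose (ctranspose g ** h) \<in> H"
      using * assms(1) by (simp add: is_grp_def)
    then show "(\<lambda>x. g ** x) ` H \<subseteq> (\<lambda>x. h ** x) ` H"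
      by (rule le) (simp add: assms SU_cancel ctranspose_mult)
  qed
qed

lemma hom_act_coset: "hom_act g ((\<lambda>x. h ** x) ` H) = (\<lambda>x. (g ** h) ** x) ` H"
  by (simp add: hom_act_def image_image matrix_mul_assoc)

lemma Cinf_on_emb: "Cinf_on U f \<Longrightarrow> Cinf_on U (\<lambda>x. emb (f x))"
  unfolding emb_def by (intro Cinf_intros Cinf_on_if) (auto intro: Cinf_on_open)

text \<open>The orbit map lifts to \<open>g \<mapsto> emb g ** a0\<close>. A single section
  \<open>\<psi>\<close> suffices because it is defined on matrices \<open>a\<close> representing
  points of the orbit, not on the points.\<close>

lemma hom_space_orbit_diffeo:
  assumes a0: "a0 \<in> SU"
    and \<psi>: "Cinf_on V \<psi>" "\<And>a. a \<in> SU \<Longrightarrow> coset a \<in> orbit (coset a0) \<Longrightarrow>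
      a \<in> V \<and> \<psi> a \<in> SU \<and> act (\<psi> a) (coset a0) = coset a"
  shows "\<exists>F. equi_diffeo (hom_space (stab (coset a0))) hom_act (wolf_part (orbit (coset a0))) act F"
proof -
  let ?H = "stab (coset a0)"
  have "\<exists>F. equi_diffeo (SU, \<lambda>g. (\<lambda>h. g ** h) ` ?H) hom_act ({a \<in> SU. coset a \<in> orbit (coset a0)}, coset) act F \<and>
    (\<forall>x\<in>SU. F ((\<lambda>h. x ** h) ` ?H) = coset (emb x ** a0))"
  proof (rule equi_diffeo_exI)
    show "Cinf_on UNIV (\<lambda>g. emb g ** a0)"
      by (intro Cinf_on_matmul Cinf_on_emb Cinf_on_ident Cinf_on_const open_UNIV)
    show "(\<lambda>g. emb g ** a0) ` SU \<subseteq> {a \<in> SU. coset a \<in> orbit (coset a0)}"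
      using a0 by (auto simp: mult_SU act_coset [symmetric] act_in_orbit)
    fix x y :: "complex^3^3"
    assume x: "x \<in> SU" and y: "y \<in> SU"
    have "act (ctranspose x ** y) (coset a0) = coset a0 \<longleftrightarrow> act x (coset a0) = act y (coset a0)"
      using x y by (metis act_mult act_one SU_D1 SU_D2)
    then show "(\<lambda>h. x ** h) ` ?H = (\<lambda>h. y ** h) ` ?H \<longleftrightarrow> coset (emb x ** a0) = coset (emb y ** a0)"
      unfolding grp_coset_eq_iff [OF is_grp_stab x y] act_coset [symmetric]
      using x y by (simp add: stab_def mult_SU ctranspose_SU)
  next
    fix a assume "a \<in> {a \<in> SU. coset a \<in> orbit (coset a0)}"
    then show "\<exists>V \<psi>. a \<in> V \<and> Cinf_on V \<psi> \<and> (\<forall>z \<in> {a \<in> SU. coset a \<in> orbit (coset a0)} \<inter> V.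
       \<psi> z \<in> SU \<and> coset (emb (\<psi> z) ** a0) = coset z)"
      using \<psi> by (intro exI [of _ V] exI [of _ \<psi>]) (auto simp: act_coset [symmetric])
  next
    fix g x :: "complex^3^3"
    assume "g \<in> SU" "x \<in> SU"
    then show "\<exists>y\<in>SU. hom_act g ((\<lambda>h. x ** h) ` ?H) = (\<lambda>h. y ** h) ` ?H \<and>
       act g (coset (emb x ** a0)) = coset (emb y ** a0)"
      by (intro bexI [of _ "g ** x"]) (auto simp: hom_act_coset act_coset emb_mult matrix_mul_assoc mult_SU)
  qed simp
  then show ?thesis
    by (auto simp: hom_space_def wolf_part_def)
qed

section \<open>Smooth sections over the orbits\<close>

lemma Cinf_hgt: "open U \<Longrightarrow> Cinf_on U hgt"
  using Cinf_on_add [of U "\<lambda>a. (cmod (a$4$1))\<^sup>2" "\<lambda>a :: complex^4^4. (cmod (a$4$4))\<^sup>2"]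
  by (simp add: hgt_def [abs_def] Cinf_on_norm_power2 Cinf_on_nth Cinf_on_ident)

lemma Cinf_ww: "open U \<Longrightarrow> Cinf_on U ww"
  unfolding ww_def [abs_def] by (intro Cinf_intros Cinf_on_if) auto

lemma Cinf_mm: "Cinf_on (ball 0 1) mm"
proof -
  have p: "0 < 1 - (norm w)\<^sup>2" if "w \<in> ball 0 1" for w :: "complex^2"
    using that by (simp add: power_less_one_iff)
  then have q: "0 < 1 + sqrt (1 - (norm w)\<^sup>2)" if "w \<in> ball 0 1" for w :: "complex^2"
    using that by (smt (verit) real_sqrt_gt_zero)
  show ?thesis
    unfolding mm_def [abs_def] by (intro Cinf_intros Cinf_on_if p q) auto
qed

text \<open>Smoothness requires an open set of matrices, larger than \<open>SU\<close>. Off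
  \<open>SU\<close> the bound on \<open>ww\<close> is independent of the positivity of
  \<open>hgt\<close>; it keeps the argument of \<open>mm\<close> in the ball where \<open>mm\<close>
  is smooth.\<close>

definition gg_dom :: "(complex^4^4) set" where
  "gg_dom = {a. 0 < hgt a} \<inter> ww -` ball 0 1"

lemma open_gg_dom: "open gg_dom"
proof -
  have "open {a. 0 < hgt a}"
    using Cinf_on_continuous [OF Cinf_hgt [OF open_UNIV]] by (intro open_Collect_less) auto
  moreover have "open (ww -` ball 0 1)"
    using Cinf_on_continuous [OF Cinf_ww [OF open_UNIV]]
    by (simp add: continuous_on_open_vimage)
  ultimately show ?thesis
    unfolding gg_dom_def by blast
qed

lemma SU_gg_dom: "a \<in> SU \<Longrightarrow> 0 < hgt a \<Longrightarrow> a \<in> gg_dom"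
proof -
  assume a: "a \<in> SU" "0 < hgt a"
  then have "(norm (ww a))\<^sup>2 < 1\<^sup>2"
    by (simp add: norm_ww)
  then have "norm (ww a) < 1"
    by (rule power_less_imp_less_base) simp
  then show ?thesis
    using a by (simp add: gg_dom_def)
qed

lemma Cinf_gg: "Cinf_on gg_dom gg"
proof -
  have k: "Cinf_on gg_dom kk"
    unfolding kk_def [abs_def]
    by (intro Cinf_intros Cinf_on_if Cinf_hgt) (auto simp: open_gg_dom, auto simp: gg_dom_def)
  have m: "Cinf_on gg_dom (\<lambda>a. mm (ww a))"
    by (rule Cinf_on_compose [OF Cinf_mm Cinf_ww [OF open_gg_dom]]) (auto simp: gg_dom_def)
  show ?thesis
    unfolding gg_def [abs_def] res_def
    by (intro Cinf_intros k m) (auto simp: open_gg_dom)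
qed

text \<open>On a single orbit the length of \<open>ww a\<close> is the constant
  \<open>sin t\<close>, so normalizing it costs only a constant factor and stays smooth in
  \<open>a\<close>.\<close>

lemma orbit_section:
  assumes t: "t \<in> {0<..<pi/2}" and a: "a \<in> SU" "coset a \<in> orbit (pt t)"
  shows "a \<in> gg_dom" "gg a ** hrot (inverse (sin t)) (ww a) \<in> SU"
    "act (gg a ** hrot (inverse (sin t)) (ww a)) (pt t) = coset a"
proof -
  have c: "0 < cos t" and s: "0 < sin t"
    using t by (auto intro: cos_gt_zero sin_gt_zero)
  have h: "hgt a = (cos t)\<^sup>2"
    using hgt_orbit [OF a] .
  then have pos: "0 < hgt a"
    using c by simp
  then show "a \<in> gg_dom"
    using a by (simp add: SU_gg_dom)
  have "(norm (ww a))\<^sup>2 = (sin t)\<^sup>2"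
    using norm_ww [OF a(1)] h by (simp add: cos_squared_eq)
  then have n: "norm (ww a) = sin t"
    using s by (simp add: power2_eq_iff_nonneg)
  let ?h = "hrot (inverse (sin t)) (ww a)"
  have H: "?h \<in> H0" "rho ?h (\<chi> i. if i = 1 then of_real (sin t) else 0) = ww a"
    using hrot_H0 [of "inverse (sin t)" "ww a", unfolded n] s by simp_all
  note nf = normal_form [OF a(1) pos]
  show "gg a ** ?h \<in> SU"
    using H nf by (simp add: mult_SU H0_def)
  have "coset (mm (rho ?h (\<chi> i. if i = 1 then of_real (sin t) else 0)))
    = act ?h (coset (mm (\<chi> i. if i = 1 then of_real (sin t) else 0)))"
    by (rule coset_mm_rho [OF H(1)]) (simp add: norm_axis_2)
  also have "\<dots> = act ?h (pt t)"
    using t by (subst mm_axis) (auto simp: pt_eq)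
  finally have "act ?h (pt t) = coset (mm (ww a))"
    unfolding H(2) ..
  then show "act (gg a ** ?h) (pt t) = coset a"
    using nf(4) by (simp only: act_mult act_coset)
qed

lemma principal_orbit_diffeo:
  assumes t: "t \<in> {0<..<pi/2}"
  shows "\<exists>F. equi_diffeo (aloff_wallach 1 0) hom_act (wolf_part (orbit (pt t))) act F"
proof -
  have "Cinf_on gg_dom (\<lambda>a. gg a ** hrot (inverse (sin t)) (ww a))"
    unfolding hrot_def
    by (intro Cinf_intros Cinf_on_if Cinf_gg Cinf_ww) (auto simp: open_gg_dom)
  from hom_space_orbit_diffeo [OF radial_0_SU this, folded pt_eq] orbit_section [OF t]
  show ?thesis
    unfolding aloff_wallach_def stab_pt [OF t, symmetric] by blast
qed

lemma pt_0: "pt 0 = coset (mat 1)"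
  by (simp add: pt_def)

lemma mm_0: "mm 0 = mat 1"
  by (simp add: vec_eq_iff forall_4 mm_def mat_1_component)

lemma orbit_pt_0_section:
  assumes a: "a \<in> SU" "coset a \<in> orbit (pt 0)"
  shows "a \<in> gg_dom" "gg a \<in> SU" "act (gg a) (pt 0) = coset a"
proof -
  have h: "hgt a = 1"
    using hgt_orbit [OF a] by simp
  then show "a \<in> gg_dom"
    using a by (simp add: SU_gg_dom)
  have "ww a = 0"
    using norm_ww [OF a(1)] h by simp
  then show "gg a \<in> SU" "act (gg a) (pt 0) = coset a"
    using normal_form [OF a(1)] h by (simp_all add: mm_0 pt_0 act_coset)
qed

lemma emb_swap13_J_mat: "emb swap13 ** J_mat = radial_0 (pi/2)"
  by (simp add: mat4_simps emb_def swap13_def J_mat_def radial_0_eq)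

lemma involution_conj: "P ** P = mat 1 \<Longrightarrow> P ** (P ** M ** P) ** P = M" for P M :: "complex^'n^'n"
proof -
  assume P: "P ** P = mat 1"
  have "P ** (P ** M ** P) ** P = P ** P ** M ** (P ** P)"
    by (simp only: matrix_mul_assoc)
  then show ?thesis by (simp add: P)
qed

lemma H0_conj: "swap13 ** g ** swap13 \<in> H0 \<longleftrightarrow> g \<in> U2"
proof -
  have "swap13 ** g ** swap13 \<in> SU \<longleftrightarrow> g \<in> SU"
  proof
    assume "swap13 ** g ** swap13 \<in> SU"
    from mult_SU [OF mult_SU [OF swap13_SU this] swap13_SU]
    show "g \<in> SU"
      by (simp only: involution_conj [OF swap13_swap13])
  qed (intro mult_SU swap13_SU)
  then show ?thesis
    unfolding H0_def U2_def
    by (auto simp: matmul_component sum_3) (auto simp: swap13_def)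
qed

lemma ctranspose_swap13: "ctranspose swap13 = swap13"
  by (simp add: swap13_def vec_eq_iff forall_3)

text \<open>Here \<open>hgt\<close> vanishes, outside the chart of \<open>gg\<close>. Right
  multiplication by \<open>J_mat\<close> leads to the orbit of \<open>pt 0\<close>, and
  \<open>swap13\<close> restores the base point because of \<open>emb_swap13_J_mat\<close>.\<close>

lemma singular_orbit_diffeo_pi2:
  "\<exists>F. equi_diffeo (hom_space U2) hom_act (wolf_part (orbit (pt (pi/2)))) act F"
proof -
  let ?V = "(\<lambda>a. a ** J_mat) -` gg_dom"
  have J: "Cinf_on UNIV (\<lambda>a :: complex^4^4. a ** J_mat)"
    by (intro Cinf_intros) auto
  have V: "open ?V"
    using Cinf_on_continuous [OF J] open_gg_dom by (simp add: continuous_on_open_vimage)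
  have "Cinf_on ?V (\<lambda>a. gg (a ** J_mat) ** swap13)"
    by (intro Cinf_on_matmul Cinf_on_const Cinf_on_compose [OF Cinf_gg] Cinf_on_subset [OF J])
      (auto simp: V)
  moreover have "a \<in> ?V \<and> gg (a ** J_mat) ** swap13 \<in> SU \<and> act (gg (a ** J_mat) ** swap13) (pt (pi/2)) = coset a"
    if a: "a \<in> SU" "coset a \<in> orbit (pt (pi/2))" for a
  proof -
    have b: "a ** J_mat \<in> SU"
      using a by (simp add: mult_SU J_mat_SU)
    have "hgt (a ** J_mat) = 1"
      using hgt_orbit [OF a] a(1) by (simp add: hgt_J_mat)
    then have "coset (a ** J_mat) \<in> orbit (pt 0)"
      using orbit_pt_iff [OF b, of 0] by simp
    note s = orbit_pt_0_section [OF b this]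
    have "coset (emb (gg (a ** J_mat)) ** J_mat) = coset (a ** J_mat ** J_mat)"
      using s(2,3) b by (subst coset_J_mat) (auto simp: pt_0 act_coset)
    moreover have "emb (gg (a ** J_mat) ** swap13) ** radial_0 (pi/2) = emb (gg (a ** J_mat)) ** J_mat"
      by (simp add: emb_swap13_J_mat [symmetric] emb_mult [symmetric] matrix_mul_assoc)
        (simp add: matrix_mul_assoc [symmetric] swap13_swap13)
    ultimately have "act (gg (a ** J_mat) ** swap13) (pt (pi/2)) = coset a"
      by (simp add: pt_eq act_coset matrix_mul_assoc [symmetric] J_mat_J_mat)
    then show ?thesis
      using s by (simp add: mult_SU swap13_SU)
  qed
  ultimately show ?thesis
    using hom_space_orbit_diffeo [OF radial_0_SU, of ?V "\<lambda>a. gg (a ** J_mat) ** swap13" "pi/2"]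
    unfolding stab_pt_pi2 [symmetric] pt_eq [symmetric] by blast
qed

text \<open>The isotropy group of \<open>pt 0\<close> is \<open>H0\<close>, only a conjugate of
  \<open>U2\<close>. Moving the base point within its orbit makes the isotropy group literally
  \<open>U2\<close>, as a diffeomorphism from \<open>hom_space U2\<close> through the orbit map
  demands.\<close>

lemma stab_act_swap13: "stab (act swap13 (pt 0)) = U2"
proof -
  have "g \<in> stab (act swap13 (pt 0)) \<longleftrightarrow> swap13 ** g ** swap13 \<in> H0" for g
  proof
    assume "g \<in> stab (act swap13 (pt 0))"
    then obtain h where "h \<in> H0" "g = swap13 ** h ** swap13"
      unfolding stab_act [OF swap13_SU] stab_pt_0 ctranspose_swap13 by blast
    then show "swap13 ** g ** swap13 \<in> H0"
      by (simp only: involution_conj [OF swap13_swap13])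
  next
    assume "swap13 ** g ** swap13 \<in> H0"
    moreover have "g = swap13 ** (swap13 ** g ** swap13) ** swap13"
      by (simp only: involution_conj [OF swap13_swap13])
    ultimately show "g \<in> stab (act swap13 (pt 0))"
      unfolding stab_act [OF swap13_SU] stab_pt_0 ctranspose_swap13 by blast
  qed
  then show ?thesis
    using H0_conj by blast
qed

lemma singular_orbit_diffeo_0:
  "\<exists>F. equi_diffeo (hom_space U2) hom_act (wolf_part (orbit (pt 0))) act F"
proof -
  have 0: "act swap13 (pt 0) = coset (emb swap13)"
    by (simp add: pt_0 act_coset)
  have o: "orbit (coset (emb swap13)) = orbit (pt 0)"
    unfolding 0 [symmetric] by (rule orbit_act [OF swap13_SU])
  have "Cinf_on gg_dom (\<lambda>a. gg a ** swap13)"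
    by (intro Cinf_on_matmul Cinf_gg Cinf_on_const open_gg_dom)
  moreover have "a \<in> gg_dom \<and> gg a ** swap13 \<in> SU \<and> act (gg a ** swap13) (coset (emb swap13)) = coset a"
    if "a \<in> SU" "coset a \<in> orbit (coset (emb swap13))" for a
  proof -
    have "act (gg a ** swap13) (coset (emb swap13)) = act (gg a) (pt 0)"
      unfolding 0 [symmetric] by (simp add: act_mult [symmetric] matrix_mul_assoc [symmetric] swap13_swap13)
    then show ?thesis
      using orbit_pt_0_section that o by (simp add: mult_SU swap13_SU)
  qed
  ultimately show ?thesis
    using hom_space_orbit_diffeo [of "emb swap13" gg_dom "\<lambda>a. gg a ** swap13"] swap13_SU
    unfolding o stab_act_swap13 [unfolded 0] by auto
qed

section \<open>The identification of N^{1,0} with N^{1,-1}\<close>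

definition perm23 :: "complex^3^3" where
  "perm23 = (\<chi> i j. if i = 1 \<and> j = 1 then -1 else if (i = 2 \<and> j = 3) \<or> (i = 3 \<and> j = 2) then 1 else 0)"

lemma perm23: "perm23 \<in> SU" "perm23 ** perm23 = mat 1" "ctranspose perm23 = perm23"
  by (simp_all add: SU_def perm23_def det_3 mat3_simps)

text \<open>Exchanging the last two coordinates turns the weights (1,0,-1) into (1,-1,0). The entry
  -1 of \<open>perm23\<close> only serves to make its determinant 1.\<close>

lemma U1_conj: "perm23 ** g ** perm23 \<in> U1 1 (-1) \<longleftrightarrow> g \<in> U1 1 0"
proof -
  have "perm23 ** g ** perm23 = (\<chi> i j. if i \<noteq> j then 0
                     else if i = 1 then cis (real_of_int 1 * \<theta>)
                     else if i = 2 then cis (real_of_int (-1) * \<theta>)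
                     else cis (- real_of_int (1 + (-1)) * \<theta>)) \<longleftrightarrow>
    g = (\<chi> i j. if i \<noteq> j then 0
                     else if i = 1 then cis (real_of_int 1 * \<theta>)
                     else if i = 2 then cis (real_of_int 0 * \<theta>)
                     else cis (- real_of_int (1 + 0) * \<theta>))" for \<theta>
    by (auto simp: mat3_simps perm23_def)
  then show ?thesis
    unfolding U1_iff by blast
qed

lemma is_grp_conj:
  assumes H: "is_grp H" and P: "P \<in> SU" "P ** P = mat 1" "ctranspose P = P"
  shows "is_grp {P ** g ** P | g. g \<in> H}"
  unfolding is_grp_def
proof (intro conjI ballI)
  show "{P ** g ** P | g. g \<in> H} \<subseteq> SU"
    using H P(1) by (auto simp: is_grp_def intro!: mult_SU)
  show "mat 1 \<in> {P ** g ** P | g. g \<in> H}"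
    using H P(2) by (intro CollectI exI [of _ "mat 1"]) (simp add: is_grp_def)
next
  fix x y assume "x \<in> {P ** g ** P | g. g \<in> H}" "y \<in> {P ** g ** P | g. g \<in> H}"
  then obtain g h where gh: "g \<in> H" "h \<in> H" "x = P ** g ** P" "y = P ** h ** P" by blast
  have "x ** y = P ** g ** (P ** P) ** h ** P"
    unfolding gh by (simp only: matrix_mul_assoc)
  then have "x ** y = P ** (g ** h) ** P"
    by (simp add: P matrix_mul_assoc)
  then show "x ** y \<in> {P ** g ** P | g. g \<in> H}"
    using gh H unfolding is_grp_def by blast
next
  fix x assume "x \<in> {P ** g ** P | g. g \<in> H}"
  then obtain g where g: "g \<in> H" "x = P ** g ** P" by blast
  then have "ctranspose x = P ** ctranspose g ** P"
    by (simp add: ctranspose_mult P matrix_mul_assoc)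
  then show "ctranspose x \<in> {P ** g ** P | g. g \<in> H}"
    using g H unfolding is_grp_def by blast
qed

text \<open>Right translation by \<open>perm23\<close> commutes with the left action of SU(3) and
  carries cosets of a subgroup to cosets of its conjugate. Being an involution, it is its own
  section.\<close>

lemma aloff_wallach_diffeo: "\<exists>F. equi_diffeo (aloff_wallach 1 0) hom_act (aloff_wallach 1 (-1)) hom_act F"
proof -
  have t: "pi/4 \<in> {0<..<pi/2}" by simp
  have G: "is_grp (U1 1 0)"
    unfolding stab_pt [OF t, symmetric] by (rule is_grp_stab)
  note inv = involution_conj [OF perm23(2)]
  have U: "U1 1 (-1) = {perm23 ** g ** perm23 | g. g \<in> U1 1 0}"
  proof (intro set_eqI iffI)
    fix x assume "x \<in> U1 1 (-1)"
    then have "perm23 ** x ** perm23 \<in> U1 1 0"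
      using U1_conj [of "perm23 ** x ** perm23"] by (simp add: inv)
    then show "x \<in> {perm23 ** g ** perm23 | g. g \<in> U1 1 0}"
      by (intro CollectI exI [of _ "perm23 ** x ** perm23"]) (simp add: inv)
  qed (use U1_conj in blast)
  have G': "is_grp (U1 1 (-1))"
    unfolding U using G perm23 by (rule is_grp_conj)
  have "\<exists>F. equi_diffeo (SU, \<lambda>g. (\<lambda>h. g ** h) ` U1 1 0) hom_act (SU, \<lambda>g. (\<lambda>h. g ** h) ` U1 1 (-1)) hom_act F \<and>
    (\<forall>x\<in>SU. F ((\<lambda>h. x ** h) ` U1 1 0) = (\<lambda>h. (x ** perm23) ** h) ` U1 1 (-1))"
  proof (rule equi_diffeo_exI)
    show s: "Cinf_on UNIV (\<lambda>x :: complex^3^3. x ** perm23)"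
      by (intro Cinf_intros) auto
    show "(\<lambda>x. x ** perm23) ` SU \<subseteq> SU"
      using perm23 by (auto intro: mult_SU)
    fix x y :: "complex^3^3"
    assume x: "x \<in> SU" and y: "y \<in> SU"
    have "ctranspose (x ** perm23) ** (y ** perm23) = perm23 ** (ctranspose x ** y) ** perm23"
      by (simp add: ctranspose_mult perm23 matrix_mul_assoc)
    then show "(\<lambda>h. x ** h) ` U1 1 0 = (\<lambda>h. y ** h) ` U1 1 0 \<longleftrightarrow>
      (\<lambda>h. (x ** perm23) ** h) ` U1 1 (-1) = (\<lambda>h. (y ** perm23) ** h) ` U1 1 (-1)"
      using x y by (simp add: grp_coset_eq_iff [OF G] grp_coset_eq_iff [OF G'] mult_SU perm23 U1_conj)
  next
    fix y :: "complex^3^3" assume "y \<in> SU"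
    have "Cinf_on UNIV (\<lambda>x :: complex^3^3. x ** perm23)"
      by (intro Cinf_intros) auto
    then show "\<exists>V \<psi>. y \<in> V \<and> Cinf_on V \<psi> \<and> (\<forall>z \<in> SU \<inter> V. \<psi> z \<in> SU \<and>
      (\<lambda>h. (\<psi> z ** perm23) ** h) ` U1 1 (-1) = (\<lambda>h. z ** h) ` U1 1 (-1))"
      by (intro exI [of _ UNIV] exI [of _ "\<lambda>x. x ** perm23"])
        (auto simp: mult_SU perm23 matrix_mul_assoc [symmetric])
  next
    fix g x :: "complex^3^3"
    assume "g \<in> SU" "x \<in> SU"
    then show "\<exists>y\<in>SU. hom_act g ((\<lambda>h. x ** h) ` U1 1 0) = (\<lambda>h. y ** h) ` U1 1 0 \<and>
       hom_act g ((\<lambda>h. (x ** perm23) ** h) ` U1 1 (-1)) = (\<lambda>h. (y ** perm23) ** h) ` U1 1 (-1)"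
      by (intro bexI [of _ "g ** x"]) (auto simp: hom_act_coset matrix_mul_assoc mult_SU)
  qed simp
  then show ?thesis
    by (auto simp: aloff_wallach_def hom_space_def)
qed

subsection \<open>The complex projective plane\<close>

definition ccross :: "complex^3 \<Rightarrow> complex^3 \<Rightarrow> complex^3" where
  "ccross x y = (\<chi> i. if i = 1 then x$2 * y$3 - x$3 * y$2
    else if i = 2 then x$3 * y$1 - x$1 * y$3 else x$1 * y$2 - x$2 * y$1)"

text \<open>The conjugate of the bilinear cross product is Hermitian-orthogonal to both factors; the
  order \<open>u\<close>, cross product, \<open>z\<close> of the columns gives determinant
  +1.\<close>

definition frame :: "complex^3 \<Rightarrow> complex^3 \<Rightarrow> complex^3^3" where
  "frame z u = (\<chi> i j. if j = 3 then z $ i else if j = 1 then u $ i else cnj (ccross z u $ i))"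

lemma frame_SU:
  assumes "hprod z z = 1" "hprod u u = 1" "hprod u z = 0"
  shows "frame z u \<in> SU"
proof -
  obtain z1 z2 z3 u1 u2 u3 where z: "z$1 = z1" "z$2 = z2" "z$3 = z3" "u$1 = u1" "u$2 = u2" "u$3 = u3" by blast
  obtain y1 y2 y3 v1 v2 v3 where y: "cnj z1 = y1" "cnj z2 = y2" "cnj z3 = y3" "cnj u1 = v1" "cnj u2 = v2" "cnj u3 = v3"
    by blast
  have cy: "cnj y1 = z1" "cnj y2 = z2" "cnj y3 = z3" "cnj v1 = u1" "cnj v2 = u2" "cnj v3 = u3"
    using y by auto
  have "hprod z u = 0"
    using assms(3) by (simp add: hprod_commute [of z u])
  with assms have e: "y1 * z1 + y2 * z2 + y3 * z3 = 1" "v1 * u1 + v2 * u2 + v3 * u3 = 1"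
    "v1 * z1 + v2 * z2 + v3 * z3 = 0" "y1 * u1 + y2 * u2 + y3 * u3 = 0"
    by (simp_all add: hprod_def sum_3 z y)
  have "ctranspose (frame z u) ** frame z u = mat 1"
    apply (simp add: mat3_simps frame_def ccross_def z y cy e)
    using e by (intro conjI; ((simp add: algebra_simps; fail) | algebra))
  moreover have "det (frame z u) = 1"
    apply (simp add: det_3 frame_def ccross_def z y cy)
    using e by algebra
  ultimately show ?thesis
    by (simp add: SU_def matrix_left_right_inverse)
qed

lemma span_singleton_eq_iff:
  fixes x y :: "complex^'n"
  assumes "y \<noteq> 0"
  shows "vec.span {x} = vec.span {y} \<longleftrightarrow> (\<exists>c. y = c *s x)"
proof
  assume "vec.span {x} = vec.span {y}"
  then have "y \<in> vec.span {x}"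
    by (simp add: vec.span_base)
  then show "\<exists>c. y = c *s x"
    by (auto simp: vec.span_singleton)
next
  assume "\<exists>c. y = c *s x"
  then obtain c where c: "y = c *s x" by blast
  with assms have "c \<noteq> 0" by auto
  then have "x = inverse c *s y"
    by (simp add: c vector_smult_assoc)
  then have "x \<in> vec.span {y}"
    by (metis vec.span_base vec.span_scale singletonI)
  moreover have "y \<in> vec.span {x}"
    by (metis c vec.span_base vec.span_scale singletonI)
  ultimately show "vec.span {x} = vec.span {y}"
    by (simp add: vec.span_eq)
qed

text \<open>The entry (3,3) has modulus one, which leaves no room for the rest of the third row. So
  \<open>U2\<close> is the stabilizer of the line spanned by the third basis vector.\<close>

lemma U2_iff_col:
  assumes "m \<in> SU"
  shows "m \<in> U2 \<longleftrightarrow> m$1$3 = 0 \<and> m$2$3 = 0"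
proof
  assume *: "m$1$3 = 0 \<and> m$2$3 = 0"
  have "m$3$3 * cnj (m$3$3) = 1"
    using unitary_col [OF SU_D1 [OF assms], of 3 3] * by (simp add: sum_3 mult.commute)
  then have "m$3$1 * cnj (m$3$1) + m$3$2 * cnj (m$3$2) = 0"
    using unitary_row [OF SU_D1 [OF assms], of 3 3] by (simp add: sum_3)
  then have "complex_of_real ((cmod (m$3$1))\<^sup>2 + (cmod (m$3$2))\<^sup>2) = 0"
    by (simp add: complex_norm_square del: of_real_power)
  then have "(cmod (m$3$1))\<^sup>2 + (cmod (m$3$2))\<^sup>2 = 0"
    using of_real_eq_0_iff by blast
  then have "m$3$1 = 0" "m$3$2 = 0"
    by (simp_all add: add_nonneg_eq_0_iff)
  with * assms show "m \<in> U2" by (simp add: U2_def)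
qed (simp add: U2_def)

lemma Cinf_on_ccross: "Cinf_on U f \<Longrightarrow> Cinf_on U g \<Longrightarrow> Cinf_on U (\<lambda>x. ccross (f x) (g x))"
  unfolding ccross_def by (intro Cinf_intros Cinf_on_if)

text \<open>The norm is written as the root of its square so that the smoothness rules
  apply.\<close>

definition unitize :: "complex^3 \<Rightarrow> complex^3" where
  "unitize z = (\<chi> i. of_real (inverse (sqrt ((norm z)\<^sup>2))) * z $ i)"

lemma unitize_eq: "unitize z = of_real (inverse (norm z)) *s z"
  by (simp add: unitize_def vec_eq_iff)

lemma hprod_unitize: "z \<noteq> 0 \<Longrightarrow> hprod (unitize z) (unitize z) = 1"
proof -
  assume "z \<noteq> 0"
  have "hprod (unitize z) (unitize z) = of_real (inverse (norm z)) * of_real (inverse (norm z)) * hprod z z"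
    by (simp add: unitize_eq hprod_def sum_distrib_left algebra_simps)
  also have "\<dots> = 1"
    using \<open>z \<noteq> 0\<close> by (simp add: hprod_self power2_eq_square field_simps)
  finally show ?thesis .
qed

lemma Cinf_on_unitize:
  assumes "Cinf_on U f" "\<And>x. x \<in> U \<Longrightarrow> f x \<noteq> 0"
  shows "Cinf_on U (\<lambda>x. unitize (f x))"
  unfolding unitize_def using assms by (intro Cinf_intros) auto

text \<open>The orbit map is \<open>column 3\<close>. A local section completes the normalized
  vector to a frame, using a fixed vector \<open>b\<close> that is nowhere parallel to
  \<open>z\<close> on the neighbourhood.\<close>

lemma CP2_diffeo: "\<exists>F. equi_diffeo (hom_space U2) hom_act CP2 line_act F"
proof -
  have G: "is_grp U2"
    unfolding stab_pt_pi2 [symmetric] by (rule is_grp_stab)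
  have nz: "column 3 g \<noteq> 0" if "g \<in> SU" for g :: "complex^3^3"
  proof
    assume "column 3 g = 0"
    then have "g $ k $ 3 = 0" for k
      by (simp add: column_def vec_eq_iff)
    then show False
      using unitary_col [OF SU_D1 [OF that], of 3 3] by simp
  qed
  have "\<exists>F. equi_diffeo (SU, \<lambda>g. (\<lambda>h. g ** h) ` U2) hom_act (- {0}, \<lambda>z. vec.span {z}) line_act F \<and>
    (\<forall>x\<in>SU. F ((\<lambda>h. x ** h) ` U2) = vec.span {column 3 x})"
  proof (rule equi_diffeo_exI)
    show "Cinf_on UNIV (column 3 :: complex^3^3 \<Rightarrow> _)"
      unfolding column_def [abs_def] by (intro Cinf_intros) auto
    show "column 3 ` (SU :: (complex^3^3) set) \<subseteq> - {0}"
      using nz by auto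
    fix x y :: "complex^3^3"
    assume x: "x \<in> SU" and y: "y \<in> SU"
    let ?m = "ctranspose x ** y"
    have m: "?m \<in> SU" using x y by (simp add: mult_SU ctranspose_SU)
    have yx: "y = x ** ?m" using x by (simp add: SU_cancel)
    have "?m$1$3 = 0 \<and> ?m$2$3 = 0 \<longleftrightarrow> (\<exists>c. column 3 y = c *s column 3 x)"
    proof
      assume "?m$1$3 = 0 \<and> ?m$2$3 = 0"
      then have "(x ** ?m) $ i $ 3 = ?m$3$3 * x $ i $ 3" for i
        by (simp add: matmul_component [of x] sum_3)
      then have "column 3 y = ?m$3$3 *s column 3 x"
        unfolding yx [symmetric] by (simp add: vec_eq_iff column_def)
      then show "\<exists>c. column 3 y = c *s column 3 x" by blast
    next
      assume "\<exists>c. column 3 y = c *s column 3 x"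
      then obtain c where c: "y $ k $ 3 = c * x $ k $ 3" for k
        by (auto simp: vec_eq_iff column_def)
      have "?m $ i $ 3 = c * (\<Sum>k\<in>UNIV. cnj (x $ k $ i) * x $ k $ 3)" for i
        by (simp add: matmul_component c sum_distrib_left algebra_simps)
      then show "?m$1$3 = 0 \<and> ?m$2$3 = 0"
        using unitary_col [OF SU_D1 [OF x]] by simp
    qed
    then show "(\<lambda>h. x ** h) ` U2 = (\<lambda>h. y ** h) ` U2 \<longleftrightarrow> vec.span {column 3 x} = vec.span {column 3 y}"
      by (simp add: grp_coset_eq_iff [OF G x y] U2_iff_col [OF m] span_singleton_eq_iff [OF nz [OF y]])
  next
    fix z0 :: "complex^3" assume "z0 \<in> - {0}"
    then have z0: "z0 \<noteq> 0" by simp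
    \<comment> \<open>A nonzero vector is parallel to at most one of two coordinate axes.\<close>
    have "ccross z0 (axis 1 1) \<noteq> 0 \<or> ccross z0 (axis 2 1) \<noteq> 0"
      using z0 by (auto simp: ccross_def vec_eq_iff forall_3 axis_def)
    then obtain b where b: "ccross z0 b \<noteq> 0" by blast
    let ?V = "{z. ccross z b \<noteq> 0}"
    have cb: "Cinf_on U (\<lambda>z. ccross z b)" if "open U" for U
      using that by (intro Cinf_on_ccross Cinf_intros)
    have V: "open ?V"
      using Cinf_on_continuous [OF cb [OF open_UNIV]] by (intro open_Collect_neq continuous_on_const) auto
    have "ccross 0 b = 0"
      by (simp add: ccross_def vec_eq_iff)
    then have V0: "z \<noteq> 0" if "z \<in> ?V" for z
      using that by auto
    define u where "u z = (\<chi> i. cnj (ccross z b $ i))" for z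
    have un: "u z \<noteq> 0" if "z \<in> ?V" for z
      using that by (auto simp: u_def vec_eq_iff)
    have uz: "hprod (u z) z = 0" for z
      by (simp add: hprod_def u_def sum_3 ccross_def algebra_simps)
    have "Cinf_on ?V (\<lambda>z. frame (unitize z) (unitize (u z)))"
    proof -
      have "Cinf_on ?V (\<lambda>z. unitize z)"
        using V0 by (intro Cinf_on_unitize Cinf_on_ident V) auto
      moreover have "Cinf_on ?V (\<lambda>z. unitize (u z))"
      proof (intro Cinf_on_unitize)
        show "Cinf_on ?V u"
          unfolding u_def by (intro Cinf_intros cb V)
      qed (use un in auto)
      ultimately show ?thesis
        unfolding frame_def by (intro Cinf_intros Cinf_on_if Cinf_on_ccross)
    qed
    moreover have "frame (unitize z) (unitize (u z)) \<in> SU \<and>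
      vec.span {column 3 (frame (unitize z) (unitize (u z)))} = vec.span {z}" if z: "z \<in> ?V" for z
    proof
      have "hprod (unitize (u z)) (unitize z) = of_real (inverse (norm (u z))) * of_real (inverse (norm z)) * hprod (u z) z"
        by (simp add: unitize_eq hprod_def sum_distrib_left algebra_simps)
      then show "frame (unitize z) (unitize (u z)) \<in> SU"
        using V0 [OF z] un [OF z] uz by (intro frame_SU hprod_unitize) auto
      have "column 3 (frame (unitize z) (unitize (u z))) = unitize z"
        by (simp add: column_def frame_def)
      moreover have "z = of_real (norm z) *s unitize z"
        using V0 [OF z] by (simp add: unitize_eq vector_smult_assoc)
      ultimately show "vec.span {column 3 (frame (unitize z) (unitize (u z)))} = vec.span {z}"
        using span_singleton_eq_iff [OF V0 [OF z]] by metis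
    qed
    ultimately show "\<exists>V \<psi>. z0 \<in> V \<and> Cinf_on V \<psi> \<and> (\<forall>z \<in> - {0} \<inter> V. \<psi> z \<in> SU \<and>
      vec.span {column 3 (\<psi> z)} = vec.span {z})"
      using b by (intro exI [of _ ?V] exI [of _ "\<lambda>z. frame (unitize z) (unitize (u z))"]) auto
  next
    fix g x :: "complex^3^3"
    assume g: "g \<in> SU" "x \<in> SU"
    have "column 3 (g ** x) = g *v column 3 x"
      by (simp add: vec_eq_iff column_def matmul_component matvec_component)
    then have "line_act g (vec.span {column 3 x}) = vec.span {column 3 (g ** x)}"
      unfolding line_act_def
      using vec.linear_span_image [OF matrix_vector_mul_linear_gen [of g], of "{column 3 x}"] by simp
    then show "\<exists>y\<in>SU. hom_act g ((\<lambda>h. x ** h) ` U2) = (\<lambda>h. y ** h) ` U2 \<and>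
       line_act g (vec.span {column 3 x}) = vec.span {column 3 y}"
      using g by (intro bexI [of _ "g ** x"]) (auto simp: hom_act_coset mult_SU)
  qed simp
  then show ?thesis
    by (auto simp: CP2_def hom_space_def)
qed

subsection \<open>Disc bundles\<close>

lemma bundle_class_eq_iff:
  assumes H: "is_grp H" and \<rho>: "\<rho> (mat 1) = id" "\<And>h k. h \<in> H \<Longrightarrow> k \<in> H \<Longrightarrow> \<rho> (h ** k) = \<rho> h \<circ> \<rho> k"
    and g: "g \<in> SU" "g' \<in> SU"
  shows "bundle_class H \<rho> (g, v) = bundle_class H \<rho> (g', v') \<longleftrightarrow>
    ctranspose g' ** g \<in> H \<and> v' = \<rho> (ctranspose g' ** g) v"
proof -
  have cl: "bundle_class H \<rho> (x, u) = {(x ** ctranspose h, \<rho> h u) | h. h \<in> H}" for x u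
    unfolding bundle_class_def using is_grp_SU [OF H] by (auto simp: matrix_inv_SU) (metis matrix_inv_SU)
  have H': "mat 1 \<in> H" "\<And>h k. h \<in> H \<Longrightarrow> k \<in> H \<Longrightarrow> h ** k \<in> H" "\<And>h. h \<in> H \<Longrightarrow> ctranspose h \<in> H"
    using H by (auto simp: is_grp_def)
  show ?thesis
  proof
    assume eq: "bundle_class H \<rho> (g, v) = bundle_class H \<rho> (g', v')"
    have "(g', v') \<in> bundle_class H \<rho> (g', v')"
      unfolding cl using H'(1) \<rho>(1) by (intro CollectI exI [of _ "mat 1"]) simp
    then have "(g', v') \<in> bundle_class H \<rho> (g, v)"
      by (simp only: eq)
    then have "(g', v') \<in> {(g ** ctranspose h, \<rho> h v) | h. h \<in> H}"
      by (simp only: cl)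
    then obtain h where h: "h \<in> H" "g' = g ** ctranspose h" "v' = \<rho> h v"
      by auto
    then have "ctranspose g' ** g = h"
      using g by (simp add: ctranspose_mult SU_cancel)
    with h show "ctranspose g' ** g \<in> H \<and> v' = \<rho> (ctranspose g' ** g) v" by simp
  next
    define k where "k = ctranspose g' ** g"
    assume "ctranspose g' ** g \<in> H \<and> v' = \<rho> (ctranspose g' ** g) v"
    then have k: "k \<in> H" "v' = \<rho> k v" by (simp_all add: k_def)
    have kS: "k \<in> SU" using is_grp_SU [OF H k(1)] .
    have g'k: "g' = g ** ctranspose k" "g' ** k = g"
      using g by (simp_all add: k_def ctranspose_mult SU_cancel)
    show "bundle_class H \<rho> (g, v) = bundle_class H \<rho> (g', v')"
      unfolding cl
    proof (intro set_eqI iffI)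
      fix z assume "z \<in> {(g ** ctranspose h, \<rho> h v) | h. h \<in> H}"
      then obtain h where h: "h \<in> H" "z = (g ** ctranspose h, \<rho> h v)" by blast
      have "z = (g' ** ctranspose (h ** ctranspose k), \<rho> (h ** ctranspose k) v')"
        using h k H' g'k(2) \<rho>(2) [of "h ** ctranspose k" k] kS
        by (simp add: ctranspose_mult matrix_mul_assoc SU_cancel)
      then show "z \<in> {(g' ** ctranspose h, \<rho> h v') | h. h \<in> H}"
        using h k H' by blast
    next
      fix z assume "z \<in> {(g' ** ctranspose h, \<rho> h v') | h. h \<in> H}"
      then obtain h where h: "h \<in> H" "z = (g' ** ctranspose h, \<rho> h v')" by blast
      have "z = (g ** ctranspose (h ** k), \<rho> (h ** k) v)"
        using h k H' g'k(1) \<rho>(2) [of h k] by (simp add: ctranspose_mult matrix_mul_assoc)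
      then show "z \<in> {(g ** ctranspose h, \<rho> h v) | h. h \<in> H}"
        using h k H' by blast
    qed
  qed
qed

lemma bundle_act_class: "bundle_act g (bundle_class H \<rho> (m, v)) = bundle_class H \<rho> (g ** m, v)"
  unfolding bundle_act_def bundle_class_def by (auto simp: matrix_mul_assoc image_iff) (metis matrix_mul_assoc)

lemma rho_one: "rho (mat 1) = id"
  by (simp add: rho_def fun_eq_iff vec_eq_iff forall_2 mat_1_component)

lemma rho_mult: "h \<in> H0 \<Longrightarrow> k \<in> H0 \<Longrightarrow> rho (h ** k) = rho h \<circ> rho k"
  by (simp add: H0_def rho_def fun_eq_iff vec_eq_iff forall_2 matmul_component sum_3 algebra_simps)

lemma linear_rho: "linear (rho h)"
  by (intro linearI) (simp_all add: rho_def vec_eq_iff forall_2 algebra_simps)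

lemma hgt_mm: "norm w \<le> 1 \<Longrightarrow> hgt (mm w) = 1 - (norm w)\<^sup>2"
  by (simp add: hgt_def mm_def power_le_one)

lemma blk_emb_iff: "g \<in> SU \<Longrightarrow> blk (emb g) \<longleftrightarrow> g \<in> H0"
  by (auto simp: H0_def blk_def emb_def)

text \<open>Uniqueness of the normal form up to \<open>H0\<close>. Comparing fourth rows in
  \<open>mm x ** k = emb m ** mm y\<close> shows that the block diagonal \<open>k\<close> is
  \<open>emb h\<close> with \<open>h\<close> in \<open>H0\<close> and \<open>x = rho h y\<close>;
  then \<open>mm_rho\<close> and cancellation of \<open>mm y\<close> give
  \<open>h = m\<close>.\<close>

lemma coset_mm_eq_iff:
  assumes g: "g \<in> SU" "g' \<in> SU" and x: "norm x < 1" and y: "norm y < 1"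
  shows "coset (emb g ** mm x) = coset (emb g' ** mm y) \<longleftrightarrow>
    ctranspose g ** g' \<in> H0 \<and> x = rho (ctranspose g ** g') y"
proof
  assume *: "ctranspose g ** g' \<in> H0 \<and> x = rho (ctranspose g ** g') y"
  let ?h = "ctranspose g ** g'"
  have "emb g' ** mm y = emb g ** (emb ?h ** mm y)"
    using g by (simp add: emb_mult ctranspose_emb [symmetric] SU_cancel matrix_mul_assoc SU_D1)
  also have "\<dots> = emb g ** mm x ** emb ?h"
    using * by (simp add: mm_rho [symmetric] matrix_mul_assoc)
  finally show "coset (emb g ** mm x) = coset (emb g' ** mm y)"
    using g x * blk_emb_H0 by (simp add: coset_mult_right mult_SU ctranspose_SU mm_SU)
next
  assume eq: "coset (emb g ** mm x) = coset (emb g' ** mm y)"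
  have SU: "mm x \<in> SU" "mm y \<in> SU" "emb g ** mm x \<in> SU" "emb g' ** mm y \<in> SU"
    using g x y by (simp_all add: mult_SU mm_SU)
  define m where "m = ctranspose g ** g'"
  define k where "k = ctranspose (emb g ** mm x) ** (emb g' ** mm y)"
  have k: "blk k" "k \<in> SU"
    using eq coset_eq_iff [OF SU(3,4)] SU by (simp_all add: k_def mult_SU ctranspose_SU)
  have e: "mm x ** k = emb m ** mm y"
    using SU g by (simp add: k_def m_def ctranspose_mult emb_mult ctranspose_emb [symmetric] matrix_mul_assoc SU_D1)
  have row: "(mm x ** k) $ 4 $ j = mm y $ 4 $ j" for j
    unfolding e by (simp add: matmul_component sum_4 emb_def)
  define p q where "p = sqrt (1 - (norm x)\<^sup>2)" and "q = sqrt (1 - (norm y)\<^sup>2)"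
  have pq: "0 < p" "0 < q"
    using x y by (simp_all add: p_def q_def power_less_one_iff)
  have b: "k$1$2 = 0" "k$1$3 = 0" "k$2$1 = 0" "k$2$4 = 0" "k$3$1 = 0" "k$3$4 = 0" "k$4$2 = 0" "k$4$3 = 0"
    using k(1) by (simp_all add: blk_def)
  have "(mm x ** k)$4$1 = of_real p * k$4$1" "(mm x ** k)$4$4 = of_real p * k$4$4"
    "(mm x ** k)$4$2 = - (cnj (x$1) * k$2$2 + cnj (x$2) * k$3$2)"
    "(mm x ** k)$4$3 = - (cnj (x$1) * k$2$3 + cnj (x$2) * k$3$3)"
    by (simp_all add: matmul_component sum_4 mm_def p_def b)
  moreover have "mm y$4$1 = 0" "mm y$4$4 = of_real q" "mm y$4$2 = - cnj (y$1)" "mm y$4$3 = - cnj (y$2)"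
    by (simp_all add: mm_def q_def)
  ultimately have r: "of_real p * k$4$1 = 0" "of_real p * k$4$4 = of_real q"
    "cnj (x$1) * k$2$2 + cnj (x$2) * k$3$2 = cnj (y$1)" "cnj (x$1) * k$2$3 + cnj (x$2) * k$3$3 = cnj (y$2)"
    using row by (simp_all only: neg_equal_iff_equal)
  then have k41: "k$4$1 = 0" using pq by simp
  have "k$4$4 * cnj (k$4$4) = 1"
    using unitary_row [OF SU_D1 [OF k(2)], of 4 4] b k41 by (simp add: sum_4)
  then have "cmod (k$4$4) = 1"
    by (rule cmod_eq_1)
  moreover have "\<bar>p\<bar> * cmod (k$4$4) = \<bar>q\<bar>"
    using arg_cong [OF r(2), of cmod] by (simp add: norm_mult)
  \<comment> \<open>A number of modulus one times a positive number is positive only if it equals 1.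
    This is where the strict bounds on the norms enter; for vectors of norm one \<open>p\<close> and
    \<open>q\<close> vanish.\<close>
  ultimately have "p = q" using pq by simp
  then have k44: "k$4$4 = 1" using r(2) pq by simp
  note h = emb_res [OF k(2) k41 b(7,8) k44]
  define h where "h = res k"
  have hk: "emb h = k" "h \<in> SU" using h by (simp_all add: h_def)
  have H: "h \<in> H0"
    using k(1) hk blk_emb_iff by metis
  have he: "h$2$2 = k$2$2" "h$2$3 = k$2$3" "h$3$2 = k$3$2" "h$3$3 = k$3$3"
    by (simp_all add: h_def res_def)
  have y: "y$1 = x$1 * cnj (k$2$2) + x$2 * cnj (k$3$2)" "y$2 = x$1 * cnj (k$2$3) + x$2 * cnj (k$3$3)"
    using arg_cong [OF r(3), of cnj] arg_cong [OF r(4), of cnj] by simp_all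
  note ur = unitary_row [OF SU_D1 [OF k(2)]]
  have "k$2$2 * cnj (k$2$2) + k$2$3 * cnj (k$2$3) = 1" "k$3$2 * cnj (k$3$2) + k$3$3 * cnj (k$3$3) = 1"
    "k$2$2 * cnj (k$3$2) + k$2$3 * cnj (k$3$3) = 0" "k$3$2 * cnj (k$2$2) + k$3$3 * cnj (k$2$3) = 0"
    using ur [of 2 2] ur [of 3 3] ur [of 2 3] ur [of 3 2] b by (simp_all add: sum_4)
  then have "rho h y $ 1 = x $ 1" "rho h y $ 2 = x $ 2"
    unfolding rho_def he y by (simp_all, algebra+)
  then have xy: "x = rho h y"
    by (simp add: vec_eq_iff forall_2)
  have "emb h ** mm y = emb m ** mm y"
    using mm_rho [OF H, of y] e hk xy by simp
  then have "emb h ** mm y ** ctranspose (mm y) = emb m ** mm y ** ctranspose (mm y)"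
    by simp
  then have "h = m"
    using emb_inj by (simp add: SU_cancel SU)
  with H xy show "ctranspose g ** g' \<in> H0 \<and> x = rho (ctranspose g ** g') y"
    by (simp add: m_def)
qed

lemma Cinf_on_rho: "Cinf_on U f \<Longrightarrow> Cinf_on U g \<Longrightarrow> Cinf_on U (\<lambda>x. rho (f x) (g x))"
  unfolding rho_def by (intro Cinf_intros Cinf_on_if)

text \<open>The matrices \<open>w\<close> and \<open>J\<close> allow to treat both singular orbits at once: with \<open>J\<close> swapping the
  two blocks, right multiplication by \<open>J\<close> is the passage to the orthogonal plane.\<close>

lemma disc_bundle_over_generic:
  assumes J: "J \<in> SU" "J ** J = mat 1" "ctranspose J = J" "\<And>M. blk (J ** M ** J) \<longleftrightarrow> blk M"
    and w: "w \<in> SU" "w ** w = mat 1" "ctranspose w = w"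
    and s: "0 < s" "s < 1"
    and Z: "Z = coset (emb w ** J)"
    and D: "\<And>a. a \<in> SU \<Longrightarrow> coset a \<in> D \<longleftrightarrow> 1 - s\<^sup>2 \<le> hgt (a ** J)"
    and Sph: "Sph \<subseteq> wolf" "\<And>a. a \<in> SU \<Longrightarrow> coset a \<in> Sph \<longleftrightarrow> hgt (a ** J) = 1 - s\<^sup>2"
  shows "disc_bundle_over Z D Sph"
proof -
  let ?H = "stab Z"
  define \<rho> where "\<rho> h = rho (w ** h ** w)" for h
  \<comment> \<open>The factor \<open>s\<close> shrinks the unit disc to a slice disc of radius less
    than 1, inside the domain of smoothness of \<open>mm\<close>; its boundary lies at height
    \<open>1 - s\<^sup>2\<close>.\<close>
  define \<phi> where "\<phi> = (\<lambda>x :: (complex^3^3) \<times> (complex^2). emb (fst x ** w) ** mm (s *\<^sub>R snd x) ** J)"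
  define T where "T = {a \<in> SU. coset a \<in> D}"
  have wJ: "emb w ** J \<in> SU" using w J by (simp add: mult_SU)
  have JJ: "M ** J ** J = M" for M :: "complex^4^4"
    using J(2) by (simp add: matrix_mul_assoc [symmetric])
  have ww': "M ** w ** w = M" for M :: "complex^3^3"
    using w(2) by (simp add: matrix_mul_assoc [symmetric])
  have cJ: "coset (a ** J) = coset (b ** J) \<longleftrightarrow> coset a = coset b" if "a \<in> SU" "b \<in> SU" for a b
  proof -
    have "ctranspose (a ** J) ** (b ** J) = J ** (ctranspose a ** b) ** J"
      by (simp add: ctranspose_mult J matrix_mul_assoc)
    then show ?thesis
      using that by (simp add: coset_eq_iff mult_SU J)
  qed
  have H: "h \<in> ?H \<longleftrightarrow> h \<in> SU \<and> w ** h ** w \<in> H0" for h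
  proof -
    have "ctranspose (emb w ** J) ** emb h ** (emb w ** J) = J ** emb (w ** h ** w) ** J"
      by (simp add: ctranspose_mult J ctranspose_emb w emb_mult matrix_mul_assoc)
    then have "blk (ctranspose (emb w ** J) ** emb h ** (emb w ** J)) \<longleftrightarrow> blk (emb (w ** h ** w))"
      by (simp only: J(4))
    moreover have "blk (emb (w ** h ** w)) \<longleftrightarrow> w ** h ** w \<in> H0" if "h \<in> SU"
      using that w by (intro blk_emb_iff mult_SU)
    ultimately show ?thesis
      unfolding Z stab_coset [OF wJ] by blast
  qed
  have G: "is_grp ?H" by (rule is_grp_stab)
  have \<rho>1: "\<rho> (mat 1) = id"
    by (simp add: \<rho>_def w rho_one)
  have \<rho>m: "\<rho> (h ** k) = \<rho> h \<circ> \<rho> k" if "h \<in> ?H" "k \<in> ?H" for h k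
  proof -
    have "w ** h ** w ** (w ** k ** w) = w ** h ** (w ** w) ** k ** w"
      by (simp only: matrix_mul_assoc)
    then have "w ** (h ** k) ** w = (w ** h ** w) ** (w ** k ** w)"
      by (simp add: w matrix_mul_assoc)
    then show ?thesis
      using that by (simp add: \<rho>_def rho_mult H)
  qed
  have "orth_rep ?H \<rho>"
    unfolding orth_rep_def
  proof (intro conjI ballI)
    show "orthogonal_transformation (\<rho> h)" if "h \<in> ?H" for h
      using that by (simp add: orthogonal_transformation \<rho>_def linear_rho norm_rho H)
    have "Cinf_on UNIV (\<lambda>x. rho (w ** fst x ** w) (snd x))"
      by (intro Cinf_on_rho Cinf_intros) auto
    from Cinf_on_continuous [OF this] show "continuous_on (?H \<times> UNIV) (\<lambda>(h, v). \<rho> h v)"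
      by (auto simp: \<rho>_def case_prod_beta intro: continuous_on_subset)
  qed (use \<rho>1 \<rho>m in auto)
  have sv: "norm (s *\<^sub>R v) < 1" if "v \<in> cball 0 1" for v :: "complex^2"
  proof -
    have "s * norm v \<le> s * 1"
      using that s by (intro mult_left_mono) auto
    moreover have "norm (s *\<^sub>R v) = s * norm v"
      using s by simp
    ultimately show ?thesis using s by linarith
  qed
  have hgt_\<phi>: "hgt (\<phi> (g, v) ** J) = 1 - s\<^sup>2 * (norm v)\<^sup>2" if "g \<in> SU" "v \<in> cball 0 1" for g v
    using sv [OF that(2)] s by (simp add: \<phi>_def JJ hgt_emb hgt_mm power_mult_distrib)
  have \<phi>SU: "\<phi> (g, v) \<in> SU" if "g \<in> SU" "v \<in> cball 0 1" for g v
    using sv [OF that(2)] that(1) w J by (simp add: \<phi>_def mult_SU mm_SU)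
  have D': "coset (\<phi> (g, v)) \<in> D" if "g \<in> SU" "v \<in> cball 0 1" for g v
  proof -
    have "s\<^sup>2 * (norm v)\<^sup>2 \<le> s\<^sup>2 * 1"
      using that(2) by (intro mult_left_mono) (auto simp: power_le_one)
    then show ?thesis
      using that by (simp add: D \<phi>SU hgt_\<phi>)
  qed
  \<comment> \<open>Reads \<open>g\<close> and the slice vector off the normal form of
    \<open>a ** J\<close>, undoing the base point \<open>w\<close> and the scaling by
    \<open>s\<close>.\<close>
  define \<psi> where "\<psi> a = (gg (a ** J) ** w, (1 / s) *\<^sub>R ww (a ** J))" for a
  define V where "V = (\<lambda>a :: complex^4^4. a ** J) -` gg_dom"
  have RJ: "Cinf_on UNIV (\<lambda>a :: complex^4^4. a ** J)"
    by (intro Cinf_intros) auto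
  have V: "open V"
    using Cinf_on_continuous [OF RJ] open_gg_dom by (simp add: V_def continuous_on_open_vimage)
  have RJV: "Cinf_on V (\<lambda>a :: complex^4^4. a ** J)"
    using Cinf_on_subset [OF RJ V] by simp
  have \<psi>: "Cinf_on V \<psi>"
    unfolding \<psi>_def
  proof (intro Cinf_on_Pair Cinf_on_matmul Cinf_on_scaleR Cinf_on_const V)
    show "Cinf_on V (\<lambda>a. gg (a ** J))"
      by (rule Cinf_on_compose [OF Cinf_gg RJV]) (auto simp: V_def)
    show "Cinf_on V (\<lambda>a. ww (a ** J))"
      by (rule Cinf_on_compose [OF Cinf_ww [OF open_UNIV] RJV]) auto
  qed
  have sec: "a \<in> V \<and> fst (\<psi> a) \<in> SU \<and> (norm (snd (\<psi> a)))\<^sup>2 = (1 - hgt (a ** J)) / s\<^sup>2 \<and> coset (\<phi> (\<psi> a)) = coset a"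
    if a: "a \<in> SU" "1 - s\<^sup>2 \<le> hgt (a ** J)" for a
  proof -
    have b: "a ** J \<in> SU" using a J by (simp add: mult_SU)
    have "s\<^sup>2 < 1" using s by (simp add: power_less_one_iff)
    then have pos: "0 < hgt (a ** J)" using a by simp
    note nf = normal_form [OF b pos]
    have "\<phi> (\<psi> a) = emb (gg (a ** J)) ** mm (ww (a ** J)) ** J"
      using s by (simp add: \<phi>_def \<psi>_def ww')
    moreover have "coset (emb (gg (a ** J)) ** mm (ww (a ** J)) ** J) = coset (a ** J ** J)"
    proof -
      have "emb (gg (a ** J)) ** mm (ww (a ** J)) \<in> SU"
        using nf(1,3) by (intro mult_SU) simp_all
      from cJ [OF this b] show ?thesis using nf(4) by blast
    qed
    moreover have "(norm (snd (\<psi> a)))\<^sup>2 = (1 - hgt (a ** J)) / s\<^sup>2"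
      using s norm_ww [OF b] by (simp add: \<psi>_def power_mult_distrib power_divide)
    ultimately show ?thesis
      using nf b pos w by (simp add: V_def SU_gg_dom \<psi>_def mult_SU JJ)
  qed
  have cb: "snd (\<psi> a) \<in> cball 0 1" if "a \<in> SU" "1 - s\<^sup>2 \<le> hgt (a ** J)" for a
  proof -
    have "(norm (snd (\<psi> a)))\<^sup>2 \<le> 1"
      using sec [OF that] that s by simp
    then show ?thesis
      by (simp add: power_le_one_iff abs_square_le_1)
  qed
  have "\<exists>F. equi_diffeo (SU \<times> cball 0 1, bundle_class ?H \<rho>) bundle_act (T, coset) act F \<and>
    (\<forall>x\<in>SU \<times> cball 0 1. F (bundle_class ?H \<rho> x) = coset (\<phi> x))"
  proof (rule equi_diffeo_exI)
    have L: "Cinf_on UNIV (\<lambda>x :: (complex^3^3) \<times> (complex^2). s *\<^sub>R snd x)"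
      by (intro Cinf_intros) auto
    let ?U = "(\<lambda>x :: (complex^3^3) \<times> (complex^2). s *\<^sub>R snd x) -` ball 0 1"
    have U: "open ?U"
      using Cinf_on_continuous [OF L] by (simp add: continuous_on_open_vimage)
    have "Cinf_on ?U (\<lambda>x. mm (s *\<^sub>R snd x))"
      by (rule Cinf_on_compose [OF Cinf_mm Cinf_on_subset [OF L U]]) auto
    then show "Cinf_on ?U \<phi>"
      unfolding \<phi>_def by (intro Cinf_on_matmul Cinf_on_emb Cinf_on_fst Cinf_on_ident Cinf_on_const U)
    show "SU \<times> cball 0 1 \<subseteq> ?U"
      using sv by auto
    show "\<phi> ` (SU \<times> cball 0 1) \<subseteq> T"
      using \<phi>SU D' by (auto simp: T_def)
  next
    fix x y :: "(complex^3^3) \<times> (complex^2)"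
    assume "x \<in> SU \<times> cball 0 1" "y \<in> SU \<times> cball 0 1"
    then obtain g v g' v' where xy: "x = (g, v)" "y = (g', v')" and g: "g \<in> SU" "g' \<in> SU"
      and v: "v \<in> cball 0 1" "v' \<in> cball 0 1" by auto
    have gw: "g ** w \<in> SU" "g' ** w \<in> SU" using g w by (simp_all add: mult_SU)
    have "coset (\<phi> x) = coset (\<phi> y) \<longleftrightarrow>
      coset (emb (g' ** w) ** mm (s *\<^sub>R v')) = coset (emb (g ** w) ** mm (s *\<^sub>R v))"
      unfolding xy \<phi>_def fst_conv snd_conv
      using gw sv [OF v(1)] sv [OF v(2)] by (subst cJ) (auto simp: mult_SU mm_SU)
    also have "\<dots> \<longleftrightarrow> ctranspose (g' ** w) ** (g ** w) \<in> H0 \<and>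
        s *\<^sub>R v' = rho (ctranspose (g' ** w) ** (g ** w)) (s *\<^sub>R v)"
      by (rule coset_mm_eq_iff [OF gw(2,1) sv [OF v(2)] sv [OF v(1)]])
    also have "ctranspose (g' ** w) ** (g ** w) = w ** (ctranspose g' ** g) ** w"
      by (simp add: ctranspose_mult w matrix_mul_assoc)
    also have "w ** (ctranspose g' ** g) ** w \<in> H0 \<longleftrightarrow> ctranspose g' ** g \<in> ?H"
      using g by (simp add: H mult_SU ctranspose_SU)
    also have "s *\<^sub>R v' = rho (w ** (ctranspose g' ** g) ** w) (s *\<^sub>R v) \<longleftrightarrow> v' = \<rho> (ctranspose g' ** g) v"
      using s by (simp add: \<rho>_def linear_scale [OF linear_rho])
    also have "ctranspose g' ** g \<in> ?H \<and> v' = \<rho> (ctranspose g' ** g) v \<longleftrightarrow>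
      bundle_class ?H \<rho> x = bundle_class ?H \<rho> y"
      unfolding xy using G \<rho>1 \<rho>m g by (subst bundle_class_eq_iff) simp_all
    finally show "bundle_class ?H \<rho> x = bundle_class ?H \<rho> y \<longleftrightarrow> coset (\<phi> x) = coset (\<phi> y)"
      by blast
  next
    fix a assume "a \<in> T"
    then have "a \<in> V" using sec D by (auto simp: T_def)
    moreover have "\<forall>z \<in> T \<inter> V. \<psi> z \<in> SU \<times> cball 0 1 \<and> coset (\<phi> (\<psi> z)) = coset z"
      using sec cb D by (auto simp: T_def mem_Times_iff)
    ultimately show "\<exists>V \<psi>. a \<in> V \<and> Cinf_on V \<psi> \<and>
      (\<forall>z \<in> T \<inter> V. \<psi> z \<in> SU \<times> cball 0 1 \<and> coset (\<phi> (\<psi> z)) = coset z)"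
      using \<psi> by blast
  next
    fix g :: "complex^3^3" and x :: "(complex^3^3) \<times> (complex^2)"
    assume "g \<in> SU" "x \<in> SU \<times> cball 0 1"
    then show "\<exists>y\<in>SU \<times> cball 0 1. bundle_act g (bundle_class ?H \<rho> x) = bundle_class ?H \<rho> y \<and>
      act g (coset (\<phi> x)) = coset (\<phi> y)"
      by (intro bexI [of _ "(g ** fst x, snd x)"])
        (auto simp: bundle_act_class act_coset \<phi>_def emb_mult matrix_mul_assoc mult_SU)
  qed
  then obtain F where F: "equi_diffeo (disc_bundle ?H \<rho>) bundle_act (wolf_part D) act F"
    "\<And>g v. g \<in> SU \<Longrightarrow> v \<in> cball 0 1 \<Longrightarrow> F (bundle_class ?H \<rho> (g, v)) = coset (\<phi> (g, v))"
    by (force simp: disc_bundle_def wolf_part_def T_def)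
  have "F (bundle_class ?H \<rho> (g, 0)) = act g Z" if "g \<in> SU" for g
  proof -
    have "F (bundle_class ?H \<rho> (g, 0)) = coset (\<phi> (g, 0))"
      using that by (intro F(2)) auto
    also have "\<dots> = act g (coset (emb w ** J))"
      by (simp add: \<phi>_def mm_0 act_coset emb_mult matrix_mul_assoc)
    finally show ?thesis by (simp only: Z)
  qed
  moreover have "F ` sphere_bundle ?H \<rho> = Sph"
  proof
    show "F ` sphere_bundle ?H \<rho> \<subseteq> Sph"
    proof
      fix Y assume "Y \<in> F ` sphere_bundle ?H \<rho>"
      then obtain g v where gv: "g \<in> SU" "norm v = 1" "Y = F (bundle_class ?H \<rho> (g, v))"
        by (auto simp: sphere_bundle_def)
      then have v: "v \<in> cball 0 1" by simp
      show "Y \<in> Sph"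
        using gv v by (simp add: F Sph(2) \<phi>SU hgt_\<phi>)
    qed
    show "Sph \<subseteq> F ` sphere_bundle ?H \<rho>"
    proof
      fix Y assume Y: "Y \<in> Sph"
      then obtain a where a: "a \<in> SU" "Y = coset a"
        using Sph(1) wolfE by blast
      then have h: "hgt (a ** J) = 1 - s\<^sup>2" using Y Sph(2) by simp
      then have le: "1 - s\<^sup>2 \<le> hgt (a ** J)" by simp
      note se = sec [OF a(1) le]
      have "(norm (snd (\<psi> a)))\<^sup>2 = 1"
        using se h s by simp
      then have n: "norm (snd (\<psi> a)) = 1"
        by (simp add: power2_eq_1_iff) (smt (verit) norm_ge_zero)
      obtain g v where gv: "\<psi> a = (g, v)" by (cases "\<psi> a")
      have "Y = F (bundle_class ?H \<rho> (g, v))"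
        using se n by (simp add: F gv a(2))
      then show "Y \<in> F ` sphere_bundle ?H \<rho>"
        using se n by (auto simp: sphere_bundle_def gv)
    qed
  qed
  ultimately show ?thesis
    unfolding disc_bundle_over_def using \<open>orth_rep ?H \<rho>\<close> F(1) by blast
qed

lemma cos_squared_le_iff:
  assumes "s \<in> {0..pi/2}" "t \<in> {0..pi/2}"
  shows "(cos s)\<^sup>2 \<le> (cos t)\<^sup>2 \<longleftrightarrow> t \<le> s"
proof -
  have "0 \<le> cos s" "0 \<le> cos t"
    using assms by (auto intro!: cos_ge_zero)
  then have "(cos s)\<^sup>2 \<le> (cos t)\<^sup>2 \<longleftrightarrow> cos s \<le> cos t"
    by (simp add: power_mono_iff)
  also have "\<dots> \<longleftrightarrow> t \<le> s"
    using assms pi_gt_zero by (subst cos_mono_le_eq) auto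
  finally show ?thesis .
qed

lemma coset_in_Union_orbits:
  assumes a: "a \<in> SU" and I: "I \<subseteq> {0..pi/2}" and t: "t \<in> {0..pi/2}" "hgt a = (cos t)\<^sup>2"
  shows "coset a \<in> (\<Union>t\<in>I. orbit (pt t)) \<longleftrightarrow> t \<in> I"
proof
  assume "coset a \<in> (\<Union>t\<in>I. orbit (pt t))"
  then obtain s where s: "s \<in> I" "coset a \<in> orbit (pt s)" by blast
  then have "(cos s)\<^sup>2 = (cos t)\<^sup>2"
    using hgt_orbit [OF a] t(2) by metis
  then have "s = t"
    using s(1) I t(1) by (metis cos_squared_inj subsetD)
  with s show "t \<in> I" by simp
next
  assume "t \<in> I"
  then show "coset a \<in> (\<Union>t\<in>I. orbit (pt t))"
    using orbit_pt_iff [OF a t(1)] t(2) by blast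
qed

text \<open>The squared radius in the slice is \<open>1 - hgt\<close>, so the common boundary is
  reached at radius \<open>sin c\<close> from the first orbit. From the second it is
  \<open>cos c\<close>, as \<open>J_mat\<close> replaces \<open>hgt\<close> by
  \<open>1 - hgt\<close>.\<close>

lemma disc_bundles:
  assumes c: "c \<in> {0<..<pi/2}"
  shows "disc_bundle_over (pt 0) (\<Union>t\<in>{0..c}. orbit (pt t)) (orbit (pt c))"
    and "disc_bundle_over (pt (pi/2)) (\<Union>t\<in>{c..pi/2}. orbit (pt t)) (orbit (pt c))"
proof -
  have sc: "0 < sin c" "0 < cos c"
    using c by (auto intro: sin_gt_zero cos_gt_zero)
  have sc1: "sin c < 1" "cos c < 1"
    using sc sin_cos_squared_add [of c] by (smt (verit) one_le_power zero_less_power)+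
  have c': "c \<in> {0..pi/2}" using c by simp
  have D0: "coset a \<in> (\<Union>t\<in>{0..c}. orbit (pt t)) \<longleftrightarrow> (cos c)\<^sup>2 \<le> hgt a" if a: "a \<in> SU" for a
  proof -
    obtain t where t: "t \<in> {0..pi/2}" "hgt a = (cos t)\<^sup>2" by (rule hgt_angle [OF a])
    have "coset a \<in> (\<Union>t\<in>{0..c}. orbit (pt t)) \<longleftrightarrow> t \<le> c"
      using c t by (subst coset_in_Union_orbits [OF a _ t]) auto
    then show ?thesis
      using cos_squared_le_iff [OF c' t(1)] t(2) by simp
  qed
  have D1: "coset a \<in> (\<Union>t\<in>{c..pi/2}. orbit (pt t)) \<longleftrightarrow> hgt a \<le> (cos c)\<^sup>2" if a: "a \<in> SU" for a
  proof -
    obtain t where t: "t \<in> {0..pi/2}" "hgt a = (cos t)\<^sup>2" by (rule hgt_angle [OF a])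
    have "coset a \<in> (\<Union>t\<in>{c..pi/2}. orbit (pt t)) \<longleftrightarrow> c \<le> t"
      using c t by (subst coset_in_Union_orbits [OF a _ t]) auto
    then show ?thesis
      using cos_squared_le_iff [OF t(1) c'] t(2) by simp
  qed
  show "disc_bundle_over (pt 0) (\<Union>t\<in>{0..c}. orbit (pt t)) (orbit (pt c))"
  proof (rule disc_bundle_over_generic [where J = "mat 1" and w = "mat 1" and s = "sin c"])
    show "orbit (pt c) \<subseteq> wolf" by (rule orbit_subset_wolf)
  qed (use sc sc1 D0 orbit_pt_iff [OF _ c'] in \<open>auto simp: pt_0 cos_squared_eq\<close>)
  show "disc_bundle_over (pt (pi/2)) (\<Union>t\<in>{c..pi/2}. orbit (pt t)) (orbit (pt c))"
  proof (rule disc_bundle_over_generic [where J = J_mat and w = swap13 and s = "cos c"])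
    show "orbit (pt c) \<subseteq> wolf" by (rule orbit_subset_wolf)
    show "pt (pi/2) = coset (emb swap13 ** J_mat)"
      by (simp add: emb_swap13_J_mat pt_eq)
  qed (use sc sc1 D1 orbit_pt_iff [OF _ c'] in
      \<open>auto simp: hgt_J_mat J_mat_SU J_mat_J_mat ctranspose_J_mat blk_J_mat swap13_SU swap13_swap13 ctranspose_swap13\<close>)
qed

lemma disc_bundles_glue:
  assumes c: "c \<in> {0<..<pi/2}"
  shows "wolf = (\<Union>t\<in>{0..c}. orbit (pt t)) \<union> (\<Union>t\<in>{c..pi/2}. orbit (pt t))"
    and "(\<Union>t\<in>{0..c}. orbit (pt t)) \<inter> (\<Union>t\<in>{c..pi/2}. orbit (pt t)) = orbit (pt c)"
proof -
  have "{0..pi/2} = {0..c} \<union> {c..pi/2}" using c by auto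
  then show "wolf = (\<Union>t\<in>{0..c}. orbit (pt t)) \<union> (\<Union>t\<in>{c..pi/2}. orbit (pt t))"
    unfolding wolf_eq_Union_orbits by blast
  show "(\<Union>t\<in>{0..c}. orbit (pt t)) \<inter> (\<Union>t\<in>{c..pi/2}. orbit (pt t)) = orbit (pt c)"
  proof
    show "(\<Union>t\<in>{0..c}. orbit (pt t)) \<inter> (\<Union>t\<in>{c..pi/2}. orbit (pt t)) \<subseteq> orbit (pt c)"
    proof clarify
      fix Y s t assume st: "s \<in> {0..c}" "t \<in> {c..pi/2}" "Y \<in> orbit (pt s)" "Y \<in> orbit (pt t)"
      moreover have "s \<in> {0..pi/2}" "t \<in> {0..pi/2}"
        using st(1,2) c by auto
      ultimately have "s = t"
        using orbits_disjoint [of s t] by blast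
      with st have "s = c" by simp
      with st show "Y \<in> orbit (pt c)" by simp
    qed
    show "orbit (pt c) \<subseteq> (\<Union>t\<in>{0..c}. orbit (pt t)) \<inter> (\<Union>t\<in>{c..pi/2}. orbit (pt t))"
      using c by (auto intro!: bexI [of _ c])
  qed
qed

subsection \<open>The Killing form\<close>

text \<open>Independence of the basis: expand \<open>b\<close> over the orthonormal
  \<open>C\<close>, exchange the sums and reassemble \<open>f c\<close> from its coefficients over
  \<open>B\<close>. This disposes of the choice in \<open>trace_on\<close>.\<close>

lemma trace_on_eq_orthonormal:
  fixes V :: "'a::euclidean_space set"
  assumes f: "linear f" "f ` V \<subseteq> V"
    and C: "pairwise orthogonal C" "\<And>c. c \<in> C \<Longrightarrow> norm c = 1" "finite C" "span C = V"
  shows "trace_on V f = (\<Sum>c\<in>C. f c \<bullet> c)"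
proof -
  define B where "B = (SOME B. independent B \<and> span B = V)"
  obtain B' where "B' \<subseteq> V" "independent B'" "V \<subseteq> span B'"
    by (metis basis_exists)
  then have "\<exists>B. independent B \<and> span B = V"
    using C(4) by (metis span_eq span_minimal subset_antisym subspace_span)
  from someI_ex [OF this] have B: "independent B" "span B = V"
    by (simp_all add: B_def)
  have finB: "finite B"
    using B(1) by (rule independent_imp_finite)
  have fV: "f x \<in> span B" if "x \<in> V" for x
    using f(2) that B(2) by auto
  have CV: "c \<in> V" if "c \<in> C" for c
    using that C(4) span_base by blast
  have rep: "representation B (f b) b = (\<Sum>c\<in>C. representation B (f c) b * (b \<bullet> c))" if "b \<in> B" for b
  proof -
    have "b \<in> span C"
      using that B(2) C(4) span_base by blast
    then have "f b = f (\<Sum>c\<in>C. (b \<bullet> c) *\<^sub>R c)"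
      using orthonormal_basis_expand [OF C(1,2) _ C(3)] by simp
    also have "\<dots> = (\<Sum>c\<in>C. (b \<bullet> c) *\<^sub>R f c)"
      by (simp add: linear_sum [OF f(1)] linear_scale [OF f(1)])
    finally have "representation B (f b) = (\<lambda>x. \<Sum>c\<in>C. representation B ((b \<bullet> c) *\<^sub>R f c) x)"
      using CV fV B(1) by (simp add: representation_sum span_scale)
    then show ?thesis
      using CV fV B(1) by (simp add: representation_scale mult.commute cong: sum.cong)
  qed
  have "trace_on V f = (\<Sum>b\<in>B. representation B (f b) b)"
    by (simp add: trace_on_def B_def Let_def)
  also have "\<dots> = (\<Sum>b\<in>B. \<Sum>c\<in>C. representation B (f c) b * (b \<bullet> c))"
    by (simp add: rep)
  also have "\<dots> = (\<Sum>c\<in>C. \<Sum>b\<in>B. representation B (f c) b * (b \<bullet> c))"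
    by (rule sum.swap)
  also have "\<dots> = (\<Sum>c\<in>C. (\<Sum>b\<in>B. representation B (f c) b *\<^sub>R b) \<bullet> c)"
    by (simp add: inner_sum_left)
  also have "\<dots> = (\<Sum>c\<in>C. f c \<bullet> c)"
    using CV fV B(1) finB by (intro sum.cong refl arg_cong2 [where f = "(\<bullet>)"] sum_representation_eq) auto
  finally show ?thesis .
qed

lemma sum_Basis_vec:
  fixes g :: "'a::euclidean_space^'n \<Rightarrow> 'b::comm_monoid_add"
  shows "(\<Sum>b\<in>Basis. g b) = (\<Sum>i\<in>UNIV. \<Sum>u\<in>Basis. g (axis i u))"
proof -
  have *: "(Basis :: ('a^'n) set) = (\<Union>i\<in>UNIV. axis i ` Basis)"
    by (auto simp: Basis_vec_def)
  have "(\<Sum>b\<in>(\<Union>i\<in>UNIV. axis i ` Basis). g b) = (\<Sum>i\<in>UNIV. \<Sum>b\<in>axis i ` Basis. g b)"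
    by (rule sum.UNION_disjoint) (auto simp: axis_eq_axis)
  also have "\<dots> = (\<Sum>i\<in>UNIV. \<Sum>u\<in>Basis. g (axis i u))"
    by (intro sum.cong refl sum.reindex_cong [OF _ refl refl]) (auto simp: inj_on_def axis_eq_axis)
  finally show ?thesis
    unfolding * .
qed

lemma inner_mat: "(M :: complex^'n^'n) \<bullet> N = Re (\<Sum>i\<in>UNIV. \<Sum>j\<in>UNIV. M $ i $ j * cnj (N $ i $ j))"
  by (simp add: inner_vec_def inner_complex_def)

text \<open>The complex trace of \<open>Z \<mapsto> A ** Z ** B\<close> is the product of the
  traces; the real trace of a complex linear map is twice the real part of its complex
  trace.\<close>

lemma trace_sandwich: "(\<Sum>b\<in>Basis. (A ** b ** B) \<bullet> b) = 2 * Re (trace A * trace B)"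
  for A B :: "complex^'n^'n"
proof -
  have e: "(A ** axis k (axis l u) ** B) $ i $ j = A $ i $ k * u * B $ l $ j" for k l u i j
    by (simp add: matmul_component axis_def if_distrib [of "\<lambda>x. x $ _"] if_distrib [of "(*) _"]
      if_distrib [of "\<lambda>x. x * _"] cong: if_cong)
  have "(A ** axis k (axis l u) ** B) \<bullet> axis k (axis l u) = (A $ k $ k * u * B $ l $ l) \<bullet> u" for k l u
    by (simp add: inner_axis e)
  moreover have "(\<Sum>u\<in>Basis. (a * u * b) \<bullet> u) = 2 * Re (a * b)" for a b
    by (simp add: Basis_complex_def inner_complex_def)
  ultimately have "(\<Sum>b\<in>Basis. (A ** b ** B) \<bullet> b) = (\<Sum>k\<in>UNIV. \<Sum>l\<in>UNIV. 2 * Re (A $ k $ k * B $ l $ l))"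
    by (simp only: sum_Basis_vec)
  moreover have "trace A * trace B = (\<Sum>k\<in>UNIV. \<Sum>l\<in>UNIV. A $ k $ k * B $ l $ l)"
    by (simp only: trace_def sum_product)
  then have "2 * Re (trace A * trace B) = (\<Sum>k\<in>UNIV. \<Sum>l\<in>UNIV. 2 * Re (A $ k $ k * B $ l $ l))"
    by (simp only: Re_sum sum_distrib_left)
  ultimately show ?thesis by (simp only:)
qed

lemma i_times_linear: "linear i_times"
  by (intro linearI) (simp_all add: vec_eq_iff i_times_component algebra_simps)

lemma i_times_inner: "i_times M \<bullet> i_times N = M \<bullet> N"
  by (simp add: inner_mat i_times_component mult.left_commute mult.assoc)

lemma i_times_i_times: "i_times (i_times M) = - M"
  by (simp add: vec_eq_iff i_times_component)

lemma i_times_matmul: "A ** i_times M = i_times (A ** M)" "i_times M ** A = i_times (M ** A)"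
  by (simp_all add: vec_eq_iff i_times_component matmul_component sum_distrib_left algebra_simps)

lemma su_inner: "M \<in> su \<Longrightarrow> N \<in> su \<Longrightarrow> M \<bullet> N = - Re (trace (M ** N))"
  unfolding su_iff by (simp add: inner_mat trace_def matmul_component sum_negf)

lemma lie_bracket_su: "M \<in> su \<Longrightarrow> N \<in> su \<Longrightarrow> lie_bracket M N \<in> su"
  using trace_mul_sym [of M N]
  by (simp add: su_def lie_bracket_def trace_sub linear_diff [OF bounded_linear.linear [OF bounded_linear_ctranspose]]
    ctranspose_mult matmul_minus_left matmul_minus_right)

lemma trace_mult_su_real: "M \<in> su \<Longrightarrow> N \<in> su \<Longrightarrow> Im (trace (M ** N)) = 0"
proof -
  assume "M \<in> su" "N \<in> su"
  then have "ctranspose (M ** N) = N ** M"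
    by (simp add: su_def ctranspose_mult matmul_minus_left matmul_minus_right)
  moreover have "trace (ctranspose X) = cnj (trace X)" for X :: "complex^'n^'n"
    by (simp add: trace_def)
  ultimately have "cnj (trace (M ** N)) = trace (M ** N)"
    by (metis trace_mul_sym)
  then show ?thesis
    by (simp add: complex_eq_iff)
qed

text \<open>Since \<open>gl(4,\<complex>) = su(4) + i su(4) + \<complex> I\<close> orthogonally, the trace of a complex linear map
  preserving \<open>su(4)\<close> and vanishing on \<open>I\<close> is half of its real trace on \<open>gl(4,\<complex>)\<close>.\<close>

lemma killing_eq:
  assumes M: "M \<in> su" and N: "N \<in> su"
  shows "killing M N = - 8 * (M \<bullet> N)"
proof -
  define f where "f Z = lie_bracket M (lie_bracket N Z)" for Z
  have lin: "linear f"
    by (intro linearI) (simp_all add: f_def lie_bracket_def matmul_add_left matmul_add_right matmul_diff_left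
        matmul_diff_right matmul_scaleR_left matmul_scaleR_right algebra_simps)
  have fi: "f (i_times Z) = i_times (f Z)" for Z
    by (simp add: f_def lie_bracket_def i_times_matmul linear_diff [OF i_times_linear]
        matmul_diff_left matmul_diff_right)
  have fI: "f (mat 1) = 0"
    by (simp add: f_def lie_bracket_def matmul_zero_left matmul_zero_right)
  have fsu: "f ` su \<subseteq> su"
    using M N by (auto simp: f_def lie_bracket_su)
  obtain C where C: "C \<subseteq> su" "pairwise orthogonal C" "\<And>c. c \<in> C \<Longrightarrow> norm c = 1" "independent C"
    "card C = dim (su :: (complex^4^4) set)" "span C = (su :: (complex^4^4) set)"
    using orthonormal_basis_subspace [OF subspace_su] by metis
  have finC: "finite C"
    using C(4) by (rule independent_imp_finite)
  have k: "killing M N = (\<Sum>c\<in>C. f c \<bullet> c)"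
    unfolding killing_def f_def [symmetric] by (rule trace_on_eq_orthonormal [OF lin fsu C(2,3) finC C(6)])
  define P where "P Z = (\<Sum>c\<in>C. (Z \<bullet> c) *\<^sub>R c)" for Z
  have Plin: "linear P"
    by (intro linearI) (simp_all add: P_def inner_left_distrib scaleR_left_distrib sum.distrib scaleR_sum_right)
  have P1: "P Z = Z" if "Z \<in> su" for Z
    unfolding P_def using that C(6) by (intro orthonormal_basis_expand [OF C(2,3) _ finC]) simp_all
  have P0: "P Z = 0" if "\<And>c. c \<in> su \<Longrightarrow> Z \<bullet> c = 0" for Z
    unfolding P_def using that C(1) by (intro sum.neutral) auto
  have Pi: "P (i_times Z) = 0" if "Z \<in> su" for Z
  proof (rule P0)
    fix c :: "complex^4^4" assume c: "c \<in> su"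
    have "i_times Z \<bullet> c = - Re (trace (i_times Z ** c))"
      using c unfolding su_iff by (simp add: inner_mat trace_def matmul_component sum_negf)
    also have "trace (i_times Z ** c) = \<i> * trace (Z ** c)"
      by (simp add: i_times_matmul) (simp add: trace_def i_times_component sum_distrib_left)
    finally show "i_times Z \<bullet> c = 0"
      using trace_mult_su_real [OF that c] by simp
  qed
  have PI: "P (mat 1) = 0" "P (i_times (mat 1)) = 0"
  proof -
    have "mat 1 \<bullet> c = Re (trace c)" "i_times (mat 1) \<bullet> c = Im (trace c)" for c :: "complex^4^4"
      by (simp_all add: inner_vec_def inner_complex_def sum_4 mat_1_component i_times_component trace_4)
    then show "P (mat 1) = 0" "P (i_times (mat 1)) = 0"
      by (auto intro!: P0 simp: su_iff)
  qed
  have dec: "f Z = f (P Z) + f (i_times (P (- i_times Z)))" for Z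
  proof -
    \<comment> \<open>\<open>Z = A + i_times B\<close> splits \<open>Z\<close> into a skew-Hermitian
      and a Hermitian part; imaginary multiples of the identity then remove the traces of
      \<open>A\<close> and \<open>B\<close>.\<close>
    define A B where "A = (1/2) *\<^sub>R (Z - ctranspose Z)" and "B = (1/2) *\<^sub>R (- i_times (Z + ctranspose Z))"
    define \<alpha> \<beta> where "\<alpha> = Im (trace A) / 4" and "\<beta> = Im (trace B) / 4"
    define A0 B0 where "A0 = A - \<alpha> *\<^sub>R i_times (mat 1)" and "B0 = B - \<beta> *\<^sub>R i_times (mat 1)"
    have "ctranspose A = - A" "ctranspose B = - B"
      by (simp_all add: A_def B_def vec_eq_iff i_times_component complex_eq_iff field_simps)
    then have sk: "cnj (A $ j $ i) = - A $ i $ j" "cnj (B $ j $ i) = - B $ i $ j" for i j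
      by (simp_all add: vec_eq_iff)
    have "cnj (trace A) = - trace A" "cnj (trace B) = - trace B"
      by (simp_all add: trace_def sk sum_negf)
    then have "trace A = \<i> * of_real (Im (trace A))" "trace B = \<i> * of_real (Im (trace B))"
      by (simp_all add: complex_eq_iff)
    moreover have "trace (r *\<^sub>R i_times (mat 1) :: complex^4^4) = \<i> * of_real (4 * r)" for r
      by (simp add: trace_4 i_times_component mat_1_component complex_eq_iff)
    ultimately have tr: "trace A0 = 0" "trace B0 = 0"
      by (simp_all add: A0_def B0_def \<alpha>_def \<beta>_def trace_sub)
    have su: "A0 \<in> su" "B0 \<in> su"
      using sk tr by (auto simp: su_iff A0_def B0_def i_times_component mat_1_component)
    have Z: "Z = A0 + i_times B0 + \<alpha> *\<^sub>R i_times (mat 1) - \<beta> *\<^sub>R mat 1"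
      by (simp add: A0_def B0_def A_def B_def vec_eq_iff i_times_component complex_eq_iff algebra_simps)
    note ls = linear_add [OF i_times_linear] linear_diff [OF i_times_linear] linear_scale [OF i_times_linear]
      linear_neg [OF i_times_linear] i_times_i_times
    have iZ: "- i_times Z = B0 - i_times A0 + \<alpha> *\<^sub>R mat 1 + \<beta> *\<^sub>R i_times (mat 1)"
      by (subst Z) (simp add: ls)
    have "P Z = A0"
      by (subst Z) (simp add: linear_add [OF Plin] linear_diff [OF Plin] linear_scale [OF Plin] P1 Pi PI su)
    moreover have "P (- i_times Z) = B0"
      unfolding iZ by (simp add: linear_add [OF Plin] linear_diff [OF Plin] linear_scale [OF Plin] P1 Pi PI su)
    moreover have "f Z = f A0 + f (i_times B0)"
      by (subst Z) (simp add: linear_add [OF lin] linear_diff [OF lin] linear_scale [OF lin] fi fI linear_0 [OF i_times_linear])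
    ultimately show ?thesis by simp
  qed
  have exp: "(\<Sum>b\<in>Basis. (b \<bullet> x) * (y \<bullet> b)) = y \<bullet> x" for x y :: "complex^4^4"
    using euclidean_inner [of y x] by (simp add: inner_commute mult.commute)
  have "(\<Sum>b\<in>Basis. f (P b) \<bullet> b) = (\<Sum>b\<in>Basis. \<Sum>c\<in>C. (b \<bullet> c) * (f c \<bullet> b))"
    by (simp add: P_def linear_sum [OF lin] linear_scale [OF lin] inner_sum_left)
  also have "\<dots> = (\<Sum>c\<in>C. \<Sum>b\<in>Basis. (b \<bullet> c) * (f c \<bullet> b))"
    by (rule sum.swap)
  finally have s1: "(\<Sum>b\<in>Basis. f (P b) \<bullet> b) = (\<Sum>c\<in>C. f c \<bullet> c)"
    by (simp add: exp)
  have i: "- i_times b \<bullet> c = b \<bullet> i_times c" for b c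
    using i_times_inner [of b "i_times c"] by (simp add: i_times_i_times)
  have "(\<Sum>b\<in>Basis. f (i_times (P (- i_times b))) \<bullet> b) = (\<Sum>b\<in>Basis. \<Sum>c\<in>C. (b \<bullet> i_times c) * (i_times (f c) \<bullet> b))"
    unfolding P_def i fi by (simp add: linear_sum [OF lin] linear_scale [OF lin] linear_sum [OF i_times_linear]
      linear_scale [OF i_times_linear] inner_sum_left)
  also have "\<dots> = (\<Sum>c\<in>C. \<Sum>b\<in>Basis. (b \<bullet> i_times c) * (i_times (f c) \<bullet> b))"
    by (rule sum.swap)
  finally have s2: "(\<Sum>b\<in>Basis. f (i_times (P (- i_times b))) \<bullet> b) = (\<Sum>c\<in>C. f c \<bullet> c)"
    by (simp add: exp i_times_inner)
  \<comment> \<open>By \<open>trace_sandwich\<close> the first and last terms each contribute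
    \<open>2 * 4 * Re (trace (M ** N))\<close>, the 4 being the trace of the identity, and the mixed
    terms vanish because \<open>M\<close> and \<open>N\<close> are trace-free.\<close>
  have fb: "f b = (M ** N) ** b ** mat 1 - M ** b ** N - N ** b ** M + mat 1 ** b ** (N ** M)" for b
    by (simp add: f_def lie_bracket_def matmul_diff_left matmul_diff_right matrix_mul_assoc)
  have "(\<Sum>b\<in>Basis. f b \<bullet> b) = (\<Sum>b\<in>Basis. f (P b) \<bullet> b) + (\<Sum>b\<in>Basis. f (i_times (P (- i_times b))) \<bullet> b)"
    unfolding sum.distrib [symmetric] inner_left_distrib [symmetric] dec [symmetric] ..
  then have "2 * killing M N = (\<Sum>b\<in>Basis. f b \<bullet> b)"
    by (simp add: s1 s2 k)
  also have "\<dots> = (\<Sum>b :: complex^4^4\<in>Basis. ((M ** N) ** b ** mat 1) \<bullet> b) - (\<Sum>b\<in>Basis. (M ** b ** N) \<bullet> b)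
    - (\<Sum>b\<in>Basis. (N ** b ** M) \<bullet> b) + (\<Sum>b :: complex^4^4\<in>Basis. (mat 1 ** b ** (N ** M)) \<bullet> b)"
    by (simp only: fb inner_left_distrib inner_diff_left sum.distrib sum_subtractf)
  also have "\<dots> = 16 * Re (trace (M ** N))"
    using M N trace_mul_sym [of N M] unfolding trace_sandwich by (simp add: su_iff trace_4 mat_1_component)
  finally show ?thesis
    using su_inner [OF M N] by simp
qed

section \<open>The orthogonal complement of the isotropy algebra\<close>

definition opart :: "complex^4^4 \<Rightarrow> complex^4^4" where
  "opart M = (\<chi> i j. if (i \<in> {1,4}) = (j \<in> {1,4}) then 0 else M $ i $ j)"

lemma opart_blk: "blk (M - opart M)"
  by (simp add: blk_def opart_def)

lemma inner_4: "(M :: complex^4^4) \<bullet> N =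
    M$1$1 \<bullet> N$1$1 + M$1$2 \<bullet> N$1$2 + M$1$3 \<bullet> N$1$3 + M$1$4 \<bullet> N$1$4
  + (M$2$1 \<bullet> N$2$1 + M$2$2 \<bullet> N$2$2 + M$2$3 \<bullet> N$2$3 + M$2$4 \<bullet> N$2$4)
  + (M$3$1 \<bullet> N$3$1 + M$3$2 \<bullet> N$3$2 + M$3$3 \<bullet> N$3$3 + M$3$4 \<bullet> N$3$4)
  + (M$4$1 \<bullet> N$4$1 + M$4$2 \<bullet> N$4$2 + M$4$3 \<bullet> N$4$3 + M$4$4 \<bullet> N$4$4)"
  by (simp add: inner_vec_def sum_4)

lemma opart_su: "M \<in> su \<Longrightarrow> opart M \<in> su"
  by (simp add: su_iff forall_4 trace_4 opart_def)

text \<open>On \<open>su\<close> the Killing form is a multiple of the Euclidean inner product, so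
  its complement to the block diagonal matrices is the Euclidean one.\<close>

lemma p_space_eq: "p_space = {M \<in> su. opart M = M}"
proof (intro set_eqI iffI)
  fix M assume "M \<in> p_space"
  then have M: "M \<in> su" "\<And>N. N \<in> k_alg \<Longrightarrow> killing M N = 0"
    by (auto simp: p_space_def)
  let ?N = "M - opart M"
  have N: "?N \<in> su"
    using M(1) opart_su by (intro subspace_diff [OF subspace_su]) auto
  then have "?N \<in> k_alg"
    by (simp add: k_alg_eq opart_blk)
  then have "M \<bullet> ?N = 0"
    using M(2) killing_eq [OF M(1) N] by simp
  moreover have "M \<bullet> ?N = ?N \<bullet> ?N"
    by (simp add: inner_4 opart_def)
  ultimately have "?N = 0" by simp
  with M(1) show "M \<in> {M \<in> su. opart M = M}" by simp
next
  fix M assume M: "M \<in> {M \<in> su. opart M = M}"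
  have "killing M N = 0" if "N \<in> k_alg" for N
  proof -
    have N: "N \<in> su" "blk N" using that by (simp_all add: k_alg_eq)
    have "opart M \<bullet> N = 0"
      using N(2) by (simp add: inner_4 opart_def blk_def)
    then show ?thesis
      using M N(1) by (simp add: killing_eq)
  qed
  with M show "M \<in> p_space" by (simp add: p_space_def)
qed

lemma opart_opart: "opart (opart M) = opart M"
  by (simp add: opart_def vec_eq_iff forall_4)

lemma linear_opart: "linear opart"
  by (intro linearI) (simp_all add: opart_def vec_eq_iff forall_4)

lemma p_proj_eq:
  assumes "M \<in> su"
  shows "p_proj M = opart M"
  unfolding p_proj_def
proof (rule the_equality)
  show "opart M \<in> p_space \<and> M - opart M \<in> k_alg"
    using assms opart_su [OF assms] subspace_diff [OF subspace_su assms]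
    by (simp add: p_space_eq opart_opart k_alg_eq opart_blk)
  fix Z assume "Z \<in> p_space \<and> M - Z \<in> k_alg"
  then have "opart Z = Z" "blk (M - Z)"
    by (simp_all add: p_space_eq k_alg_eq)
  moreover have "opart (M - Z) = 0" if "blk (M - Z)"
    using that by (simp add: opart_def vec_eq_iff forall_4 blk_def)
  ultimately show "Z = opart M"
    by (simp add: linear_diff [OF linear_opart])
qed

section \<open>Tangent spaces of the orbits\<close>

lemma su_conj: "M \<in> su \<Longrightarrow> a \<in> SU \<Longrightarrow> ctranspose a ** M ** a \<in> su"
proof -
  assume M: "M \<in> su" and a: "a \<in> SU"
  have "trace (ctranspose a ** M ** a) = trace (a ** (ctranspose a ** M))"
    by (rule trace_mul_sym)
  then show ?thesis
    using M a by (simp add: su_def ctranspose_mult matmul_minus_left matmul_minus_right matrix_mul_assoc SU_D1)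
qed

lemma su3_su: "M \<in> su3 \<Longrightarrow> M \<in> su"
  by (simp add: su3_def)

text \<open>Invariance of the complement under the isotropy group, which lets the representative of
  a coset be changed.\<close>

lemma opart_conj:
  assumes "blk k"
  shows "opart (ctranspose k ** M ** k) = ctranspose k ** opart M ** k"
  using assms by (simp add: vec_eq_iff forall_4 opart_def matmul_component sum_4 blk_def)

lemma orbit_tangent_eq: "a \<in> SU \<Longrightarrow> orbit_tangent a = (\<lambda>M. opart (ctranspose a ** M ** a)) ` su3"
  unfolding orbit_tangent_def
  by (intro image_cong refl) (simp add: matrix_inv_SU p_proj_eq su_conj su3_su)

lemma su3_conj:
  assumes M: "M \<in> su3" and g: "g \<in> SU"
  shows "ctranspose (emb g) ** M ** emb g \<in> su3"
proof -
  have "ctranspose (emb g) ** M ** emb g \<in> su"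
    using su_conj [OF su3_su [OF M]] g by simp
  moreover have "\<forall>i. (ctranspose (emb g) ** M ** emb g) $ i $ 4 = 0 \<and> (ctranspose (emb g) ** M ** emb g) $ 4 $ i = 0"
    using M by (simp add: su3_def forall_4 matmul_component sum_4 emb_def)
  ultimately show ?thesis
    by (simp add: su3_def)
qed

lemma su3_conj_image: "g \<in> SU \<Longrightarrow> (\<lambda>M. ctranspose (emb g) ** M ** emb g) ` su3 = su3"
proof -
  assume g: "g \<in> SU"
  have "M = ctranspose (emb g) ** (ctranspose (emb (ctranspose g)) ** M ** emb (ctranspose g)) ** emb g" for M
    using g by (simp add: ctranspose_emb matrix_mul_assoc [symmetric] emb_mult [symmetric] SU_D2)
      (simp add: matrix_mul_assoc emb_mult [symmetric] SU_D2)
  then have "M \<in> (\<lambda>M. ctranspose (emb g) ** M ** emb g) ` su3" if "M \<in> su3" for M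
    using su3_conj [OF that ctranspose_SU [OF g]] by blast
  then show ?thesis
    using su3_conj g by blast
qed

text \<open>Write \<open>a = emb g ** radial_0 t ** k\<close>: conjugation by \<open>emb g\<close>
  only permutes \<open>su3\<close>, and conjugation by \<open>k\<close> is an isomorphism commuting
  with \<open>opart\<close>.\<close>

lemma dim_orbit_tangent:
  assumes a: "a \<in> SU" "coset a \<in> orbit (pt t)"
  shows "dim (orbit_tangent a) = dim (orbit_tangent (radial_0 t))"
proof -
  let ?r = "radial_0 t"
  obtain g where g: "g \<in> SU" "coset a = coset (emb g ** ?r)"
    using a(2) by (auto simp: orbit_def pt_eq act_coset)
  have gr: "emb g ** ?r \<in> SU" using g by (simp add: mult_SU radial_0_SU)
  define k where "k = ctranspose (emb g ** ?r) ** a"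
  have k: "k \<in> SU" "blk k"
    using coset_eq_iff [OF gr a(1)] g gr a by (simp_all add: k_def mult_SU ctranspose_SU)
  have ak: "a = emb g ** ?r ** k"
    using gr by (simp add: k_def SU_cancel)
  have e: "opart (ctranspose a ** M ** a) =
    ctranspose k ** opart (ctranspose ?r ** (ctranspose (emb g) ** M ** emb g) ** ?r) ** k" for M
    unfolding opart_conj [OF k(2), symmetric] ak by (simp add: ctranspose_mult matrix_mul_assoc)
  have "orbit_tangent a = (\<lambda>X. ctranspose k ** X ** k) `
      (\<lambda>M. opart (ctranspose ?r ** M ** ?r)) ` (\<lambda>M. ctranspose (emb g) ** M ** emb g) ` su3"
    unfolding orbit_tangent_eq [OF a(1)] by (simp add: image_image e)
  also have "\<dots> = (\<lambda>X. ctranspose k ** X ** k) ` orbit_tangent ?r"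
    unfolding su3_conj_image [OF g(1)] orbit_tangent_eq [OF radial_0_SU] ..
  also have "dim \<dots> = dim (orbit_tangent ?r)"
  proof (rule dim_image_eq)
    show "linear (\<lambda>X. ctranspose k ** X ** k)"
      by (intro linearI) (simp_all add: matmul_add_left matmul_add_right matmul_scaleR_left matmul_scaleR_right)
    have "X = k ** (ctranspose k ** X ** k) ** ctranspose k" for X
      using k(1) by (simp add: matrix_mul_assoc SU_D1 SU_cancel)
    then show "inj_on (\<lambda>X. ctranspose k ** X ** k) (span (orbit_tangent ?r))"
      by (intro inj_onI) metis
  qed
  finally show ?thesis .
qed

text \<open>The one computation behind both the orbit tangent spaces and the metric. The term with
  \<open>r\<close> is the velocity along the geodesic; it shares the entries (4,2) and (2,4) with
  \<open>x$2$2\<close>, which is imaginary while \<open>r\<close> is real.\<close>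

lemma opart_radial_entries:
  assumes x: "x \<in> su3"
  shows "opart (ctranspose (radial_0 t) ** x ** radial_0 t + r *\<^sub>R C_mat 5) = (\<chi> i j.
    if i = 1 \<and> j = 2 then of_real (cos t) * x$1$2 else if i = 2 \<and> j = 1 then - cnj (of_real (cos t) * x$1$2)
    else if i = 1 \<and> j = 3 then x$1$3 else if i = 3 \<and> j = 1 then - cnj (x$1$3)
    else if i = 4 \<and> j = 2 then of_real (sin t * cos t) * x$2$2 - of_real r
    else if i = 2 \<and> j = 4 then of_real (sin t * cos t) * x$2$2 + of_real r
    else if i = 4 \<and> j = 3 then of_real (sin t) * x$2$3 else if i = 3 \<and> j = 4 then - cnj (of_real (sin t) * x$2$3)
    else 0)"
proof -
  have z: "x$1$4 = 0" "x$2$4 = 0" "x$3$4 = 0" "x$4$4 = 0" "x$4$1 = 0" "x$4$2 = 0" "x$4$3 = 0"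
    "x$2$1 = - cnj (x$1$2)" "x$3$1 = - cnj (x$1$3)" "x$3$2 = - cnj (x$2$3)"
    using x by (simp_all add: su3_def su_iff)
  show ?thesis
    by (simp add: vec_eq_iff forall_4 opart_def matmul_component sum_4 radial_0_eq C_mat_eq E_mat_component z
      scaleR_conv_of_real [where 'a = complex] algebra_simps)
qed

lemma subspace_p_space: "subspace p_space"
proof -
  have "subspace {M. opart M = M}"
    by (auto simp: subspace_def linear_add [OF linear_opart] linear_scale [OF linear_opart] linear_0 [OF linear_opart])
  then show ?thesis
    unfolding p_space_eq using subspace_inter [OF subspace_su] by (simp add: Collect_conj_eq)
qed

lemma p_space_entries: "Z \<in> p_space \<longleftrightarrow> Z$1$1 = 0 \<and> Z$1$4 = 0 \<and> Z$2$2 = 0 \<and> Z$2$3 = 0 \<and> Z$3$2 = 0 \<and> Z$3$3 = 0 \<and>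
    Z$4$1 = 0 \<and> Z$4$4 = 0 \<and> Z$2$1 = - cnj (Z$1$2) \<and> Z$3$1 = - cnj (Z$1$3) \<and> Z$2$4 = - cnj (Z$4$2) \<and> Z$3$4 = - cnj (Z$4$3)"
  by (auto simp: p_space_eq su_iff opart_def vec_eq_iff forall_4 trace_4 complex_eq_iff)

lemma orbit_tangent_radial:
  "orbit_tangent (radial_0 t) = (\<lambda>x. opart (ctranspose (radial_0 t) ** x ** radial_0 t + 0 *\<^sub>R C_mat 5)) ` su3"
  by (simp add: orbit_tangent_eq [OF radial_0_SU])

lemma su3_diag: "x \<in> su3 \<Longrightarrow> x $ i $ i = \<i> * of_real (Im (x $ i $ i))"
  by (rule su_diag [OF su3_su])

text \<open>For matrices in \<open>p_space\<close> the condition is orthogonality to the geodesic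
  direction \<open>C_mat 5\<close>.\<close>

definition hyper :: "(complex^4^4) set" where
  "hyper = {Z \<in> p_space. Re (Z$4$2) = 0}"

lemma dim_hyper: "dim hyper + 1 = dim p_space"
proof -
  have C: "C_mat 5 \<in> p_space"
    by (simp add: p_space_entries C_mat_eq E_mat_component)
  have nz: "C_mat 5 \<noteq> 0"
    by (auto simp: C_mat_eq E_mat_component vec_eq_iff)
  have "(\<forall>x\<in>span {C_mat 5}. orthogonal x y) \<longleftrightarrow> Re (y$4$2) = 0" if "y \<in> p_space" for y
  proof -
    have "C_mat 5 \<bullet> y = - 2 * Re (y$4$2)"
      using that by (simp add: inner_4 C_mat_eq E_mat_component p_space_entries inner_complex_def)
    then show ?thesis
      by (auto simp: span_singleton orthogonal_def)
  qed
  then have "{y \<in> p_space. \<forall>x\<in>span {C_mat 5}. orthogonal x y} = hyper"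
    by (auto simp: hyper_def)
  moreover have "dim (span {C_mat 5}) = 1"
    using nz by (simp add: dim_span_eq_card_independent)
  moreover have "span {C_mat 5} \<subseteq> p_space"
    using C by (intro span_minimal subspace_p_space) auto
  ultimately show ?thesis
    using dim_subspace_orthogonal_to_vectors [OF subspace_span subspace_p_space, of "{C_mat 5}"] by simp
qed

lemma subspace_hyper: "subspace hyper"
  using subspace_p_space unfolding hyper_def subspace_def by auto

lemma orbit_tangent_principal:
  assumes t: "t \<in> {0<..<pi/2}"
  shows "orbit_tangent (radial_0 t) = hyper"
proof
  have sc: "sin t \<noteq> 0" "cos t \<noteq> 0"
    using t sin_gt_zero [of t] cos_gt_zero [of t] by auto
  show "orbit_tangent (radial_0 t) \<subseteq> hyper"
  proof
    fix Z assume "Z \<in> orbit_tangent (radial_0 t)"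
    then obtain x where x: "x \<in> su3" and Z: "Z = opart (ctranspose (radial_0 t) ** x ** radial_0 t + 0 *\<^sub>R C_mat 5)"
      unfolding orbit_tangent_radial by blast
    have "Re (x$2$2) = 0" using su3_diag [OF x, of 2] by (simp add: complex_eq_iff)
    then show "Z \<in> hyper"
      unfolding Z opart_radial_entries [OF x] hyper_def by (simp add: p_space_entries complex_eq_iff)
  qed
  show "hyper \<subseteq> orbit_tangent (radial_0 t)"
  proof
    fix Z assume Z: "Z \<in> hyper"
    \<comment> \<open>Found by solving \<open>opart_radial_entries\<close> for \<open>x\<close>,
      possible because \<open>sin t\<close> and \<open>cos t\<close> are nonzero. The entry (1,1) is
      chosen to make the trace vanish.\<close>
    define x :: "complex^4^4" where "x = (\<chi> i j.
      if i = 1 \<and> j = 2 then Z$1$2 / of_real (cos t) else if i = 2 \<and> j = 1 then - cnj (Z$1$2 / of_real (cos t))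
      else if i = 1 \<and> j = 3 then Z$1$3 else if i = 3 \<and> j = 1 then - cnj (Z$1$3)
      else if i = 2 \<and> j = 3 then Z$4$3 / of_real (sin t) else if i = 3 \<and> j = 2 then - cnj (Z$4$3 / of_real (sin t))
      else if i = 2 \<and> j = 2 then Z$4$2 / of_real (sin t * cos t)
      else if i = 1 \<and> j = 1 then - Z$4$2 / of_real (sin t * cos t) else 0)"
    have c: "cnj (Z$4$2) = - Z$4$2"
      using Z by (simp add: hyper_def complex_eq_iff)
    have x: "x \<in> su3"
      by (simp add: su3_def su_iff forall_4 trace_4 x_def c)
    have "opart (ctranspose (radial_0 t) ** x ** radial_0 t + 0 *\<^sub>R C_mat 5) = Z"
      unfolding opart_radial_entries [OF x] using Z sc
      by (simp add: vec_eq_iff forall_4 hyper_def p_space_entries x_def c)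
    with x show "Z \<in> orbit_tangent (radial_0 t)"
      unfolding orbit_tangent_radial by blast
  qed
qed

lemma dim_orbit_tangent_singular:
  assumes "t = 0 \<or> t = pi/2"
  shows "dim (orbit_tangent (radial_0 t)) < dim hyper"
proof -
  \<comment> \<open>An entry whose coefficient in \<open>opart_radial_entries\<close> vanishes:
    (4,3) carries \<open>sin t\<close>, and (1,2) carries \<open>cos t\<close>.\<close>
  define i :: 4 where "i = (if t = 0 then 4 else 1)"
  define j :: 4 where "j = (if t = 0 then 3 else 2)"
  define S where "S = {Z \<in> hyper. Z $ i $ j = 0}"
  have S: "subspace S"
    using subspace_hyper unfolding S_def subspace_def by auto
  have "orbit_tangent (radial_0 t) \<subseteq> S"
  proof
    fix Z assume "Z \<in> orbit_tangent (radial_0 t)"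
    then obtain x where x: "x \<in> su3" and Z: "Z = opart (ctranspose (radial_0 t) ** x ** radial_0 t + 0 *\<^sub>R C_mat 5)"
      unfolding orbit_tangent_radial by blast
    have "Re (x$2$2) = 0" using su3_diag [OF x, of 2] by (simp add: complex_eq_iff)
    moreover have "t = 0 \<and> sin t = 0 \<or> t \<noteq> 0 \<and> cos t = 0"
      using assms by (elim disjE; hypsubst; simp)
    ultimately show "Z \<in> S"
      unfolding Z opart_radial_entries [OF x] hyper_def S_def i_def j_def
      by (elim disjE conjE) (simp_all add: p_space_entries complex_eq_iff)
  qed
  then have 1: "span (orbit_tangent (radial_0 t)) \<subseteq> S"
    by (rule span_minimal [OF _ S])
  have "E_mat i j - E_mat j i \<in> hyper" "E_mat i j - E_mat j i \<notin> S"
    by (auto simp: hyper_def S_def p_space_entries E_mat_component i_def j_def)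
  then have "S \<subset> hyper" unfolding S_def by blast
  with 1 have "span (orbit_tangent (radial_0 t)) \<subset> span hyper"
    using span_superset [of hyper] by blast
  then show ?thesis
    by (rule dim_psubset)
qed

lemma principal_dim: "a \<in> SU \<Longrightarrow> principal_at (coset a) \<Longrightarrow> dim (orbit_tangent a) = dim hyper"
  using principal_iff_orbit dim_orbit_tangent orbit_tangent_principal by metis

lemma singular_iff:
  assumes a: "a \<in> SU"
  shows "singular_at a \<longleftrightarrow> coset a \<in> orbit (pt 0) \<union> orbit (pt (pi/2))"
proof
  assume "singular_at a"
  then have np: "\<not> principal_at (coset a)"
    unfolding singular_at_def using principal_dim a by (metis less_irrefl)
  obtain t where t: "t \<in> {0..pi/2}" "hgt a = (cos t)\<^sup>2" by (rule hgt_angle [OF a])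
  then have o: "coset a \<in> orbit (pt t)"
    using orbit_pt_iff [OF a] by blast
  then have "t \<notin> {0<..<pi/2}"
    using np principal_iff_orbit [OF a] by blast
  then have "t = 0 \<or> t = pi/2" using t(1) by auto
  with o show "coset a \<in> orbit (pt 0) \<union> orbit (pt (pi/2))" by blast
next
  assume "coset a \<in> orbit (pt 0) \<union> orbit (pt (pi/2))"
  then obtain t where t: "t = 0 \<or> t = pi/2" "coset a \<in> orbit (pt t)" by blast
  have "pi/4 \<in> {0<..<pi/2}" by simp
  moreover have "coset (radial_0 (pi/4)) \<in> orbit (pt (pi/4))"
    using act_in_orbit [OF mat_1_SU, of "pt (pi/4)"] by (simp add: pt_eq)
  ultimately have p: "principal_at (coset (radial_0 (pi/4)))"
    using principal_iff_orbit [OF radial_0_SU] by blast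
  have "dim (orbit_tangent a) < dim (orbit_tangent (radial_0 (pi/4)))"
    using dim_orbit_tangent [OF a t(2)] dim_orbit_tangent_singular [OF t(1)] principal_dim [OF radial_0_SU p] by simp
  with p show "singular_at a"
    unfolding singular_at_def using radial_0_SU by blast
qed

subsection \<open>The metric\<close>

lemma orbit_map_push_eq:
  assumes "(\<gamma> has_vector_derivative D) (at t)"
  shows "orbit_map_push \<gamma> g t (x, r) = emb g ** (x ** \<gamma> t + r *\<^sub>R D)"
proof -
  have "((\<lambda>s. mexp (s *\<^sub>R x)) has_vector_derivative x) (at 0)"
    using mexp_has_vector_derivative [of x 0] by simp
  moreover have "((\<lambda>s. \<gamma> (t + s * r)) has_vector_derivative r *\<^sub>R D) (at 0)"
    using assms
    by (intro vector_diff_chain_at [where f = "\<lambda>s. t + s * r" and g = \<gamma>, unfolded o_def])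
      (auto intro!: derivative_eq_intros)
  ultimately have "((\<lambda>s. mexp (s *\<^sub>R x) ** \<gamma> (t + s * r)) has_vector_derivative
      mexp (0 *\<^sub>R x) ** (r *\<^sub>R D) + x ** \<gamma> (t + 0 * r)) (at 0)"
    by (intro bounded_bilinear.has_vector_derivative [OF bounded_bilinear_matmul])
  from bounded_linear.has_vector_derivative [OF bounded_bilinear.bounded_linear_right [OF bounded_bilinear_matmul] this]
  have "((\<lambda>s. emb g ** (mexp (s *\<^sub>R x) ** \<gamma> (t + s * r))) has_vector_derivative
    emb g ** (x ** \<gamma> t + r *\<^sub>R D)) (at 0)"
    by (simp add: add.commute)
  from vector_derivative_at [OF this] show ?thesis
    by (simp add: orbit_map_push_def matrix_mul_assoc)
qed

text \<open>The sign \<open>e\<close> is the direction in which the geodesic \<open>exp(t C\<^sub>5)\<close> is traversed.\<close>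

lemma pullback_metric_eq:
  assumes \<gamma>: "(\<gamma> has_vector_derivative e *\<^sub>R (C_mat 5 ** \<gamma> t)) (at t)" "\<gamma> t = radial_0 u" "e * e = 1"
    and g: "g \<in> SU" and x: "x \<in> su3" and y: "y \<in> su3"
  shows "pullback_metric \<gamma> g t (x, \<sigma>) (y, \<tau>) =
    16 * ((cos u)\<^sup>2 * (x$1$2 \<bullet> y$1$2) + x$1$3 \<bullet> y$1$3 + (sin u * cos u)\<^sup>2 * (x$2$2 \<bullet> y$2$2) + \<sigma> * \<tau>
      + (sin u)\<^sup>2 * (x$2$3 \<bullet> y$2$3))"
proof -
  let ?r = "radial_0 u"
  \<comment> \<open>The velocity \<open>C_mat 5 ** ?r\<close> can thus be written as a left
    translate \<open>?r ** C_mat 5\<close>, as translation back to the base point requires.\<close>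
  have comm: "C_mat 5 ** ?r = ?r ** C_mat 5"
    unfolding radial_0_def by (rule mexp_commutes) (simp add: matmul_scaleR_left matmul_scaleR_right)
  have p: "p_proj (matrix_inv (emb g ** \<gamma> t) ** orbit_map_push \<gamma> g t (z, r)) =
    opart (ctranspose ?r ** z ** ?r + (r * e) *\<^sub>R C_mat 5)" if z: "z \<in> su3" for z r
  proof -
    have "matrix_inv (emb g ** \<gamma> t) = ctranspose ?r ** ctranspose (emb g)"
      using g by (simp add: \<gamma>(2) matrix_inv_SU mult_SU radial_0_SU ctranspose_mult)
    then have "matrix_inv (emb g ** \<gamma> t) ** orbit_map_push \<gamma> g t (z, r) =
      ctranspose ?r ** (ctranspose (emb g) ** (emb g ** (z ** ?r + (r * e) *\<^sub>R (C_mat 5 ** ?r))))"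
      by (simp add: orbit_map_push_eq [OF \<gamma>(1)] \<gamma>(2) matrix_mul_assoc)
    also have "\<dots> = ctranspose ?r ** (z ** ?r + (r * e) *\<^sub>R (?r ** C_mat 5))"
      using g by (simp add: SU_cancel comm)
    also have "\<dots> = ctranspose ?r ** z ** ?r + (r * e) *\<^sub>R C_mat 5"
      by (simp add: matmul_add_right matmul_scaleR_right matrix_mul_assoc SU_D2 [OF radial_0_SU])
    finally show ?thesis
      using z by (simp add: p_proj_eq subspace_add [OF subspace_su] subspace_scale [OF subspace_su]
        su_conj su3_su radial_0_SU C_mat_su)
  qed
  have su: "opart (ctranspose ?r ** z ** ?r + r *\<^sub>R C_mat 5) \<in> su" if "z \<in> su3" for z r
    using that by (intro opart_su subspace_add [OF subspace_su] subspace_scale [OF subspace_su])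
      (simp_all add: su_conj su3_su radial_0_SU C_mat_su)
  have d: "Re (x$2$2) = 0" "Re (y$2$2) = 0"
    using su3_diag [OF x, of 2] su3_diag [OF y, of 2] by (simp_all add: complex_eq_iff)
  have st: "\<sigma> * e * (\<tau> * e) = \<sigma> * \<tau>"
    using \<gamma>(3) by (metis mult.assoc mult.commute mult.right_neutral)
  have "pullback_metric \<gamma> g t (x, \<sigma>) (y, \<tau>) =
    8 * (opart (ctranspose ?r ** x ** ?r + (\<sigma> * e) *\<^sub>R C_mat 5) \<bullet> opart (ctranspose ?r ** y ** ?r + (\<tau> * e) *\<^sub>R C_mat 5))"
    using x y by (simp add: pullback_metric_def wolf_metric_def p killing_eq su)
  \<comment> \<open>Each component occurs in two entries, conjugate up to sign, which doubles the
    factor 8 of the Killing form. The mixed terms of \<open>x$2$2\<close> and the radial direction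
    cancel because \<open>x$2$2\<close> is imaginary.\<close>
  also have "\<dots> = 16 * ((cos u)\<^sup>2 * (x$1$2 \<bullet> y$1$2) + x$1$3 \<bullet> y$1$3 + (sin u * cos u)\<^sup>2 * (x$2$2 \<bullet> y$2$2)
      + \<sigma> * e * (\<tau> * e) + (sin u)\<^sup>2 * (x$2$3 \<bullet> y$2$3))"
    unfolding opart_radial_entries [OF x] opart_radial_entries [OF y] inner_4
    by (simp add: inner_complex_def d power2_eq_square algebra_simps)
  finally show ?thesis
    by (simp only: st)
qed

lemma pullback_radial_0:
  assumes "g \<in> SU" "x \<in> su3" "y \<in> su3"
  shows "pullback_metric radial_0 g t (x, \<sigma>) (y, \<tau>) =
    16 * ((cos t)\<^sup>2 * (x$1$2 \<bullet> y$1$2) + x$1$3 \<bullet> y$1$3 + (sin t * cos t)\<^sup>2 * (x$2$2 \<bullet> y$2$2) + \<sigma> * \<tau>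
      + (sin t)\<^sup>2 * (x$2$3 \<bullet> y$2$3))"
proof (rule pullback_metric_eq [OF _ refl _ assms])
  show "(radial_0 has_vector_derivative 1 *\<^sub>R (C_mat 5 ** radial_0 t)) (at t)"
    using mexp_has_vector_derivative [of "C_mat 5" t] by (simp add: radial_0_def [abs_def])
qed simp

lemma pullback_radial_1:
  assumes "g \<in> SU" "x \<in> su3" "y \<in> su3"
  shows "pullback_metric radial_1 g t (x, \<sigma>) (y, \<tau>) =
    16 * ((sin t)\<^sup>2 * (x$1$2 \<bullet> y$1$2) + x$1$3 \<bullet> y$1$3 + (sin t * cos t)\<^sup>2 * (x$2$2 \<bullet> y$2$2) + \<sigma> * \<tau>
      + (cos t)\<^sup>2 * (x$2$3 \<bullet> y$2$3))"
proof -
  have "((\<lambda>t. mexp ((pi / 2 - t) *\<^sub>R C_mat 5)) has_vector_derivative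
      (- 1) *\<^sub>R (C_mat 5 ** mexp ((pi / 2 - t) *\<^sub>R C_mat 5))) (at t)"
    by (rule vector_diff_chain_at [where f = "\<lambda>t. pi / 2 - t" and g = "\<lambda>t. mexp (t *\<^sub>R C_mat 5)", unfolded o_def])
      (auto intro!: mexp_has_vector_derivative derivative_eq_intros)
  then have "(radial_1 has_vector_derivative (- 1) *\<^sub>R (C_mat 5 ** radial_1 t)) (at t)"
    by (simp add: radial_1_def [abs_def])
  from pullback_metric_eq [OF this radial_1_eq _ assms] show ?thesis
    by (simp add: sin_diff cos_diff mult.commute)
qed

section \<open>The automorphism relating the two bundles\<close>

definition G_mat :: "complex^4^4" where
  "G_mat = (\<chi> i j. if i = 3 \<and> j = 1 then 1 else if i = 2 \<and> j = 2 then 1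
    else if i = 1 \<and> j = 3 then -1 else if i = 4 \<and> j = 4 then 1 else 0)"

definition conj_G :: "complex^4^4 \<Rightarrow> complex^4^4" where
  "conj_G M = G_mat ** M ** ctranspose G_mat"

lemma G_mat_SU: "G_mat \<in> SU"
  by (simp add: SU_def G_mat_def det_4 mat4_simps)

lemma conj_G_entries: "conj_G M = (\<chi> i j. (if i = 1 then -1 else 1) * (if j = 1 then -1 else 1) *
    M $ (if i = 1 then 3 else if i = 3 then 1 else i) $ (if j = 1 then 3 else if j = 3 then 1 else j))"
  by (simp add: conj_G_def G_mat_def mat4_simps)

lemma linear_conj_G: "linear conj_G"
  unfolding conj_G_def
  by (intro linearI) (simp_all add: matmul_add_left matmul_add_right matmul_scaleR_left matmul_scaleR_right)

lemma conj_G_su3: "M \<in> su3 \<Longrightarrow> conj_G M \<in> su3"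
  using su_conj [of M "ctranspose G_mat"]
  by (simp add: su3_def ctranspose_SU G_mat_SU flip: conj_G_def) (simp add: conj_G_entries forall_4)

lemma lie_automorphism_conj_G: "lie_automorphism su3 conj_G"
  unfolding lie_automorphism_def
proof (intro conjI ballI)
  show "linear conj_G" by (rule linear_conj_G)
  define h where "h M = ctranspose G_mat ** M ** G_mat" for M
  have h: "h (conj_G M) = M" "conj_G (h M) = M" for M
    using G_mat_SU by (simp_all add: h_def conj_G_def matrix_mul_assoc SU_cancel SU_D1 SU_D2)
  have "h M \<in> su3" if "M \<in> su3" for M
  proof -
    have "h M \<in> su"
      unfolding h_def using su3_su [OF that] G_mat_SU by (rule su_conj)
    then show ?thesis
      using that by (simp add: su3_def) (simp add: h_def forall_4 matmul_component sum_4 G_mat_def)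
  qed
  then show "bij_betw conj_G su3 su3"
    using h conj_G_su3 by (intro bij_betwI [where g = h]) auto
  fix x y
  have "conj_G A ** conj_G B = conj_G (A ** B)" for A B
    using G_mat_SU by (simp add: conj_G_def matrix_mul_assoc SU_cancel)
  then show "conj_G (lie_bracket x y) = lie_bracket (conj_G x) (conj_G y)"
    by (simp add: lie_bracket_def linear_diff [OF linear_conj_G])
qed

text \<open>The signs of \<open>G_mat\<close> are tuned to the prescribed images: conjugation by
  \<open>emb swap13\<close> also exchanges the indices 1 and 3, but it fixes
  \<open>e_mat 2\<close>.\<close>

lemma conj_G_e_mat: "conj_G (e_mat 1) = - e_mat 1" "conj_G (e_mat 2) = e_mat 4" "conj_G (e_mat 3) = - e_mat 5"
  "conj_G (e_mat 4) = - e_mat 2" "conj_G (e_mat 5) = e_mat 3" "conj_G (e_mat 6) = e_mat 6"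
  "conj_G (e_mat 7) = - e_mat 7" "conj_G (e_mat 8) = e_mat 8"
  by (simp_all add: conj_G_entries e_mat_def basis_mat_defs vec_eq_iff forall_4 i_times_component
    transpose_component E_mat_component)

lemma span_e_mat: "span (e_mat ` {1..8}) = su3"
proof
  have sub: "subspace su3"
    using subspace_su [where 'n = 4] unfolding su3_def subspace_def by auto
  have "{1..8::nat} = {1, 2, 3, 4, 5, 6, 7, 8}" by auto
  moreover have "e_mat 1 \<in> su3" "e_mat 2 \<in> su3" "e_mat 3 \<in> su3" "e_mat 4 \<in> su3" "e_mat 5 \<in> su3"
    "e_mat 6 \<in> su3" "e_mat 7 \<in> su3" "e_mat 8 \<in> su3"
    by (simp_all add: su3_def su_iff e_mat_def basis_mat_defs forall_4 i_times_component
      transpose_component E_mat_component trace_4 algebra_simps)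
  ultimately have "e_mat ` {1..8} \<subseteq> su3" by simp
  then show "span (e_mat ` {1..8}) \<subseteq> su3"
    by (rule span_minimal [OF _ sub])
  show "su3 \<subseteq> span (e_mat ` {1..8})"
  proof
    fix M assume M: "M \<in> su3"
    define x where "x i = Im (M $ i $ i)" for i
    have d: "M $ i $ i = \<i> * of_real (x i)" for i
      using su3_diag [OF M] by (simp add: x_def)
    have "Im (trace M) = 0" "M$4$4 = 0"
      using M by (simp_all add: su3_def su_iff)
    then have tr: "x 2 = - x 1 - x 3" "x 4 = 0"
      by (simp_all add: trace_4 x_def)
    have z: "M$1$4 = 0" "M$2$4 = 0" "M$3$4 = 0" "M$4$4 = 0" "M$4$1 = 0" "M$4$2 = 0" "M$4$3 = 0"
      "M$2$1 = - cnj (M$1$2)" "M$3$1 = - cnj (M$1$3)" "M$3$2 = - cnj (M$2$3)"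
      using M by (simp_all add: su3_def su_iff)
    \<comment> \<open>\<open>e_mat 1\<close> and \<open>e_mat 8\<close> are \<open>i\<close> times
      diag(1,0,-1,0) and diag(1,-2,1,0) divided by \<open>sqrt 3\<close>. The entries (1,2) and
      (2,3) are recovered from half sums and half differences, \<open>e_mat 2\<close> to
      \<open>e_mat 5\<close> being sums and differences of the corresponding basis matrices.\<close>
    have "M = ((x 1 - x 3) / 2) *\<^sub>R e_mat 1 + (sqrt 3 * (- x 2 / 2)) *\<^sub>R e_mat 8
      + (sqrt 2 * ((Re (M$1$2) + Re (M$2$3)) / 2)) *\<^sub>R e_mat 2 + (sqrt 2 * ((Re (M$1$2) - Re (M$2$3)) / 2)) *\<^sub>R e_mat 4
      + (sqrt 2 * ((Im (M$1$2) + Im (M$2$3)) / 2)) *\<^sub>R e_mat 3 + (sqrt 2 * ((Im (M$1$2) - Im (M$2$3)) / 2)) *\<^sub>R e_mat 5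
      + Re (M$1$3) *\<^sub>R e_mat 6 + (- Im (M$1$3)) *\<^sub>R e_mat 7"
      by (simp add: vec_eq_iff forall_4 e_mat_def basis_mat_defs i_times_component transpose_component
        E_mat_component z complex_eq_iff d tr) (simp add: field_simps tr)
    also have "\<dots> \<in> span (e_mat ` {1..8})"
      by (intro span_add span_scale span_base imageI) auto
    finally show "M \<in> span (e_mat ` {1..8})" .
  qed
qed

text \<open>Up to sign and conjugation, invisible to the inner products, \<open>conj_G\<close>
  exchanges the entries (1,2) and (2,3) and keeps (1,3) and (2,2). This matches the exchange of
  \<open>sin t\<close> and \<open>cos t\<close>. The points \<open>g\<close> and \<open>g'\<close>
  may differ since both metrics are left-invariant.\<close>

lemma metric_conj_G:
  assumes "g \<in> SU" "g' \<in> SU" "x \<in> su3" "y \<in> su3"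
  shows "pullback_metric radial_1 g' t (conj_G x, \<sigma>) (conj_G y, \<tau>) = pullback_metric radial_0 g t (x, \<sigma>) (y, \<tau>)"
proof -
  have "z$3$2 = - cnj (z$2$3)" "z$3$1 = - cnj (z$1$3)" "z$2$1 = - cnj (z$1$2)" if "z \<in> su3" for z
    using that by (simp_all add: su3_def su_iff)
  then have "conj_G z $ 1 $ 2 = cnj (z$2$3)" "conj_G z $ 1 $ 3 = cnj (z$1$3)" "conj_G z $ 2 $ 2 = z$2$2"
    "conj_G z $ 2 $ 3 = - cnj (z$1$2)" if "z \<in> su3" for z
    using that by (simp_all add: conj_G_entries)
  then show ?thesis
    using assms by (simp add: pullback_radial_0 pullback_radial_1 conj_G_su3 inner_complex_def)
qed

theorem proposition3p4:
  shows
    "\<comment> \<open>the Wolf space is \<open>Gr\<^sub>2(\<complex>\<^sup>4) = SU(4)/S(U(2) \<times> U(2))\<close>\<close>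
     K_grp = SU2U2 \<and>
     (\<exists>\<Psi>. bij_betw \<Psi> wolf Gr2 \<and>
       (\<forall>a\<in>SU. \<Psi> (coset a) = (\<lambda>z. a *v z) ` vec.span {axis 1 1, axis 4 1})) \<and>

     \<comment> \<open>cohomogeneity one\<close>
     (\<forall>a\<in>SU. principal_at (coset a) \<longrightarrow> dim (orbit_tangent a) + 1 = dim p_space) \<and>
     wolf = (\<Union>t\<in>{0..pi/2}. orbit (pt t)) \<and>
     (\<forall>s\<in>{0..pi/2}. \<forall>t\<in>{0..pi/2}. s \<noteq> t \<longrightarrow> orbit (pt s) \<inter> orbit (pt t) = {}) \<and>
     (\<forall>a\<in>SU. principal_at (coset a) \<longleftrightarrow> (\<exists>t\<in>{0<..<pi/2}. coset a \<in> orbit (pt t))) \<and>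
     (\<forall>a\<in>SU. singular_at a \<longleftrightarrow> coset a \<in> orbit (pt 0) \<union> orbit (pt (pi/2))) \<and>

     \<comment> \<open>both singular orbits are copies of \<open>CP(2) = SU(3)/U(2)\<close>\<close>
     (\<exists>F. equi_diffeo (hom_space U2) hom_act CP2 line_act F) \<and>
     (\<forall>t\<in>{0, pi/2}. \<exists>F. equi_diffeo (hom_space U2) hom_act (wolf_part (orbit (pt t))) act F) \<and>

     \<comment> \<open>gluing of two disc bundles over the singular orbits along a principal orbit\<close>
     (\<forall>c\<in>{0<..<pi/2}.
        let D0 = (\<Union>t\<in>{0..c}. orbit (pt t)); D1 = (\<Union>t\<in>{c..pi/2}. orbit (pt t)) in
        disc_bundle_over (pt 0) D0 (orbit (pt c)) \<and>
        disc_bundle_over (pt (pi/2)) D1 (orbit (pt c)) \<and>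
        wolf = D0 \<union> D1 \<and> D0 \<inter> D1 = orbit (pt c)) \<and>

     \<comment> \<open>the principal orbits\<close>
     (\<forall>Z\<in>wolf. principal_at Z \<longrightarrow>
        (\<exists>F. equi_diffeo (aloff_wallach 1 0) hom_act (wolf_part (orbit Z)) act F)) \<and>
     (\<exists>F. equi_diffeo (aloff_wallach 1 0) hom_act (aloff_wallach 1 (-1)) hom_act F) \<and>

     \<comment> \<open>the metric in the two bundles\<close>
     span (e_mat ` {1..8}) = su3 \<and>
     (\<exists>\<phi>. lie_automorphism su3 \<phi> \<and>
        \<phi> (e_mat 1) = - e_mat 1 \<and> \<phi> (e_mat 2) = e_mat 4 \<and> \<phi> (e_mat 3) = - e_mat 5 \<and>
        \<phi> (e_mat 4) = - e_mat 2 \<and> \<phi> (e_mat 5) = e_mat 3 \<and> \<phi> (e_mat 6) = e_mat 6 \<and>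
        \<phi> (e_mat 7) = - e_mat 7 \<and> \<phi> (e_mat 8) = e_mat 8 \<and>
        (\<forall>g\<in>SU. \<forall>g'\<in>SU. \<forall>t\<in>{0..<pi/2}. \<forall>x\<in>su3. \<forall>y\<in>su3. \<forall>\<sigma> \<tau>.
           pullback_metric radial_1 g' t (\<phi> x, \<sigma>) (\<phi> y, \<tau>) =
           pullback_metric radial_0 g t (x, \<sigma>) (y, \<tau>)))"
proof -
  have principal: "\<exists>F. equi_diffeo (aloff_wallach 1 0) hom_act (wolf_part (orbit Z)) act F"
    if pr: "Z \<in> wolf" "principal_at Z" for Z
  proof -
    obtain g t where Z: "g \<in> SU" "t \<in> {0..pi/2}" "Z = act g (pt t)"
      using pr(1) by (rule wolf_normalE)
    with pr(2) have "t \<in> {0<..<pi/2}"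
      using principal_at_iff by blast
    then show ?thesis
      unfolding Z(3) orbit_act [OF Z(1)] by (rule principal_orbit_diffeo)
  qed
  have codim: "dim (orbit_tangent a) + 1 = dim p_space" if "a \<in> SU" "principal_at (coset a)" for a
    using principal_dim [OF that] dim_hyper by simp
  have singular: "\<exists>F. equi_diffeo (hom_space U2) hom_act (wolf_part (orbit (pt t))) act F" if "t \<in> {0, pi/2}" for t
    using that singular_orbit_diffeo_0 singular_orbit_diffeo_pi2 by blast
  show ?thesis
    unfolding Let_def
    by (intro conjI ballI impI allI exI [of _ conj_G] K_grp_eq wolf_Gr2 codim wolf_eq_Union_orbits
        orbits_disjoint principal_iff_orbit singular_iff CP2_diffeo singular disc_bundles disc_bundles_glue
        principal aloff_wallach_diffeo span_e_mat lie_automorphism_conj_G conj_G_e_mat metric_conj_G)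
qed

end
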